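(* Let $n\in\mathbb{N}$, $n<\alpha<n+1$, and suppose $B$ is an $A^\alpha$-interpolating Blaschke product with zeros $\{z_j\}_{j\in\mathbb{N}}$. Let $d_j:=\inf\{|z_j-z_l|:\ l\in\mathbb{N}\setminus\{j\}\}$ for $j\in\mathbb{N}$, let $\mathcal{J}_k:=\{f\in A^\alpha:\ fB^k\in A^\alpha\}$ for $k\in\mathbb{N}$, and let $\mathcal{J}_{-1}:=\{f\in A^\alpha:\ f/B\in\Lambda^\alpha\}$. Given an integer $k$ with $n/2<k\le n$, one has $\mathcal{J}_k\subset\mathcal{J}_{-1}$ if and only if $$\sup_j\frac{d_j}{1-|z_j|}<\infty.$$
   Context: Notation: $\mathbb{N}=\{1,2,\dots\}$, $\mathbb{D}=\{z\in\mathbb{C}:|z|<1\}$, $\mathbb{T}=\partial\mathbb{D}$; $H^\infty$ is the algebra of bounded analytic functions on $\mathbb{D}$. For $\alpha>0$, $A^\alpha$ is the set of all $f\in H^\infty$ such that $|f^{(m)}(z)|=O((1-|z|)^{\alpha-m})$, $z\in\mathbb{D}$, for some (equivalently, any) integer $m>\alpha$. If $n<\alpha<n+1$ with $n$ a nonnegative integer, then for $f\in A^\alpha$ the derivatives $f,f',\dots,f^{(n)}$ extend continuously to $\mathrm{clos}\,\mathbb{D}$, and their values on $\mathbb{T}$ are understood in this sense. $\Lambda^\alpha=\Lambda^\alpha(\mathbb{T}):=A^\alpha+\overline{A^\alpha}$ (sums of boundary functions on $\mathbb{T}$ of functions in $A^\alpha$ and complex conjugates of such functions); equivalently, $\Lambda^\alpha$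 is the set of $f\in C(\mathbb{T})$ such that $\|\Delta_h^mf\|_\infty=O(|h|^\alpha)$, $h\in\mathbb{R}$, where $m$ is an integer with $m>\alpha$, $\|\cdot\|_\infty$ is the sup-norm on $\mathbb{T}$, $(\Delta_h^1f)(\zeta)=f(e^{ih}\zeta)-f(\zeta)$ and $\Delta_h^kf=\Delta_h^1\Delta_h^{k-1}f$. The condition $f/B\in\Lambda^\alpha$ refers to the (a.e. defined) boundary function of $f/B$ on $\mathbb{T}$. Blaschke product: for a sequence $\{z_j\}\subset\mathbb{D}$ with $\sum_j(1-|z_j|)<\infty$, the Blaschke product with zeros $\{z_j\}$ is $B(z)=\prod_j\frac{\bar z_j}{|z_j|}\frac{z_j-z}{1-\bar z_jz}$ (with the factor interpreted as $z$ if $z_j=0$). $A^\alpha$-interpolating sets (for $n<\alpha<n+1$, $n$ a nonnegative integer): a closed set $E\subset\mathrm{clos}\,\mathbb{D}$ is an $A^\alpha$-interpolating set if, for all functions $\varphi_0,\dots,\varphi_n:E\to\mathbb{C}$ satisfying, with some constant $C>0$, $$\left|\varphi_s(z)-\sum_{m=0}^{n-s}\frac{\varphi_{s+m}(w)}{m!}(z-w)^m\right|\le C|z-w|^{\alpha-s}\qquad(z,w\in E,\ s=0,\dots,n),$$ there exists $g\in A^\alpha$ with $g|_E=\varphi_0,\ g'|_E=\varphi_1,\ \dots,\ g^{(n)}|_E=\varphi_n$. A Blaschke product $B$ with zeros $\{z_j\}$ is an $A^\alpha$-interpolating Blaschke product if its zeros $z_j$ are all simple (so the $z_j$ are pairwise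 distinct) and $\mathrm{clos}\{z_j\}$ is an $A^\alpha$-interpolating set. *)

theory Defs
  imports "HOL-Complex_Analysis.Complex_Analysis"
begin

text \<open>
  Functions on the unit disc are represented by total functions on the complex plane; none of
  the notions below depends on the values outside the open disc. Likewise a function on the unit
  circle is a total function of which only the values on \<open>sphere 0 1\<close> matter. Sequences
  of zeros are indexed from 0.
\<close>

abbreviation unit_disc :: "complex set" (\<open>\<D>\<close>) where
  "\<D> \<equiv> ball 0 1"

definition H_infinity :: "(complex \<Rightarrow> complex) set" where
  "H_infinity = {f. f holomorphic_on \<D> \<and> bounded (f ` \<D>)}"

definition A_space :: "real \<Rightarrow> (complex \<Rightarrow> complex) set" where
  "A_space \<alpha> = {f \<in> H_infinity. \<exists>m::nat. real m > \<alpha> \<and>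
     (\<exists>C. \<forall>z\<in>\<D>. norm ((deriv ^^ m) f z) \<le> C * (1 - norm z) powr (\<alpha> - real m))}"

text \<open>
  The extension by continuity of a function on the disc to the closed disc. It is only used
  for functions that have such an extension, namely for the derivatives of order less than
  \<open>\<alpha>\<close> of members of \<open>A_space \<alpha>\<close> (with \<open>\<alpha>\<close> not an integer).
\<close>

definition disc_ext :: "(complex \<Rightarrow> complex) \<Rightarrow> complex \<Rightarrow> complex" where
  "disc_ext f z = (if z \<in> \<D> then f z else Lim (at z within \<D>) f)"

definition Lambda_space :: "real \<Rightarrow> (complex \<Rightarrow> complex) set" where
  "Lambda_space \<alpha> = {h. \<exists>f\<in>A_space \<alpha>. \<exists>g\<in>A_space \<alpha>.
     \<forall>\<zeta>\<in>sphere 0 1. h \<zeta> = disc_ext f \<zeta> + cnj (disc_ext g \<zeta>)}"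

text \<open>
  \<open>h\<close> is the almost everywhere defined boundary function of \<open>F\<close>, in the sense of radial limits.
\<close>

definition has_boundary_function ::
    "(complex \<Rightarrow> complex) \<Rightarrow> (complex \<Rightarrow> complex) \<Rightarrow> bool" where
  "has_boundary_function F h \<longleftrightarrow>
     (AE t in lebesgue_on {0..2*pi}.
        ((\<lambda>r. F (complex_of_real r * cis t)) \<longlongrightarrow> h (cis t)) (at_left 1))"

definition blaschke_seq :: "(nat \<Rightarrow> complex) \<Rightarrow> bool" where
  "blaschke_seq z \<longleftrightarrow> range z \<subseteq> \<D> \<and> summable (\<lambda>j. 1 - norm (z j))"

definition blaschke_factor :: "complex \<Rightarrow> complex \<Rightarrow> complex" where
  "blaschke_factor a w =
     (if a = 0 then w else cnj a / complex_of_real (norm a) * ((a - w) / (1 - cnj a * w)))"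

definition blaschke_product :: "(nat \<Rightarrow> complex) \<Rightarrow> complex \<Rightarrow> complex" where
  "blaschke_product z w = (\<Prod>j. blaschke_factor (z j) w)"

text \<open>In the next two definitions \<open>n\<close> is meant to be the integer with \<open>n < \<alpha> < n + 1\<close>.\<close>

definition A_interpolating_set :: "nat \<Rightarrow> real \<Rightarrow> complex set \<Rightarrow> bool" where
  "A_interpolating_set n \<alpha> E \<longleftrightarrow> closed E \<and> E \<subseteq> cball 0 1 \<and>
     (\<forall>\<phi> :: nat \<Rightarrow> complex \<Rightarrow> complex.
        (\<exists>C>0. \<forall>z\<in>E. \<forall>w\<in>E. \<forall>s\<le>n.
           norm (\<phi> s z - (\<Sum>m=0..n-s. \<phi> (s + m) w / fact m * (z - w) ^ m))
             \<le> C * norm (z - w) powr (\<alpha> - real s))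
        \<longrightarrow> (\<exists>g\<in>A_space \<alpha>. \<forall>s\<le>n. \<forall>z\<in>E. disc_ext ((deriv ^^ s) g) z = \<phi> s z))"

text \<open>
  A zero is repeated in \<open>z\<close> according to its multiplicity, so the zeros are simple exactly if
  \<open>z\<close> is injective.
\<close>

definition A_interpolating_blaschke ::
    "nat \<Rightarrow> real \<Rightarrow> (nat \<Rightarrow> complex) \<Rightarrow> (complex \<Rightarrow> complex) \<Rightarrow> bool" where
  "A_interpolating_blaschke n \<alpha> z B \<longleftrightarrow>
     blaschke_seq z \<and> B = blaschke_product z \<and> inj z \<and>
     A_interpolating_set n \<alpha> (closure (range z))"

definition sep_dist :: "(nat \<Rightarrow> complex) \<Rightarrow> nat \<Rightarrow> real" where
  "sep_dist z j = (INF l\<in>UNIV - {j}. norm (z j - z l))"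

definition J_mult :: "real \<Rightarrow> (complex \<Rightarrow> complex) \<Rightarrow> nat \<Rightarrow> (complex \<Rightarrow> complex) set" where
  "J_mult \<alpha> B k = {f \<in> A_space \<alpha>. (\<lambda>w. f w * B w ^ k) \<in> A_space \<alpha>}"

definition J_div :: "real \<Rightarrow> (complex \<Rightarrow> complex) \<Rightarrow> (complex \<Rightarrow> complex) set" where
  "J_div \<alpha> B = {f \<in> A_space \<alpha>.
     \<exists>h\<in>Lambda_space \<alpha>. has_boundary_function (\<lambda>w. f w / B w) h}"

end

theory Submission
  imports Defs
begin

text \<open>
  Interpolating the jets \<open>0, ..., 0, c j\<close> at the zeros produces a function \<open>g\<close> for which
  \<open>g(w) (1 - cnj (z j) w) powr (-\<alpha>)\<close> is bounded uniformly in \<open>j\<close>; dividing it by finite subproducts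
  of \<open>B\<close> gives the Carleson condition. This makes every finite subproduct bounded below off small
  discs around its zeros and, by reflection in the circle, bounded on discs that stick out of the
  unit disc, uniformly in the subproduct. With local Taylor polynomials, Cauchy estimates on such
  discs decide when \<open>f B\<^sup>k\<close> or \<open>f / B\<close> is smooth; passing to the limit is Montel's theorem.

  If \<open>f / B\<close> lies in \<open>\<Lambda>\<^sup>\<alpha>\<close>, then \<open>f (z j) = O((1 - |z j|) powr \<alpha>)\<close>, as one sees by integrating
  \<open>f - B g = B cnj h\<close> against a kernel concentrated near \<open>z j\<close>. If \<open>d j / (1 - |z j|)\<close> is unbounded,
  this fails for the interpolating function \<open>f\<close> that agrees to order \<open>n\<close> at \<open>z j\<close> with
  \<open>d j powr (\<alpha> - k) (1 - cnj (z j) w)\<^sup>k\<close>; the power cancels the poles of \<open>B\<^sup>k\<close>, so \<open>f B\<^sup>k\<close> is smooth.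

  If \<open>d j = O(1 - |z j|)\<close>, then \<open>f B\<^sup>k\<close> vanishes to order \<open>k\<close> at two zeros at distance comparable with
  \<open>1 - |z j|\<close>. Since \<open>2 k > n\<close>, this controls its Taylor polynomial of degree \<open>n\<close>, so that \<open>f B\<^sup>k\<close> and
  hence \<open>f\<close> is \<open>O((1 - |z j|) powr \<alpha>)\<close> near \<open>z j\<close>. Then the principal parts of \<open>f / B\<close> sum up to
  \<open>cnj h\<close> on the circle with \<open>h \<in> A\<^sup>\<alpha>\<close>, and the rest of \<open>f / B\<close> belongs to \<open>A\<^sup>\<alpha>\<close>.
\<close>

subsection \<open>Taylor polynomials\<close>

text \<open>The zeros may accumulate on the circle, so \<open>B\<close> itself need not continue
  across it; this is why the estimates concern finite subproducts, with constants that do not depend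
  on the subproduct. Discs inside the unit disc would not be enough. Typically the Taylor polynomial
  of \<open>f\<close> at \<open>w\<close> is only of size \<open>D powr \<alpha>\<close>, where
  \<open>D\<close> measures the distance to the nearest zero and may be much larger than
  \<open>1 - norm w\<close>. Cauchy's estimate on a disc of radius comparable with \<open>D\<close>
  gives \<open>D powr (\<alpha> - m)\<close>, which is at most
  \<open>(1 - norm w) powr (\<alpha> - m)\<close> because \<open>m > \<alpha>\<close>. The Taylor
  remainder is already of size \<open>(1 - norm w) powr \<alpha>\<close> and needs only the small
  disc. The order of differentiation is \<open>n + 1\<close> for \<open>f\<close> times a power of
  the product, but \<open>n + 2\<close> for the quotient: the sum over all principal parts is
  compared with a Carleson sum whose kernel has exponent 2, and the power left over must have a
  negative exponent.\<close>

definition taylor_poly :: "(nat \<Rightarrow> complex) \<Rightarrow> nat \<Rightarrow> complex \<Rightarrow> complex \<Rightarrow> complex" where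
  "taylor_poly a N v z = (\<Sum>i\<le>N. a i * (z - v) ^ i / fact i)"

lemma taylor_poly_0 [simp]: "taylor_poly a 0 v z = a 0"
  by (simp add: taylor_poly_def)

lemma taylor_poly_center [simp]: "taylor_poly a N v v = a 0"
  by (induction N) (auto simp: taylor_poly_def)

text \<open>The coefficients \<open>a\<close> are derivatives at the centre rather than monomial
  coefficients, so differentiation is a mere shift of \<open>a\<close>.\<close>

lemma has_field_derivative_taylor_poly:
  "(taylor_poly a (Suc N) v has_field_derivative taylor_poly (\<lambda>i. a (Suc i)) N v z) (at z)"
proof (induction N)
  case 0
  have "(\<lambda>z. a 0 + a 1 * (z - v)) = taylor_poly a (Suc 0) v"
    by (auto simp: taylor_poly_def)
  moreover have "((\<lambda>z. a 0 + a 1 * (z - v)) has_field_derivative a 1) (at z)"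
    by (auto intro!: derivative_eq_intros)
  ultimately show ?case by simp
next
  case (Suc N)
  let ?N = "Suc (Suc N)"
  have e1: "(\<lambda>z. taylor_poly a (Suc N) v z + a ?N * (z - v) ^ ?N / fact ?N) = taylor_poly a ?N v"
    by (auto simp: taylor_poly_def)
  have e2: "taylor_poly (\<lambda>i. a (Suc i)) (Suc N) v z =
      taylor_poly (\<lambda>i. a (Suc i)) N v z + a ?N * (z - v) ^ Suc N / fact (Suc N)"
    by (simp add: taylor_poly_def)
  have e3: "((\<lambda>z. a ?N * (z - v) ^ ?N / fact ?N) has_field_derivative
      a ?N * (of_nat ?N * (z - v) ^ Suc N) / fact ?N) (at z)"
  proof (intro DERIV_cdivide DERIV_cmult)
    show "((\<lambda>z. (z - v) ^ ?N) has_field_derivative of_nat ?N * (z - v) ^ Suc N) (at z)"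
      by (rule DERIV_cong[OF DERIV_power[OF DERIV_diff[OF DERIV_ident DERIV_const]]]) simp
  qed
  have e4: "a ?N * (of_nat ?N * (z - v) ^ Suc N) / fact ?N = a ?N * (z - v) ^ Suc N / fact (Suc N)"
    unfolding fact_Suc[of "Suc N"] of_nat_mult
    using of_nat_neq_0[of "Suc N", where ?'a = complex] by (simp del: of_nat_Suc fact_Suc power_Suc)
  show ?case
    unfolding e1[symmetric] e2 by (rule DERIV_add[OF Suc e3[unfolded e4]])
qed

lemma deriv_taylor_poly: "deriv (taylor_poly a (Suc N) v) = taylor_poly (\<lambda>i. a (Suc i)) N v"
  using DERIV_imp_deriv[OF has_field_derivative_taylor_poly] by blast

lemma holomorphic_taylor_poly [holomorphic_intros]: "taylor_poly a N v holomorphic_on S"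
  unfolding taylor_poly_def by (intro holomorphic_intros) auto

lemma higher_deriv_taylor_poly:
  "s \<le> N \<Longrightarrow> (deriv ^^ s) (taylor_poly a N v) z = taylor_poly (\<lambda>i. a (i + s)) (N - s) v z"
proof (induction s arbitrary: a N)
  case (Suc s)
  then obtain N' where N: "N = Suc N'" by (cases N) auto
  show ?case using Suc
    by (simp add: N funpow_Suc_right deriv_taylor_poly del: funpow.simps)
qed simp

text \<open>By the induction hypothesis for the shifted coefficients both sides have the same
  derivative, and they agree at \<open>w\<close>.\<close>

lemma taylor_poly_recenter:
  "taylor_poly a N v z = taylor_poly (\<lambda>s. taylor_poly (\<lambda>i. a (i + s)) (N - s) v w) N w z"
proof (induction N arbitrary: a z)
  case 0
  then show ?case by simp
next
  case (Suc N)
  define r where "r = (\<lambda>z. taylor_poly a (Suc N) v z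
      - taylor_poly (\<lambda>s. taylor_poly (\<lambda>i. a (i + s)) (Suc N - s) v w) (Suc N) w z)"
  have "(r has_field_derivative 0) (at x within UNIV)" for x
  proof -
    have "(r has_field_derivative taylor_poly (\<lambda>i. a (Suc i)) N v x -
       taylor_poly (\<lambda>s. taylor_poly (\<lambda>i. a (i + Suc s)) (Suc N - Suc s) v w) N w x) (at x)"
      unfolding r_def by (intro DERIV_diff has_field_derivative_taylor_poly)
    then show ?thesis using Suc[of "\<lambda>i. a (Suc i)" x] by simp
  qed
  then obtain c where c: "\<And>x. r x = c"
    using has_field_derivative_zero_constant[of UNIV r] by auto
  have "r w = 0" unfolding r_def by simp
  then show ?case using c[of w] c[of z] by (simp add: r_def)
qed

lemma norm_taylor_poly_le: "norm (taylor_poly a N v z) \<le> (\<Sum>i\<le>N. norm (a i) * norm (z - v) ^ i)"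
  unfolding taylor_poly_def
proof (rule order_trans[OF norm_sum sum_mono])
  fix i
  have "norm (a i * (z - v) ^ i / fact i) = norm (a i) * norm (z - v) ^ i / fact i"
    by (simp add: norm_mult norm_divide norm_power)
  also have "\<dots> \<le> norm (a i) * norm (z - v) ^ i / 1"
    by (intro divide_left_mono) auto
  finally show "norm (a i * (z - v) ^ i / fact i) \<le> norm (a i) * norm (z - v) ^ i" by simp
qed

text \<open>Homogeneity: a coefficient of order \<open>i\<close> has size
  \<open>D powr (\<alpha> - i)\<close>, so each term contributes the same amount. All later bounds
  on jets are put into this form.\<close>

lemma norm_taylor_poly_le_powr:
  assumes "\<And>i. i \<le> N \<Longrightarrow> norm (a i) \<le> K * D powr (\<alpha> - real i)" "norm (z - v) \<le> D" "D > 0"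
  shows "norm (taylor_poly a N v z) \<le> real (Suc N) * (K * D powr \<alpha>)"
proof -
  have "norm (a i) * norm (z - v) ^ i \<le> K * D powr \<alpha>" if "i \<le> N" for i
  proof -
    have "norm (a i) * norm (z - v) ^ i \<le> (K * D powr (\<alpha> - real i)) * D ^ i"
      using assms that by (intro mult_mono power_mono) (auto intro: order_trans[OF norm_ge_zero])
    also have "\<dots> = K * D powr \<alpha>"
      using \<open>D > 0\<close> by (simp add: powr_diff powr_realpow)
    finally show ?thesis .
  qed
  then have "(\<Sum>i\<le>N. norm (a i) * norm (z - v) ^ i) \<le> (\<Sum>i\<le>N. K * D powr \<alpha>)"
    by (intro sum_mono) auto
  then show ?thesis using norm_taylor_poly_le[of a N v z] by simp
qed

subsection \<open>Estimates for derivatives\<close>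

text \<open>Cauchy's inequality on the circle of half the radius, because nothing is assumed on the
  boundary of the ball; hence the factor 2.\<close>

lemma norm_higher_deriv_ball_le:
  assumes "f holomorphic_on ball w r" "0 < r" "\<And>z. z \<in> ball w r \<Longrightarrow> norm (f z) \<le> M"
  shows "norm ((deriv ^^ m) f w) \<le> fact m * M * (2 / r) ^ m"
proof -
  have "norm ((deriv ^^ m) f w) \<le> fact m * M / (r / 2) ^ m"
  proof (rule Cauchy_inequality)
    show "f holomorphic_on ball w (r / 2)"
      using assms by (auto intro: holomorphic_on_subset)
    show "continuous_on (cball w (r / 2)) f"
      using assms by (intro holomorphic_on_imp_continuous_on[OF holomorphic_on_subset]) auto
    show "norm (f x) \<le> M" if "norm (w - x) = r / 2" for x
      using assms that by (auto simp: dist_norm)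
  qed (use assms in auto)
  then show ?thesis by (simp add: power_divide)
qed

text \<open>The majorant is integrated along the radius from 0 to \<open>z\<close>. As
  \<open>\<beta> < 0\<close>, the weight is at least 1, which absorbs the constant
  \<open>G 0\<close>.\<close>

lemma growth_antiderivative:
  assumes "G holomorphic_on \<D>" "\<beta> < 0"
    and C: "\<And>z. z \<in> \<D> \<Longrightarrow> norm (deriv G z) \<le> C * (1 - norm z) powr (\<beta> - 1)"
  obtains C' where "\<And>z. z \<in> \<D> \<Longrightarrow> norm (G z) \<le> C' * (1 - norm z) powr \<beta>"
proof
  fix z :: complex assume z: "z \<in> \<D>"
  have C0: "C \<ge> 0" using order_trans[OF norm_ge_zero C[of 0]] by simp
  define \<phi> where "\<phi> = (\<lambda>t. C / (- \<beta>) * (1 - t * norm z) powr \<beta>)"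
  have pos: "1 - t * norm z > 0" "t *\<^sub>R z \<in> \<D>" if "0 \<le> t" "t \<le> 1" for t
  proof -
    have "t * norm z \<le> norm z" using that by (simp add: mult_left_le_one_le)
    then show "1 - t * norm z > 0" "t *\<^sub>R z \<in> \<D>" using z that by auto
  qed
  have "norm (G (1 *\<^sub>R z) - G (0 *\<^sub>R z)) \<le> \<phi> 1 - \<phi> 0"
  proof (rule differentiable_bound_general[where f' = "\<lambda>t. z * deriv G (t *\<^sub>R z)"
        and \<phi>' = "\<lambda>t. norm z * (C * (1 - t * norm z) powr (\<beta> - 1))"])
    show "continuous_on {0..1} (\<lambda>t. G (t *\<^sub>R z))"
      using pos by (intro continuous_on_compose2[OF holomorphic_on_imp_continuous_on[OF assms(1)]]
         continuous_intros) auto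
    show "continuous_on {0..1} \<phi>"
      unfolding \<phi>_def
    proof (intro continuous_intros ballI)
      show "1 - t * norm z \<noteq> 0" if "t \<in> {0..1}" for t using pos(1)[of t] that by auto
    qed
    fix t :: real assume t: "0 < t" "t < 1"
    have "(G has_field_derivative deriv G (t *\<^sub>R z)) (at (t *\<^sub>R z))"
      using pos[of t] t assms(1) by (intro holomorphic_derivI[of G \<D>]) auto
    moreover have "((\<lambda>t. t *\<^sub>R z) has_vector_derivative z) (at t)"
      by (auto simp: has_vector_derivative_def intro!: derivative_eq_intros)
    ultimately    show "((\<lambda>t. G (t *\<^sub>R z)) has_vector_derivative z * deriv G (t *\<^sub>R z)) (at t)"
      using field_vector_diff_chain_at by (fastforce simp: o_def)
    show "(\<phi> has_vector_derivative norm z * (C * (1 - t * norm z) powr (\<beta> - 1))) (at t)"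
      unfolding \<phi>_def has_real_derivative_iff_has_vector_derivative[symmetric]
      using pos[of t] t \<open>\<beta> < 0\<close> by (auto intro!: derivative_eq_intros simp: powr_diff)
    show "norm (z * deriv G (t *\<^sub>R z)) \<le> norm z * (C * (1 - t * norm z) powr (\<beta> - 1))"
      using C[OF pos(2)[of t]] t by (simp add: norm_mult mult_left_mono)
  qed auto
  then have "norm (G z - G 0) \<le> C / (- \<beta>) * (1 - norm z) powr \<beta> - C / (- \<beta>)"
    by (simp add: \<phi>_def)
  moreover have "norm (G z) \<le> norm (G 0) + norm (G z - G 0)" by (metis norm_triangle_sub)
  moreover have "C / (- \<beta>) \<ge> 0" using C0 \<open>\<beta> < 0\<close> by (intro divide_nonneg_pos) auto
  ultimately have "norm (G z) \<le> norm (G 0) * 1 + C / (- \<beta>) * (1 - norm z) powr \<beta>" by linarith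
  also have "\<dots> \<le> norm (G 0) * (1 - norm z) powr \<beta> + C / (- \<beta>) * (1 - norm z) powr \<beta>"
  proof -
    have "(1 - norm z) powr \<beta> \<ge> 1" using z \<open>\<beta> < 0\<close> powr_mono2'[of \<beta> "1 - norm z" 1] by auto
    then show ?thesis using mult_left_mono[of 1 "(1 - norm z) powr \<beta>" "norm (G 0)"] by simp
  qed
  finally show "norm (G z) \<le> (norm (G 0) + C / (- \<beta>)) * (1 - norm z) powr \<beta>"
    by (simp only: distrib_right)
qed

lemma hoelder_radial:
  assumes "G holomorphic_on \<D>" "0 < \<beta>" "\<beta> < 1"
    and C: "\<And>z. z \<in> \<D> \<Longrightarrow> norm (deriv G z) \<le> C * (1 - norm z) powr (\<beta> - 1)"
    and z: "z \<in> \<D>" and \<tau>: "0 < \<tau>" "\<tau> \<le> 1"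
  shows "norm (G ((1 - \<tau>) *\<^sub>R z) - G z) \<le> C / \<beta> * \<tau> powr \<beta>"
proof -
  have C0: "C \<ge> 0" using order_trans[OF norm_ge_zero C[of 0]] by simp
  have pos: "1 - (1 - t) * norm z \<ge> t" "(1 - t) *\<^sub>R z \<in> \<D>" if "0 \<le> t" "t \<le> 1" for t
  proof -
    have "(1 - t) * norm z \<le> 1 - t" using that z by (simp add: mult_left_le)
    then show "1 - (1 - t) * norm z \<ge> t" by simp
    have "(1 - t) * norm z \<le> norm z" using that by (simp add: mult_left_le_one_le)
    then show "(1 - t) *\<^sub>R z \<in> \<D>" using z that by auto
  qed
  have "norm (G ((1 - \<tau>) *\<^sub>R z) - G ((1 - 0) *\<^sub>R z)) \<le> C / \<beta> * \<tau> powr \<beta> - C / \<beta> * 0 powr \<beta>"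
  proof (rule differentiable_bound_general[where f' = "\<lambda>t. - z * deriv G ((1 - t) *\<^sub>R z)"
        and \<phi>' = "\<lambda>t. C * t powr (\<beta> - 1)"])
    show "continuous_on {0..\<tau>} (\<lambda>t. G ((1 - t) *\<^sub>R z))"
      using pos \<tau> by (intro continuous_on_compose2[OF holomorphic_on_imp_continuous_on[OF assms(1)]]
         continuous_intros) auto
    show "continuous_on {0..\<tau>} (\<lambda>t. C / \<beta> * t powr \<beta>)"
      using \<open>0 < \<beta>\<close> by (intro continuous_on_mult continuous_on_powr' continuous_intros) auto
    fix t :: real assume t: "0 < t" "t < \<tau>"
    have "(G has_field_derivative deriv G ((1 - t) *\<^sub>R z)) (at ((1 - t) *\<^sub>R z))"
      using pos[of t] t \<tau> assms(1) by (intro holomorphic_derivI[of G \<D>]) auto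
    moreover have "((\<lambda>t. (1 - t) *\<^sub>R z) has_vector_derivative - z) (at t)"
      by (auto simp: has_vector_derivative_def scaleR_diff_left intro!: derivative_eq_intros)
    ultimately    show "((\<lambda>t. G ((1 - t) *\<^sub>R z)) has_vector_derivative - z * deriv G ((1 - t) *\<^sub>R z)) (at t)"
      using field_vector_diff_chain_at by (fastforce simp: o_def)
    show "((\<lambda>t. C / \<beta> * t powr \<beta>) has_vector_derivative C * t powr (\<beta> - 1)) (at t)"
      unfolding has_real_derivative_iff_has_vector_derivative[symmetric]
      using t \<open>0 < \<beta>\<close> by (auto intro!: derivative_eq_intros simp: powr_diff)
    have "norm (deriv G ((1 - t) *\<^sub>R z)) \<le> C * (1 - norm ((1 - t) *\<^sub>R z)) powr (\<beta> - 1)"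
      using pos(2)[of t] t \<tau> by (intro C) auto
    also have "\<dots> \<le> C * t powr (\<beta> - 1)"
      using pos(1)[of t] t \<tau> C0 \<open>\<beta> < 1\<close> by (intro mult_left_mono powr_mono2') auto
    finally have "norm (deriv G ((1 - t) *\<^sub>R z)) \<le> C * t powr (\<beta> - 1)" .
    then have "norm z * norm (deriv G ((1 - t) *\<^sub>R z)) \<le> 1 * (C * t powr (\<beta> - 1))"
      using z by (intro mult_mono) auto
    then show "norm (- z * deriv G ((1 - t) *\<^sub>R z)) \<le> C * t powr (\<beta> - 1)"
      by (simp add: norm_mult)
  qed (use \<tau> in auto)
  then show ?thesis using \<open>0 < \<beta>\<close> by simp
qed

text \<open>Hardy and Littlewood: move from both points towards the centre by about their distance and
  compare the values there.\<close>

lemma hoelder_of_deriv_growth: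
  assumes "G holomorphic_on \<D>" "0 < \<beta>" "\<beta> < 1"
    and C: "\<And>z. z \<in> \<D> \<Longrightarrow> norm (deriv G z) \<le> C * (1 - norm z) powr (\<beta> - 1)"
    and z: "z \<in> \<D>" and w: "w \<in> \<D>"
  shows "norm (G z - G w) \<le> (C + 2 * C / \<beta>) * norm (z - w) powr \<beta>"
proof (cases "z = w")
  case False
  have C0: "C \<ge> 0" using order_trans[OF norm_ge_zero C[of 0]] by simp
  \<comment> \<open>The distance can exceed 1; the cut-off keeps the factor
    \<open>1 - \<tau>\<close> nonnegative. For \<open>\<tau> = 1\<close> both points move to
    0.\<close>
  define \<tau> where "\<tau> = min 1 (norm (z - w))"
  have \<tau>: "0 < \<tau>" "\<tau> \<le> 1" "\<tau> \<le> norm (z - w)" using False by (auto simp: \<tau>_def)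
  define z' w' where "z' = (1 - \<tau>) *\<^sub>R z" and "w' = (1 - \<tau>) *\<^sub>R w"
  have pow: "\<tau> powr \<beta> \<le> norm (z - w) powr \<beta>" using \<tau> \<open>0 < \<beta>\<close> by (intro powr_mono2) auto
  have rad: "norm (G ((1 - \<tau>) *\<^sub>R x) - G x) \<le> C / \<beta> * norm (z - w) powr \<beta>" if "x \<in> \<D>" for x
  proof -
    have "C / \<beta> * \<tau> powr \<beta> \<le> C / \<beta> * norm (z - w) powr \<beta>"
      using pow C0 \<open>0 < \<beta>\<close> by (intro mult_left_mono) auto
    with hoelder_radial[OF assms(1-3) C that \<tau>(1,2)] show ?thesis by linarith
  qed
  have mid: "norm (G z' - G w') \<le> C * norm (z - w) powr \<beta>"
  proof (cases "\<tau> = 1")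
    case True
    then show ?thesis using C0 by (simp add: z'_def w'_def)
  next
    case False
    then have \<tau>': "\<tau> = norm (z - w)" "\<tau> < 1" by (auto simp: \<tau>_def min_def split: if_splits)
    have sub: "u \<in> \<D>" "\<tau> \<le> 1 - norm u" if "u \<in> cball 0 (1 - \<tau>)" for u :: complex
      using that \<tau> by auto
    have "norm (G z' - G w') \<le> (C * \<tau> powr (\<beta> - 1)) * norm (z' - w')"
    proof (rule field_differentiable_bound[of "cball 0 (1 - \<tau>)" G "deriv G"])
      fix u assume u: "u \<in> cball (0::complex) (1 - \<tau>)"
      show "(G has_field_derivative deriv G u) (at u within cball 0 (1 - \<tau>))"
        using sub[OF u] assms(1)
        by (intro has_field_derivative_at_within[OF holomorphic_derivI[of G \<D>]]) auto
      have "C * (1 - norm u) powr (\<beta> - 1) \<le> C * \<tau> powr (\<beta> - 1)"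
        using sub(2)[OF u] \<tau> C0 \<open>\<beta> < 1\<close> by (intro mult_left_mono powr_mono2') auto
      then show "norm (deriv G u) \<le> C * \<tau> powr (\<beta> - 1)"
        using C[OF sub(1)[OF u]] by linarith
    next
      show "z' \<in> cball 0 (1 - \<tau>)" "w' \<in> cball 0 (1 - \<tau>)"
        using z w \<tau> by (auto simp: z'_def w'_def mult_left_le)
    qed auto
    also have "norm (z' - w') = (1 - \<tau>) * \<tau>"
      using \<tau> \<tau>' by (simp add: z'_def w'_def flip: scaleR_diff_right)
    also have "C * \<tau> powr (\<beta> - 1) * ((1 - \<tau>) * \<tau>) \<le> C * \<tau> powr (\<beta> - 1) * (1 * \<tau>)"
      using \<tau> C0 by (intro mult_left_mono mult_right_mono) auto
    also have "\<dots> = C * \<tau> powr \<beta>" using \<tau> by (simp add: powr_diff)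
    finally show ?thesis by (simp add: \<tau>')
  qed
  have "norm (G z - G w) \<le> norm (G z' - G z) + norm (G z' - G w') + norm (G w' - G w)"
    by norm
  also have "\<dots> \<le> C / \<beta> * norm (z - w) powr \<beta> + C * norm (z - w) powr \<beta> + C / \<beta> * norm (z - w) powr \<beta>"
    using rad[OF z] rad[OF w] mid unfolding z'_def w'_def by (intro add_mono) auto
  also have "\<dots> = (C + 2 * C / \<beta>) * norm (z - w) powr \<beta>" by (simp add: field_simps)
  finally show ?thesis .
qed simp

subsection \<open>The spaces \<open>A_space \<alpha>\<close>\<close>

lemma A_spaceI:
  assumes "f holomorphic_on \<D>" "\<And>z. z \<in> \<D> \<Longrightarrow> norm (f z) \<le> C" "real m > \<alpha>"
    "\<And>z. z \<in> \<D> \<Longrightarrow> norm ((deriv ^^ m) f z) \<le> M * (1 - norm z) powr (\<alpha> - real m)"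
  shows "f \<in> A_space \<alpha>"
proof -
  have "bounded (f ` \<D>)" using assms(2) by (intro boundedI[of _ C]) auto
  with assms show ?thesis
    unfolding A_space_def H_infinity_def by (intro CollectI conjI exI[of _ m] exI[of _ M]) auto
qed

lemma A_space_holomorphic: "f \<in> A_space \<alpha> \<Longrightarrow> f holomorphic_on \<D>"
  by (auto simp: A_space_def H_infinity_def)

lemma A_space_boundedE:
  assumes "f \<in> A_space \<alpha>"
  obtains C where "C > 0" "\<And>z. z \<in> \<D> \<Longrightarrow> norm (f z) \<le> C"
proof -
  have "bounded (f ` \<D>)" using assms by (auto simp: A_space_def H_infinity_def)
  then obtain C where "C > 0" "\<forall>x\<in>f ` \<D>. norm x \<le> C" by (auto simp: bounded_pos)
  then show ?thesis using that by auto
qed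

lemma A_space_cong:
  assumes "f \<in> A_space \<alpha>" "\<And>z. z \<in> \<D> \<Longrightarrow> f z = g z"
  shows "g \<in> A_space \<alpha>"
proof -
  have "(deriv ^^ m) f z = (deriv ^^ m) g z" if "z \<in> \<D>" for m z
  proof (rule higher_deriv_cong_ev)
    show "\<forall>\<^sub>F x in nhds z. f x = g x"
      using that assms(2) by (intro eventually_mono[OF eventually_nhds_in_open[of \<D>]]) auto
  qed simp
  moreover have "f ` \<D> = g ` \<D>" using assms(2) by (intro image_cong) auto
  moreover have "f holomorphic_on \<D> \<longleftrightarrow> g holomorphic_on \<D>"
    using assms(2) by (intro holomorphic_cong) auto
  ultimately show ?thesis
    using assms(1) by (auto simp: A_space_def H_infinity_def)
qed

text \<open>The definition supplies a growth bound for some order only.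
  \<open>growth_antiderivative\<close> lowers it one derivative at a time down to the least
  admissible \<open>m\<close>; the exponents stay negative on the way.\<close>

lemma A_space_derivE:
  assumes f: "f \<in> A_space \<alpha>" and \<alpha>: "\<alpha> < real m"
    and m: "\<And>m'. real m' > \<alpha> \<Longrightarrow> m \<le> m'"
  obtains C where "\<And>z. z \<in> \<D> \<Longrightarrow> norm ((deriv ^^ m) f z) \<le> C * (1 - norm z) powr (\<alpha> - real m)"
proof -
  have "\<exists>C. \<forall>z\<in>\<D>. norm ((deriv ^^ m) f z) \<le> C * (1 - norm z) powr (\<alpha> - real m)"
    if "\<exists>C. \<forall>z\<in>\<D>. norm ((deriv ^^ (m + d)) f z) \<le> C * (1 - norm z) powr (\<alpha> - real (m + d))" for d
    using that
  proof (induction d)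
    case (Suc d)
    then obtain C where "\<forall>z\<in>\<D>. norm ((deriv ^^ (m + Suc d)) f z) \<le> C * (1 - norm z) powr (\<alpha> - real (m + Suc d))"
      by blast
    then have "norm (deriv ((deriv ^^ (m + d)) f) z) \<le> C * (1 - norm z) powr (\<alpha> - real (m + d) - 1)"
      if "z \<in> \<D>" for z
      using that by (simp add: algebra_simps)
    from growth_antiderivative[OF holomorphic_higher_deriv _ this]
    obtain C' where "\<And>z. z \<in> \<D> \<Longrightarrow> norm ((deriv ^^ (m + d)) f z) \<le> C' * (1 - norm z) powr (\<alpha> - real (m + d))"
      using A_space_holomorphic[OF f] \<alpha> by auto
    then show ?case using Suc.IH by blast
  qed simp
  moreover obtain m' where "real m' > \<alpha>"
    "\<exists>C. \<forall>z\<in>\<D>. norm ((deriv ^^ m') f z) \<le> C * (1 - norm z) powr (\<alpha> - real m')"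
    using f by (auto simp: A_space_def)
  moreover have "m' = m + (m' - m)" using m[of m'] calculation by auto
  ultimately have "\<exists>C. \<forall>z\<in>\<D>. norm ((deriv ^^ m) f z) \<le> C * (1 - norm z) powr (\<alpha> - real m)"
    by metis
  then show ?thesis using that by blast
qed

abbreviation taylor :: "(complex \<Rightarrow> complex) \<Rightarrow> nat \<Rightarrow> complex \<Rightarrow> complex \<Rightarrow> complex" where
  "taylor f n w \<equiv> taylor_poly (\<lambda>i. (deriv ^^ i) f w) n w"

text \<open>The compatibility condition of \<open>A_interpolating_set\<close>, for the jets of
  \<open>f\<close> at all points of the disc.\<close>

definition taylor_bound :: "nat \<Rightarrow> real \<Rightarrow> real \<Rightarrow> (complex \<Rightarrow> complex) \<Rightarrow> bool" where
  "taylor_bound n \<alpha> C f \<longleftrightarrow> C > 0 \<and> (\<forall>s\<le>n. \<forall>x\<in>\<D>. \<forall>w\<in>\<D>.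
     norm ((deriv ^^ s) f x - taylor_poly (\<lambda>i. (deriv ^^ (i + s)) f w) (n - s) w x)
       \<le> C * norm (x - w) powr (\<alpha> - real s))"

lemma taylor_boundD:
  assumes "taylor_bound n \<alpha> C f"
  shows "C > 0" "\<And>s x w. s \<le> n \<Longrightarrow> x \<in> \<D> \<Longrightarrow> w \<in> \<D> \<Longrightarrow>
    norm ((deriv ^^ s) f x - taylor_poly (\<lambda>i. (deriv ^^ (i + s)) f w) (n - s) w x)
      \<le> C * norm (x - w) powr (\<alpha> - real s)"
  using assms by (auto simp: taylor_bound_def)

text \<open>The top order is the Hoelder estimate for the \<open>n\<close>-th derivative, whose
  exponent \<open>\<alpha> - n\<close> lies in (0,1). The lower orders follow downwards: the
  derivative of one remainder is the remainder of the next order, and it is integrated along a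
  segment.\<close>

lemma A_space_taylor:
  assumes f: "f \<in> A_space \<alpha>" and \<alpha>: "real n < \<alpha>" "\<alpha> < real n + 1"
  obtains C where "taylor_bound n \<alpha> C f"
proof -
  have holf: "(deriv ^^ s) f holomorphic_on \<D>" for s
    using A_space_holomorphic[OF f] by (intro holomorphic_higher_deriv) auto
  obtain C1 where C1: "\<And>z. z \<in> \<D> \<Longrightarrow> norm ((deriv ^^ Suc n) f z) \<le> C1 * (1 - norm z) powr (\<alpha> - real (Suc n))"
  proof (rule A_space_derivE[OF f])
    show "\<alpha> < real (Suc n)" using \<alpha> by simp
    show "Suc n \<le> m'" if "real m' > \<alpha>" for m' using \<alpha> that by linarith
  qed (rule that)
  define C where "C = max 1 (C1 + 2 * C1 / (\<alpha> - real n))"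
  have "norm ((deriv ^^ n) f z - (deriv ^^ n) f w) \<le> C * norm (z - w) powr (\<alpha> - real n)"
    if "z \<in> \<D>" "w \<in> \<D>" for z w
  proof -
    have "norm ((deriv ^^ n) f z - (deriv ^^ n) f w)
        \<le> (C1 + 2 * C1 / (\<alpha> - real n)) * norm (z - w) powr (\<alpha> - real n)"
      using C1 \<alpha> that by (intro hoelder_of_deriv_growth holf) (auto simp: algebra_simps)
    also have "\<dots> \<le> C * norm (z - w) powr (\<alpha> - real n)"
      by (intro mult_right_mono) (auto simp: C_def)
    finally show ?thesis .
  qed
  note top = this
  have "norm ((deriv ^^ (n - d)) f z - taylor_poly (\<lambda>i. (deriv ^^ (i + (n - d))) f w) d w z)
      \<le> C * norm (z - w) powr (\<alpha> - real (n - d))" if "d \<le> n" "z \<in> \<D>" "w \<in> \<D>" for d z w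
    using that
  proof (induction d arbitrary: z)
    case 0
    then show ?case using top by simp
  next
    case (Suc d)
    define s where "s = n - Suc d"
    have s: "n - d = Suc s" using Suc.prems by (simp add: s_def)
    define T where "T = (\<lambda>i. (deriv ^^ (i + s)) f w)"
    define R where "R = (\<lambda>z. (deriv ^^ s) f z - taylor_poly T (Suc d) w z)"
    define R' where "R' = (\<lambda>z. (deriv ^^ Suc s) f z - taylor_poly (\<lambda>i. T (Suc i)) d w z)"
    have seg: "closed_segment w z \<subseteq> \<D>"
      using Suc.prems by (intro closed_segment_subset) auto
    have "norm (R z - R w) \<le> (C * norm (z - w) powr (\<alpha> - real (Suc s))) * norm (z - w)"
    proof (rule field_differentiable_bound[of "closed_segment w z" R R'])
      fix x assume x: "x \<in> closed_segment w z"
      have xD: "x \<in> \<D>" using x seg by auto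
      have "((deriv ^^ s) f has_field_derivative (deriv ^^ Suc s) f x) (at x)"
        using xD by (auto intro!: holomorphic_derivI[OF holf])
      then show "(R has_field_derivative R' x) (at x within closed_segment w z)"
        unfolding R_def R'_def
        by (intro has_field_derivative_at_within[OF DERIV_diff] has_field_derivative_taylor_poly)
      have "norm (R' x) \<le> C * norm (x - w) powr (\<alpha> - real (Suc s))"
        using Suc.IH[of x] Suc.prems xD by (simp add: R'_def T_def s)
      also have "\<dots> \<le> C * norm (z - w) powr (\<alpha> - real (Suc s))"
      proof (intro mult_left_mono powr_mono2)
        show "norm (x - w) \<le> norm (z - w)" using x by (metis segment_bound(1) norm_minus_commute)
        show "0 \<le> \<alpha> - real (Suc s)" using s \<alpha> by linarith
      qed (auto simp: C_def)
      finally show "norm (R' x) \<le> C * norm (z - w) powr (\<alpha> - real (Suc s))" .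
    qed auto
    moreover have "R w = 0" by (simp add: R_def T_def)
    moreover have "norm (z - w) powr (\<alpha> - real (Suc s)) * norm (z - w) = norm (z - w) powr (\<alpha> - real s)"
      by (cases "z = w") (auto simp: powr_diff powr_add)
    ultimately have "norm (R z) \<le> C * norm (z - w) powr (\<alpha> - real s)" by (simp add: mult.assoc)
    then show ?case by (simp add: R_def T_def s_def)
  qed
  note main = this
  have "norm ((deriv ^^ s) f z - taylor_poly (\<lambda>i. (deriv ^^ (i + s)) f w) (n - s) w z)
      \<le> C * norm (z - w) powr (\<alpha> - real s)" if "s \<le> n" "z \<in> \<D>" "w \<in> \<D>" for s z w
    using main[of "n - s" z w] that by simp
  then have "taylor_bound n \<alpha> C f" by (simp add: taylor_bound_def C_def)
  then show ?thesis by (rule that)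
qed

text \<open>After the polynomial at \<open>v\<close> is recentred at \<open>w\<close>, the
  differences of the coefficients are exactly the Taylor remainders of the derivatives of
  \<open>f\<close>.\<close>

lemma A_space_jet_diff:
  assumes tb: "taylor_bound n \<alpha> C f"
    and "real n < \<alpha>" "w \<in> \<D>" "v \<in> \<D>" "norm (w - v) \<le> D" "norm (z - w) \<le> D" "D > 0"
  shows "norm (taylor f n w z - taylor f n v z)
    \<le> real (Suc n) * (C * D powr \<alpha>)"
proof -
  note C = taylor_boundD(1)[OF tb] and taylor = taylor_boundD(2)[OF tb]
  define e where "e = (\<lambda>s. (deriv ^^ s) f w - taylor_poly (\<lambda>i. (deriv ^^ (i + s)) f v) (n - s) v w)"
  have "taylor f n w z - taylor f n v z
      = taylor_poly e n w z"
    unfolding taylor_poly_recenter[of "\<lambda>i. (deriv ^^ i) f v" n v z w]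
    by (simp add: taylor_poly_def[of _ n w] e_def sum_subtractf[symmetric] diff_divide_distrib left_diff_distrib)
  moreover have "norm (taylor_poly e n w z) \<le> real (Suc n) * (C * D powr \<alpha>)"
  proof (rule norm_taylor_poly_le_powr)
    fix s assume s: "s \<le> n"
    have "norm (e s) \<le> C * norm (w - v) powr (\<alpha> - real s)"
      unfolding e_def using assms s by (intro taylor) auto
    also have "\<dots> \<le> C * D powr (\<alpha> - real s)"
      using assms s C by (intro mult_left_mono powr_mono2) auto
    finally show "norm (e s) \<le> C * D powr (\<alpha> - real s)" .
  qed (use assms in auto)
  ultimately show ?thesis by simp
qed

text \<open>For \<open>n \<ge> 1\<close> the Taylor formula at 0 bounds the first derivative, so
  \<open>f\<close> is Lipschitz and extends continuously. The \<open>Lim\<close> in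
  \<open>disc_ext\<close> is then a genuine limit.\<close>

lemma A_space_tendsto_disc_ext:
  assumes f: "f \<in> A_space \<alpha>" and \<alpha>: "real n < \<alpha>" "\<alpha> < real n + 1" "n \<ge> 1" and \<zeta>: "norm \<zeta> = 1"
  shows "(f \<longlongrightarrow> disc_ext f \<zeta>) (at \<zeta> within \<D>)"
proof -
  obtain C where tb: "taylor_bound n \<alpha> C f" using A_space_taylor[OF f \<alpha>(1,2)] .
  note C = taylor_boundD[OF tb]
  define K where "K = C + (\<Sum>i\<le>n - 1. norm ((deriv ^^ (i + 1)) f 0))"
  have bnd: "norm (deriv f z) \<le> K" if z: "z \<in> \<D>" for z
  proof -
    define T where "T = taylor_poly (\<lambda>i. (deriv ^^ (i + 1)) f 0) (n - 1) 0 z"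
    have "norm (deriv f z - T) \<le> C * norm z powr (\<alpha> - 1)"
      using C(2)[of 1 z 0] z \<alpha> by (simp add: T_def)
    also have "\<dots> \<le> C * 1 powr (\<alpha> - 1)"
      using z \<alpha> C by (intro mult_left_mono powr_mono2) auto
    finally have "norm (deriv f z - T) \<le> C" by simp
    moreover have "norm T \<le> (\<Sum>i\<le>n - 1. norm ((deriv ^^ (i + 1)) f 0))"
    proof -
      have "norm T \<le> (\<Sum>i\<le>n - 1. norm ((deriv ^^ (i + 1)) f 0) * norm (z - 0) ^ i)"
        unfolding T_def by (rule norm_taylor_poly_le)
      also have "\<dots> \<le> (\<Sum>i\<le>n - 1. norm ((deriv ^^ (i + 1)) f 0))"
        using z by (intro sum_mono mult_left_le power_le_one) auto
      finally show ?thesis .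
    qed
    ultimately show ?thesis unfolding K_def by norm
  qed
  have lip: "norm (f z - f w) \<le> K * norm (z - w)" if "z \<in> \<D>" "w \<in> \<D>" for z w
    using that bnd
    by (intro field_differentiable_bound[of \<D> f "deriv f"] has_field_derivative_at_within[OF holomorphic_derivI[OF A_space_holomorphic[OF f]]])
       auto
  have "uniformly_continuous_on \<D> f"
    using lip by (intro lipschitz_on_uniformly_continuous[of K] lipschitz_onI)
      (auto simp: dist_norm intro: order_trans[OF norm_ge_zero bnd[of 0]])
  then obtain l where "(f \<longlongrightarrow> l) (at \<zeta> within \<D>)"
    using uniformly_continuous_on_extension_at_closure[of \<D> f \<zeta>] \<zeta> by auto
  moreover have "at \<zeta> within \<D> \<noteq> bot"
    using \<zeta> islimpt_ball[of \<zeta> 0 1] by (auto simp: trivial_limit_within)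
  ultimately have "Lim (at \<zeta> within \<D>) f = l" using tendsto_Lim by blast
  then show ?thesis using \<open>(f \<longlongrightarrow> l) _\<close> \<zeta> by (simp add: disc_ext_def)
qed

lemma A_space_radial_limit:
  assumes f: "f \<in> A_space \<alpha>" and \<alpha>: "real n < \<alpha>" "\<alpha> < real n + 1" "n \<ge> 1"
  shows "((\<lambda>r. f (complex_of_real r * cis t)) \<longlongrightarrow> disc_ext f (cis t)) (at_left 1)"
proof -
  have "filterlim (\<lambda>r. complex_of_real r * cis t) (at (cis t) within \<D>) (at_left 1)"
    unfolding filterlim_at
  proof
    show "((\<lambda>r. complex_of_real r * cis t) \<longlongrightarrow> cis t) (at_left 1)"
      by (auto intro!: tendsto_eq_intros)
    have "\<forall>\<^sub>F r in at_left 1. r \<in> {0<..<(1::real)}" by (rule eventually_at_left_real) simp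
    then show "\<forall>\<^sub>F r in at_left 1. complex_of_real r * cis t \<in> \<D> \<and> complex_of_real r * cis t \<noteq> cis t"
      by eventually_elim (auto simp: norm_mult)
  qed
  from filterlim_compose[OF A_space_tendsto_disc_ext[OF f \<alpha>, of "cis t"] this] show ?thesis
    by simp
qed

section \<open>Normal families\<close>

lemma bounded_holomorphic_limit:
  assumes hol: "\<And>N. F N holomorphic_on \<D>" and bnd: "\<And>N z. z \<in> \<D> \<Longrightarrow> norm (F N z) \<le> C"
  obtains r G where "strict_mono (r :: nat \<Rightarrow> nat)" "G holomorphic_on \<D>"
    "\<And>z. z \<in> \<D> \<Longrightarrow> (\<lambda>N. F (r N) z) \<longlonglongrightarrow> G z"
    "\<And>z m. z \<in> \<D> \<Longrightarrow> (\<lambda>N. (deriv ^^ m) (F (r N)) z) \<longlonglongrightarrow> (deriv ^^ m) G z"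
proof -
  obtain G r where G: "G holomorphic_on \<D>" "strict_mono (r :: nat \<Rightarrow> nat)"
    "\<And>x. x \<in> \<D> \<Longrightarrow> (\<lambda>n. F (r n) x) \<longlonglongrightarrow> G x"
    "\<And>K. compact K \<Longrightarrow> K \<subseteq> \<D> \<Longrightarrow> uniform_limit K (F \<circ> r) G sequentially"
  proof (rule Montel[of \<D> "range F" F])
    show "\<exists>B. \<forall>h\<in>range F. \<forall>z\<in>K. norm (h z) \<le> B" if "K \<subseteq> \<D>" for K
      using bnd that by (intro exI[of _ C]) auto
  qed (use hol in auto)
  have "(\<lambda>N. (deriv ^^ m) (F (r N)) z) \<longlonglongrightarrow> (deriv ^^ m) G z" if z: "z \<in> \<D>" for z m
  proof -
    obtain e where e: "e > 0" "cball z e \<subseteq> \<D>" using z open_contains_cball_eq[of \<D>] by auto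
    show ?thesis
    proof (rule higher_deriv_complex_uniform_limit)
    show "uniform_limit (ball z e) (\<lambda>N. F (r N)) G sequentially"
      using G(4)[of "cball z e"] e by (auto simp: o_def intro: uniform_limit_on_subset)
    show "\<forall>\<^sub>F N in sequentially. F (r N) holomorphic_on ball z e"
      using hol e by (auto intro!: always_eventually holomorphic_on_subset[OF hol])
    qed (use \<open>z \<in> \<D>\<close> e in auto)
  qed
  with G that show ?thesis by blast
qed

text \<open>Bounds that are uniform in \<open>N\<close> survive pointwise limits of the function and
  of its \<open>m\<close>-th derivative. This is how estimates for finite subproducts reach
  \<open>B\<close>.\<close>

lemma A_space_limit:
  assumes hol: "\<And>N. F N holomorphic_on \<D>" and bnd: "\<And>N z. z \<in> \<D> \<Longrightarrow> norm (F N z) \<le> C"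
    and m: "real m > \<alpha>"
    and der: "\<And>N z. z \<in> \<D> \<Longrightarrow> norm ((deriv ^^ m) (F N) z) \<le> M * (1 - norm z) powr (\<alpha> - real m)"
  obtains r G where "strict_mono (r :: nat \<Rightarrow> nat)" "G \<in> A_space \<alpha>"
    "\<And>z. z \<in> \<D> \<Longrightarrow> (\<lambda>N. F (r N) z) \<longlonglongrightarrow> G z"
proof -
  obtain r G where G: "strict_mono (r :: nat \<Rightarrow> nat)" "G holomorphic_on \<D>"
    "\<And>z. z \<in> \<D> \<Longrightarrow> (\<lambda>N. F (r N) z) \<longlonglongrightarrow> G z"
    "\<And>z m. z \<in> \<D> \<Longrightarrow> (\<lambda>N. (deriv ^^ m) (F (r N)) z) \<longlonglongrightarrow> (deriv ^^ m) G z"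
  proof (rule bounded_holomorphic_limit[of F C])
    show "F N holomorphic_on \<D>" for N by (rule hol)
    show "norm (F N z) \<le> C" if "z \<in> \<D>" for N z by (rule bnd[OF that])
  qed (rule that)
  have "G \<in> A_space \<alpha>"
  proof (rule A_spaceI[OF G(2) _ m])
    fix z :: complex assume z: "z \<in> \<D>"
    show "norm (G z) \<le> C"
      using bnd[OF z] by (intro Lim_norm_ubound[OF _ G(3)[OF z]]) auto
    show "norm ((deriv ^^ m) G z) \<le> M * (1 - norm z) powr (\<alpha> - real m)"
      using der[OF z] by (intro Lim_norm_ubound[OF _ G(4)[OF z]]) auto
  qed
  with G that show ?thesis by blast
qed

subsection \<open>Blaschke factors and finite Blaschke products\<close>

text \<open>The unimodular normalisation; with the value 1 at 0 a single formula covers both cases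
  of \<open>blaschke_factor\<close>.\<close>

definition blaschke_const :: "complex \<Rightarrow> complex" where
  "blaschke_const a = (if a = 0 then 1 else - cnj a / complex_of_real (norm a))"

lemma norm_blaschke_const [simp]: "norm (blaschke_const a) = 1"
  by (simp add: blaschke_const_def norm_divide)

lemma blaschke_const_nonzero [simp]: "blaschke_const a \<noteq> 0"
  using norm_blaschke_const[of a] by (metis norm_zero zero_neq_one)

lemma blaschke_factor_eq: "blaschke_factor a w = blaschke_const a * ((w - a) / (1 - cnj a * w))"
proof (cases "a = 0")
  case False
  have "(a - w) / (1 - cnj a * w) = - ((w - a) / (1 - cnj a * w))"
    by (simp add: minus_divide_left)
  then show ?thesis using False by (simp add: blaschke_factor_def blaschke_const_def)
qed (simp add: blaschke_factor_def blaschke_const_def)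

lemma norm_blaschke_factor: "norm (blaschke_factor a w) = norm (w - a) / norm (1 - cnj a * w)"
  by (simp add: blaschke_factor_eq norm_mult norm_divide)

lemma norm_one_minus_cnj_power2:
  "norm (1 - cnj a * w) ^ 2 - norm (w - a) ^ 2 = (1 - norm a ^ 2) * (1 - norm w ^ 2)"
  unfolding cmod_power2 by (simp add: power2_eq_square algebra_simps)

text \<open>For nonzero \<open>a\<close> this norm is \<open>norm a\<close> times the distance from
  \<open>w\<close> to the reflected point \<open>1 / cnj a\<close>. The bounds make it comparable
  with \<open>(1 - norm a) + norm (w - a)\<close>.\<close>

lemma one_minus_cnj_bounds:
  assumes "norm a < 1" "norm w \<le> 1"
  shows "1 - norm a \<le> norm (1 - cnj a * w)" "1 - norm w \<le> norm (1 - cnj a * w)"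
    "norm (w - a) \<le> norm (1 - cnj a * w)" "1 - cnj a * w \<noteq> 0"
    "norm (1 - cnj a * w) \<le> 2 * (1 - norm a) + norm (w - a)" "norm (1 - cnj a * w) \<le> 2"
proof -
  have "1 - norm (cnj a * w) \<le> norm (1 - cnj a * w)"
    using norm_triangle_ineq2[of 1 "cnj a * w"] by simp
  moreover have "norm (cnj a * w) \<le> norm a" "norm (cnj a * w) \<le> norm w"
    using assms by (auto simp: norm_mult mult_left_le mult_left_le_one_le)
  ultimately show 1: "1 - norm a \<le> norm (1 - cnj a * w)" "1 - norm w \<le> norm (1 - cnj a * w)" by auto
  show "1 - cnj a * w \<noteq> 0" using 1 assms by auto
  have "(1 - norm a ^ 2) * (1 - norm w ^ 2) \<ge> 0"
    using assms by (intro mult_nonneg_nonneg) (auto intro!: power_le_one)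
  then have "norm (w - a) ^ 2 \<le> norm (1 - cnj a * w) ^ 2"
    using norm_one_minus_cnj_power2[of a w] by linarith
  then show "norm (w - a) \<le> norm (1 - cnj a * w)" by (rule power2_le_imp_le) simp
  have "1 - cnj a * w = complex_of_real (1 - norm a ^ 2) - cnj a * (w - a)"
    using complex_norm_square[of a] by (simp add: algebra_simps)
  then have "norm (1 - cnj a * w) \<le> norm (complex_of_real (1 - norm a ^ 2)) + norm (cnj a * (w - a))"
    by (metis norm_triangle_ineq4)
  also have "norm (complex_of_real (1 - norm a ^ 2)) = 1 - norm a ^ 2"
    using assms by (subst norm_of_real) (auto intro!: abs_of_nonneg power_le_one)
  also have "1 - norm a ^ 2 = (1 + norm a) * (1 - norm a)" by (simp add: power2_eq_square algebra_simps)
  also have "(1 + norm a) * (1 - norm a) \<le> 2 * (1 - norm a)"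
    using assms by (intro mult_right_mono) auto
  also have "norm (cnj a * (w - a)) \<le> norm (w - a)"
    using assms by (simp add: norm_mult mult_left_le_one_le)
  finally show "norm (1 - cnj a * w) \<le> 2 * (1 - norm a) + norm (w - a)" by simp
  show "norm (1 - cnj a * w) \<le> 2"
    using norm_triangle_ineq4[of 1 "cnj a * w"] \<open>norm (cnj a * w) \<le> norm a\<close> assms by simp
qed

lemma one_minus_norm_blaschke_factor_power2:
  assumes "norm a < 1" "norm w \<le> 1"
  shows "1 - norm (blaschke_factor a w) ^ 2
    = (1 - norm a ^ 2) * (1 - norm w ^ 2) / norm (1 - cnj a * w) ^ 2"
proof -
  have "norm (1 - cnj a * w) \<noteq> 0" using one_minus_cnj_bounds(4)[OF assms] by simp
  then show ?thesis
    using norm_one_minus_cnj_power2[of a w]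
    by (simp add: norm_blaschke_factor power_divide field_simps)
qed

lemma norm_blaschke_factor_le_1:
  assumes "norm a < 1" "norm w \<le> 1"
  shows "norm (blaschke_factor a w) \<le> 1"
  using one_minus_cnj_bounds[OF assms] by (simp add: norm_blaschke_factor divide_le_eq)

lemma norm_blaschke_factor_eq_1:
  assumes "norm a < 1" "norm w = 1"
  shows "norm (blaschke_factor a w) = 1"
proof -
  have "norm (blaschke_factor a w) ^ 2 = 1"
    using one_minus_norm_blaschke_factor_power2[of a w] assms by simp
  then show ?thesis by (intro power2_eq_imp_eq[where y = 1]) auto
qed

text \<open>The factor at \<open>w\<close> is the reciprocal of the conjugate of its value at the
  reflected point; the third hypothesis keeps \<open>w\<close> away from the pole.\<close>

lemma norm_blaschke_factor_reflect:
  assumes "norm a < 1" "norm w \<ge> 1" "1 / cnj w \<noteq> a"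
  shows "norm (blaschke_factor a w) * norm (blaschke_factor a (1 / cnj w)) = 1"
    "1 - cnj a * w \<noteq> 0"
proof -
  have w: "w \<noteq> 0" "w \<noteq> a" using assms by auto
  have e1: "1 / cnj w - a = cnj (1 - cnj a * w) / cnj w" using w by (simp add: field_simps)
  have e2: "1 - cnj a * (1 / cnj w) = cnj (w - a) / cnj w" using w by (simp add: field_simps)
  show nz: "1 - cnj a * w \<noteq> 0" using e1 assms by (metis complex_cnj_zero div_0 right_minus_eq)
  have "norm (1 - cnj a * w) \<noteq> 0" "norm (w - a) \<noteq> 0" using nz w by auto
  then show "norm (blaschke_factor a w) * norm (blaschke_factor a (1 / cnj w)) = 1"
    unfolding norm_blaschke_factor e1 e2 norm_divide complex_mod_cnj
    using w by (simp add: field_simps)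
qed

lemma holomorphic_on_blaschke_factor [holomorphic_intros]:
  "(\<And>w. w \<in> S \<Longrightarrow> 1 - cnj a * w \<noteq> 0) \<Longrightarrow> blaschke_factor a holomorphic_on S"
  unfolding blaschke_factor_eq[abs_def] by (intro holomorphic_intros) auto

lemma blaschke_factor_eq_0_iff: "norm a < 1 \<Longrightarrow> norm w \<le> 1 \<Longrightarrow> blaschke_factor a w = 0 \<longleftrightarrow> w = a"
  using one_minus_cnj_bounds(4)[of a w] by (auto simp: blaschke_factor_eq)

text \<open>Indexed by a set rather than by an initial segment, since single factors are removed and
  the bounds have to hold for all finite subproducts.\<close>

definition finite_blaschke :: "('i \<Rightarrow> complex) \<Rightarrow> 'i set \<Rightarrow> complex \<Rightarrow> complex" where
  "finite_blaschke z S w = (\<Prod>j\<in>S. blaschke_factor (z j) w)"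

lemma finite_blaschke_empty [simp]: "finite_blaschke z {} w = 1"
  by (simp add: finite_blaschke_def)

lemma finite_blaschke_insert:
  "finite S \<Longrightarrow> j \<notin> S \<Longrightarrow> finite_blaschke z (insert j S) w = blaschke_factor (z j) w * finite_blaschke z S w"
  by (simp add: finite_blaschke_def)

lemma finite_blaschke_remove:
  "finite S \<Longrightarrow> j \<in> S \<Longrightarrow> finite_blaschke z S w = blaschke_factor (z j) w * finite_blaschke z (S - {j}) w"
  by (simp add: finite_blaschke_def prod.remove)

lemma holomorphic_on_finite_blaschke [holomorphic_intros]:
  "(\<And>j w. j \<in> S \<Longrightarrow> w \<in> A \<Longrightarrow> 1 - cnj (z j) * w \<noteq> 0) \<Longrightarrow> finite_blaschke z S holomorphic_on A"
  unfolding finite_blaschke_def[abs_def] by (intro holomorphic_intros) auto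

lemma holomorphic_on_disc_finite_blaschke:
  "(\<And>j. j \<in> S \<Longrightarrow> norm (z j) < 1) \<Longrightarrow> finite_blaschke z S holomorphic_on \<D>"
  using one_minus_cnj_bounds(4) by (intro holomorphic_intros) auto

lemma norm_finite_blaschke_le_1:
  assumes "\<And>j. j \<in> S \<Longrightarrow> norm (z j) < 1" "norm w \<le> 1"
  shows "norm (finite_blaschke z S w) \<le> 1"
  using assms norm_blaschke_factor_le_1 unfolding finite_blaschke_def prod_norm[symmetric]
  by (intro prod_le_1) auto

lemma norm_finite_blaschke_eq_1:
  assumes "\<And>j. j \<in> S \<Longrightarrow> norm (z j) < 1" "norm w = 1"
  shows "norm (finite_blaschke z S w) = 1"
  using assms norm_blaschke_factor_eq_1 unfolding finite_blaschke_def prod_norm[symmetric]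
  by (intro prod.neutral) auto

lemma finite_blaschke_eq_0_iff:
  assumes "\<And>j. j \<in> S \<Longrightarrow> norm (z j) < 1" "norm w \<le> 1" "finite S"
  shows "finite_blaschke z S w = 0 \<longleftrightarrow> w \<in> z ` S"
  using assms blaschke_factor_eq_0_iff[of _ w] by (auto simp: finite_blaschke_def)

lemma norm_finite_blaschke_reflect:
  assumes "\<And>j. j \<in> S \<Longrightarrow> norm (z j) < 1" "norm w \<ge> 1" "1 / cnj w \<notin> z ` S"
  shows "norm (finite_blaschke z S w) * norm (finite_blaschke z S (1 / cnj w)) = 1"
  unfolding finite_blaschke_def prod_norm[symmetric] prod.distrib[symmetric]
  using assms by (intro prod.neutral ballI norm_blaschke_factor_reflect) auto

text \<open>Division does not enlarge the bound, because the factor is nearly unimodular on circles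
  close to the unit circle: the maximum principle on radius \<open>r\<close>, then \<open>r\<close>
  tends to 1. No boundary values of \<open>f\<close> are needed.\<close>

lemma divide_blaschke_factor:
  assumes holf: "f holomorphic_on \<D>" and C: "\<And>w. w \<in> \<D> \<Longrightarrow> norm (f w) \<le> C"
    and a: "norm a < 1" "f a = 0"
  obtains q where "q holomorphic_on \<D>" "\<And>w. w \<in> \<D> \<Longrightarrow> f w = blaschke_factor a w * q w"
    "\<And>w. w \<in> \<D> \<Longrightarrow> norm (q w) \<le> C"
proof
  define F where "F = (\<lambda>w. if w = a then deriv f a else (f w - f a) / (w - a))"
  have holF: "F holomorphic_on \<D>"
    unfolding F_def using a by (intro pole_lemma holf) (auto simp: interior_open)
  define q where "q = (\<lambda>w. F w * (1 - cnj a * w) / blaschke_const a)"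
  show holq: "q holomorphic_on \<D>"
    unfolding q_def by (intro holomorphic_intros holF) auto
  show eq: "f w = blaschke_factor a w * q w" if "w \<in> \<D>" for w
    using that a one_minus_cnj_bounds(4)[of a w] by (auto simp: q_def F_def blaschke_factor_eq)
  fix w :: complex assume w: "w \<in> \<D>"
  \<comment> \<open>A lower bound for the squared modulus of the factor on the circle of radius
    \<open>r\<close>; it tends to 1.\<close>
  define M where "M = (\<lambda>r. 1 - (1 - r ^ 2) / (1 - norm a) ^ 2)"
  have M: "(M \<longlongrightarrow> 1) (at_left 1)"
    unfolding M_def using a by (auto intro!: tendsto_eq_intros)
  have "\<forall>\<^sub>F r in at_left 1. r \<in> {norm w<..<1}" using w by (intro eventually_at_left_real) auto
  moreover have "\<forall>\<^sub>F r in at_left 1. M r > 0" using order_tendstoD(1)[OF M] by simp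
  ultimately have "\<forall>\<^sub>F r in at_left 1. norm (q w) \<le> C / sqrt (M r)"
  proof eventually_elim
    case (elim r)
    then have r: "0 < r" "r < 1" "norm w < r" using norm_ge_zero[of w] by (auto simp del: norm_ge_zero)
    show ?case
    proof (rule maximum_modulus_frontier[of q "ball 0 r"])
      show "q holomorphic_on interior (ball 0 r)"
        using holq r by (auto simp: interior_open intro: holomorphic_on_subset)
      show "continuous_on (closure (ball 0 r)) q"
        using r by (intro holomorphic_on_imp_continuous_on[OF holomorphic_on_subset[OF holq]]) auto
      fix x assume "x \<in> frontier (ball (0::complex) r)"
      then have x: "norm x = r" "x \<in> \<D>" using r by auto
      have "(1 - norm a ^ 2) * (1 - norm x ^ 2) / norm (1 - cnj a * x) ^ 2
          \<le> 1 * (1 - norm x ^ 2) / (1 - norm a) ^ 2"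
        using one_minus_cnj_bounds(1)[of a x] a x
        by (intro frac_le mult_right_mono power_mono) (auto intro!: mult_nonneg_nonneg power_le_one)
      then have "M r \<le> norm (blaschke_factor a x) ^ 2"
        using one_minus_norm_blaschke_factor_power2[of a x] a x by (simp add: M_def)
      then have "sqrt (M r) \<le> norm (blaschke_factor a x)" by (intro real_le_lsqrt) auto
      then have "sqrt (M r) * norm (q x) \<le> norm (f x)"
        unfolding eq[OF x(2)] norm_mult by (intro mult_right_mono) auto
      also have "\<dots> \<le> C" using C[OF x(2)] .
      finally show "norm (q x) \<le> C / sqrt (M r)" using elim by (simp add: field_simps)
    qed (use r in auto)
  qed
  moreover have "((\<lambda>r. C / sqrt (M r)) \<longlongrightarrow> C / sqrt 1) (at_left 1)"
    by (intro tendsto_intros M) auto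
  ultimately show "norm (q w) \<le> C"
    using tendsto_lowerbound[of "\<lambda>r. C / sqrt (M r)" "C / sqrt 1"] by auto
qed

lemma divide_finite_blaschke:
  assumes "finite S" "inj_on z S" "\<And>j. j \<in> S \<Longrightarrow> norm (z j) < 1"
    and "f holomorphic_on \<D>" "\<And>w. w \<in> \<D> \<Longrightarrow> norm (f w) \<le> C" "\<And>j. j \<in> S \<Longrightarrow> f (z j) = 0"
  obtains q where "q holomorphic_on \<D>" "\<And>w. w \<in> \<D> \<Longrightarrow> f w = finite_blaschke z S w * q w"
    "\<And>w. w \<in> \<D> \<Longrightarrow> norm (q w) \<le> C"
proof -
  have "\<exists>q. q holomorphic_on \<D> \<and> (\<forall>w\<in>\<D>. f w = finite_blaschke z S w * q w \<and> norm (q w) \<le> C)"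
    using assms
  proof (induction S arbitrary: f rule: finite_induct)
    case empty
    then show ?case by (intro exI[of _ f]) auto
  next
    case (insert j S)
    obtain q where q: "q holomorphic_on \<D>" "\<And>w. w \<in> \<D> \<Longrightarrow> f w = blaschke_factor (z j) w * q w"
      "\<And>w. w \<in> \<D> \<Longrightarrow> norm (q w) \<le> C"
    proof (rule divide_blaschke_factor[of f C "z j"])
      show "norm (f w) \<le> C" if "w \<in> \<D>" for w using insert.prems(4)[OF that] .
    qed (use insert.prems that in auto)
    have "q (z l) = 0" if l: "l \<in> S" for l
    proof -
      have "z j \<notin> z ` S" using insert.prems(1) insert.hyps by auto
      then have "z l \<noteq> z j" using l by (metis imageI)
      moreover have "norm (z l) < 1" "norm (z j) < 1" "f (z l) = 0" using l insert.prems by auto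
      ultimately show ?thesis using q(2)[of "z l"] blaschke_factor_eq_0_iff[of "z j" "z l"] by auto
    qed
    then obtain q' where "q' holomorphic_on \<D>"
        "\<forall>w\<in>\<D>. q w = finite_blaschke z S w * q' w \<and> norm (q' w) \<le> C"
      using insert.IH[of q] q insert.prems by auto
    then show ?case using q insert.hyps by (intro exI[of _ q']) (auto simp: finite_blaschke_insert)
  qed
  then show ?thesis using that by blast
qed

subsection \<open>Infinite Blaschke products\<close>

lemma norm_one_minus_blaschke_factor:
  assumes "norm a < 1" "norm w < 1"
  shows "norm (blaschke_factor a w - 1) \<le> 2 / (1 - norm w) * (1 - norm a)"
proof (cases "a = 0")
  case True
  have "norm (w - 1) \<le> 2" using norm_triangle_ineq4[of w 1] assms by simp
  also have "2 \<le> 2 / (1 - norm w)" using assms by (simp add: field_simps)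
  finally show ?thesis using True by (simp add: blaschke_factor_def)
next
  case False
  have d: "1 - cnj a * w \<noteq> 0" "1 - norm w \<le> norm (1 - cnj a * w)"
    using one_minus_cnj_bounds[of a w] assms by auto
  define x where "x = complex_of_real (norm a)"
  have x: "x \<noteq> 0" "a * cnj a = x * x" using False complex_norm_square[of a]
    by (auto simp: x_def power2_eq_square)
  have "blaschke_factor a w - 1 = - ((1 - x) * (x + cnj a * w)) / (x * (1 - cnj a * w))"
    using False d x by (simp add: blaschke_factor_def x_def[symmetric] field_simps)
  then have "norm (blaschke_factor a w - 1) = (1 - norm a) * norm (x + cnj a * w) / (norm a * norm (1 - cnj a * w))"
  proof -
    have "norm (1 - x) = 1 - norm a"
      unfolding x_def using assms by (metis abs_of_pos diff_gt_0_iff_gt norm_of_real of_real_1 of_real_diff)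
    then show ?thesis
      using \<open>blaschke_factor a w - 1 = _\<close> by (simp add: norm_mult norm_divide x_def)
  qed
  also have "\<dots> \<le> (1 - norm a) * (2 * norm a) / (norm a * (1 - norm w))"
  proof (intro frac_le mult_left_mono)
    have "norm (x + cnj a * w) \<le> norm a + norm a * norm w"
      using norm_triangle_ineq[of x "cnj a * w"] by (simp add: norm_mult x_def)
    also have "\<dots> \<le> norm a + norm a * 1" using assms by (intro add_mono mult_left_mono) auto
    finally show "norm (x + cnj a * w) \<le> 2 * norm a" by simp
  qed (use assms False d in auto)
  also have "\<dots> = norm a * ((1 - norm a) * 2) / (norm a * (1 - norm w))" by (simp add: ac_simps)
  also have "\<dots> = 2 / (1 - norm w) * (1 - norm a)"
    using False by (subst mult_divide_mult_cancel_left) auto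
  finally show ?thesis .
qed

lemma blaschke_seqD:
  assumes "blaschke_seq z"
  shows "norm (z j) < 1" "summable (\<lambda>j. 1 - norm (z j))"
  using assms by (auto simp: blaschke_seq_def subset_iff)

lemma convergent_prod_blaschke:
  assumes "blaschke_seq z" "norm w < 1"
  shows "convergent_prod (\<lambda>j. blaschke_factor (z j) w)"
proof (intro abs_convergent_prod_imp_convergent_prod summable_imp_abs_convergent_prod)
  show "summable (\<lambda>j. norm (blaschke_factor (z j) w - 1))"
    by (rule summable_comparison_test'[OF summable_mult[OF blaschke_seqD(2)[OF assms(1)]], of 0 _ "2 / (1 - norm w)"])
       (use norm_one_minus_blaschke_factor blaschke_seqD[OF assms(1)] assms(2) in auto)
qed

lemma finite_blaschke_tendsto:
  assumes "blaschke_seq z" "norm w < 1"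
  shows "(\<lambda>N. finite_blaschke z {..<N} w) \<longlonglongrightarrow> blaschke_product z w"
proof -
  have "(\<lambda>N. \<Prod>j\<le>N. blaschke_factor (z j) w) \<longlonglongrightarrow> blaschke_product z w"
    unfolding blaschke_product_def by (intro convergent_prod_LIMSEQ convergent_prod_blaschke assms)
  then have "(\<lambda>N. finite_blaschke z {..<Suc N} w) \<longlonglongrightarrow> blaschke_product z w"
    by (simp add: finite_blaschke_def lessThan_Suc_atMost)
  then show ?thesis by (rule LIMSEQ_imp_Suc)
qed

lemma norm_blaschke_product_le_1:
  assumes "blaschke_seq z" "norm w < 1"
  shows "norm (blaschke_product z w) \<le> 1"
  using assms norm_finite_blaschke_le_1[of "{..<_}" z w] blaschke_seqD(1)
  by (intro Lim_norm_ubound[OF _ finite_blaschke_tendsto]) auto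

lemma blaschke_product_eq_0_iff:
  assumes "blaschke_seq z" "norm w < 1"
  shows "blaschke_product z w = 0 \<longleftrightarrow> w \<in> range z"
proof
  assume "blaschke_product z w = 0"
  then have "\<exists>j. blaschke_factor (z j) w = 0"
    using convergent_prod_blaschke[OF assms] unfolding blaschke_product_def
    by (metis prodinf_nonzero)
  then show "w \<in> range z" using blaschke_factor_eq_0_iff[of _ w] blaschke_seqD[OF assms(1)] assms(2) by auto
next
  assume "w \<in> range z"
  then obtain j where j: "w = z j" by auto
  have "\<forall>\<^sub>F N in sequentially. finite_blaschke z {..<N} w = 0"
    using eventually_gt_at_top[of j]
  proof eventually_elim
    case (elim N)
    then show ?case using finite_blaschke_eq_0_iff[of "{..<N}" z w] less_imp_le[OF blaschke_seqD(1)[OF assms(1)]] blaschke_seqD(1)[OF assms(1)] j by auto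
  qed
  then have "(\<lambda>N. finite_blaschke z {..<N} w) \<longlonglongrightarrow> 0"
    by (intro tendsto_eventually)
  then show "blaschke_product z w = 0" using finite_blaschke_tendsto[OF assms] LIMSEQ_unique by blast
qed

lemma blaschke_product_holomorphic:
  assumes "blaschke_seq z"
  shows "blaschke_product z holomorphic_on \<D>"
proof -
  obtain r G where G: "strict_mono (r :: nat \<Rightarrow> nat)" "G holomorphic_on \<D>"
    "\<And>w. w \<in> \<D> \<Longrightarrow> (\<lambda>N. finite_blaschke z {..<r N} w) \<longlonglongrightarrow> G w"
  proof (rule bounded_holomorphic_limit[of "\<lambda>N. finite_blaschke z {..<N}" 1])
    show "finite_blaschke z {..<N} holomorphic_on \<D>" for N
      using blaschke_seqD(1)[OF assms] by (intro holomorphic_on_disc_finite_blaschke)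
    show "norm (finite_blaschke z {..<N} w) \<le> 1" if "w \<in> \<D>" for N w
      using blaschke_seqD(1)[OF assms] that by (intro norm_finite_blaschke_le_1) auto
  qed (rule that)
  have "G w = blaschke_product z w" if "w \<in> \<D>" for w
    using LIMSEQ_unique[OF G(3)[OF that] LIMSEQ_subseq_LIMSEQ[OF finite_blaschke_tendsto[OF assms] G(1), unfolded o_def]] that
    by auto
  then show ?thesis using G(2) holomorphic_cong[of \<D> \<D> G "blaschke_product z"] by auto
qed

subsection \<open>Interpolation and the Carleson condition\<close>

lemma sep_dist_le:
  assumes "l \<noteq> j"
  shows "sep_dist z j \<le> norm (z j - z l)"
  unfolding sep_dist_def using assms by (intro cINF_lower bdd_belowI[of _ 0]) auto

text \<open>The moduli of the zeros tend to 1, so all but finitely many zeros keep distance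
  \<open>e\<close> from \<open>z j\<close>; the remaining ones are distinct from
  \<open>z j\<close>.\<close>

lemma sep_dist_pos:
  assumes z: "blaschke_seq z" "inj z"
  shows "sep_dist z j > 0"
proof -
  define e where "e = (1 - norm (z j)) / 2"
  have e: "e > 0" using blaschke_seqD(1)[OF z(1)] by (simp add: e_def)
  have "\<forall>\<^sub>F l in sequentially. 1 - norm (z l) < e"
    using order_tendstoD(2)[OF summable_LIMSEQ_zero[OF blaschke_seqD(2)[OF z(1)]] e] .
  then obtain N where N: "\<And>l. l \<ge> N \<Longrightarrow> 1 - norm (z l) < e"
    by (auto simp: eventually_sequentially)
  define M where "M = Min (insert e ((\<lambda>l. norm (z j - z l)) ` ({..<N} - {j})))"
  have "M > 0" using e z(2) by (auto simp: M_def inj_eq)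
  moreover have "M \<le> norm (z j - z l)" if "l \<noteq> j" for l
  proof (cases "l < N")
    case True
    then show ?thesis unfolding M_def using that by (intro Min_le) auto
  next
    case False
    then have "1 - norm (z l) < e" using N by simp
    then have "e \<le> norm (z j - z l)"
      using norm_triangle_ineq2[of "z l" "z j"] by (simp add: e_def norm_minus_commute)
    moreover have "M \<le> e" unfolding M_def by (intro Min_le) auto
    ultimately show ?thesis by linarith
  qed
  moreover have "Suc j \<in> UNIV - {j}" by simp
  then have "UNIV - {j} \<noteq> {}" by blast
  ultimately have "M \<le> sep_dist z j"
    unfolding sep_dist_def by (intro cINF_greatest) auto
  with \<open>M > 0\<close> show ?thesis by linarith
qed

lemma sep_dist_attained:
  assumes "sep_dist z j < M"
  obtains l where "l \<noteq> j" "norm (z j - z l) < M"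
proof -
  have "Suc j \<in> UNIV - {j}" by simp
  then have "UNIV - {j} \<noteq> {}" by blast
  moreover have "bdd_below ((\<lambda>l. norm (z j - z l)) ` (UNIV - {j}))" by (intro bdd_belowI[of _ 0]) auto
  ultimately have "\<exists>l\<in>UNIV - {j}. norm (z j - z l) < M"
    using assms cINF_less_iff[of "UNIV - {j}" "\<lambda>l. norm (z j - z l)" M] by (simp add: sep_dist_def)
  then show ?thesis using that by blast
qed

text \<open>The accumulation points of the zeros belong to the interpolation set too. The asserted
  condition is closed and holds at all zeros, hence also there.\<close>

lemma sep_dist_closure:
  assumes "w \<in> closure (range z)" "w \<noteq> z j"
  shows "sep_dist z j \<le> norm (z j - w)"
proof -
  let ?A = "{z j} \<union> {w. sep_dist z j \<le> norm (z j - w)}"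
  have "closed ?A" by (intro closed_Un closed_Collect_le continuous_intros closed_singleton)
  moreover have "range z \<subseteq> ?A"
  proof
    fix w assume "w \<in> range z"
    then obtain l where "w = z l" by auto
    then show "w \<in> ?A" using sep_dist_le[of l j z] by (cases "l = j") auto
  qed
  ultimately have "closure (range z) \<subseteq> ?A" by (rule closure_minimal[rotated])
  then show ?thesis using assms by auto
qed

lemma interpolating_jets:
  assumes "A_interpolating_blaschke n \<alpha> z B" and \<alpha>: "real n < \<alpha>"
    and K: "\<And>s j. s \<le> n \<Longrightarrow> norm (a s j) \<le> K * sep_dist z j powr (\<alpha> - real s)"
  obtains g where "g \<in> A_space \<alpha>" "\<And>s j. s \<le> n \<Longrightarrow> (deriv ^^ s) g (z j) = a s j"
proof -
  have z: "blaschke_seq z" "inj z" and int: "A_interpolating_set n \<alpha> (closure (range z))"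
    using assms by (auto simp: A_interpolating_blaschke_def)
  note zD = blaschke_seqD(1)[OF z(1)] and d = sep_dist_pos[OF z]
  define E where "E = closure (range z)"
  \<comment> \<open>At accumulation points on the circle the jets are prescribed to be 0.\<close>
  define \<phi> where "\<phi> = (\<lambda>s w. if w \<in> range z then a s (inv z w) else 0)"
  have \<phi>z: "\<phi> s (z j) = a s j" for s j using z(2) by (simp add: \<phi>_def)
  define K' where "K' = max 1 K"
  have bnd: "norm (\<phi> s x) \<le> K' * norm (x - y) powr (\<alpha> - real s)"
    if "s \<le> n" "x \<in> E" "y \<in> E" "x \<noteq> y" for s x y
  proof (cases "x \<in> range z")
    case True
    then obtain j where j: "x = z j" by auto
    have "norm (\<phi> s x) \<le> K * sep_dist z j powr (\<alpha> - real s)" using K that by (simp add: j \<phi>z)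
    also have "\<dots> \<le> K' * norm (x - y) powr (\<alpha> - real s)"
      unfolding K'_def using sep_dist_closure[of y z j] that \<alpha> less_imp_le[OF d[of j]] by (intro mult_mono powr_mono2) (auto simp: j E_def)
    finally show ?thesis .
  next
    case False
    then show ?thesis by (simp add: \<phi>_def K'_def)
  qed
  have main: "norm (\<phi> s x - (\<Sum>m=0..n-s. \<phi> (s + m) y / fact m * (x - y) ^ m))
         \<le> (K' * real (n + 2)) * norm (x - y) powr (\<alpha> - real s)"
    if "x \<in> E" "y \<in> E" "s \<le> n" for x y s
  proof (cases "x = y")
    case True
    \<comment> \<open>On the diagonal the right-hand side of the condition is 0, so the difference
      has to vanish exactly.\<close>
    have "(\<Sum>m=0..n-s. \<phi> (s + m) y / fact m * (x - y) ^ m) = (\<Sum>m=0..n-s. if m = 0 then \<phi> s y else 0)"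
      using True by (intro sum.cong) auto
    then show ?thesis using True by simp
  next
    case False
    have "norm (\<phi> (s + m) y / fact m * (x - y) ^ m) \<le> K' * norm (x - y) powr (\<alpha> - real s)"
      if "m \<in> {0..n-s}" for m
    proof -
      have "norm (\<phi> (s + m) y / fact m * (x - y) ^ m) = norm (\<phi> (s + m) y) / fact m * norm (x - y) ^ m"
        by (simp add: norm_mult norm_divide norm_power)
      also have "\<dots> \<le> norm (\<phi> (s + m) y) / 1 * norm (x - y) ^ m"
        by (intro mult_right_mono divide_left_mono) auto
      also have "\<dots> \<le> K' * norm (x - y) powr (\<alpha> - real (s + m)) * norm (x - y) ^ m"
        using bnd[of "s + m" y x] that \<open>x \<in> E\<close> \<open>y \<in> E\<close> \<open>s \<le> n\<close> False
        by (auto simp: norm_minus_commute intro!: mult_right_mono)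
      also have "\<dots> = K' * norm (x - y) powr (\<alpha> - real s)"
        using False by (simp add: powr_realpow[symmetric] powr_add[symmetric] mult.assoc)
      finally show ?thesis .
    qed
    then have "norm (\<Sum>m=0..n-s. \<phi> (s + m) y / fact m * (x - y) ^ m)
        \<le> of_nat (card {0..n-s}) * (K' * norm (x - y) powr (\<alpha> - real s))"
      by (rule sum_norm_bound)
    also have "\<dots> \<le> real (n + 1) * (K' * norm (x - y) powr (\<alpha> - real s))"
      by (intro mult_right_mono) (auto simp: K'_def)
    finally have "norm (\<phi> s x) + norm (\<Sum>m=0..n-s. \<phi> (s + m) y / fact m * (x - y) ^ m)
      \<le> (K' * real (n + 2)) * norm (x - y) powr (\<alpha> - real s)"
      using bnd[OF \<open>s \<le> n\<close> \<open>x \<in> E\<close> \<open>y \<in> E\<close> False] by (simp add: algebra_simps)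
    then show ?thesis using norm_triangle_ineq4 order_trans by blast
  qed
  have ex: "\<exists>C>0. \<forall>x\<in>E. \<forall>y\<in>E. \<forall>s\<le>n. norm (\<phi> s x - (\<Sum>m=0..n-s. \<phi> (s + m) y / fact m * (x - y) ^ m))
             \<le> C * norm (x - y) powr (\<alpha> - real s)"
    using main by (intro exI[of _ "K' * real (n + 2)"]) (auto simp: K'_def)
  define Q where "Q = (\<lambda>g. \<forall>s\<le>n. \<forall>w\<in>E. disc_ext ((deriv ^^ s) g) w = \<phi> s w)"
  have "\<exists>g\<in>A_space \<alpha>. Q g"
    unfolding Q_def using mp[OF int[unfolded A_interpolating_set_def E_def[symmetric], THEN conjunct2, THEN conjunct2, THEN spec[where x = \<phi>]] ex] .
  then obtain g where g: "g \<in> A_space \<alpha>" "Q g" by auto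
  have "(deriv ^^ s) g (z j) = a s j" if "s \<le> n" for s j
  proof -
    have "z j \<in> E" unfolding E_def by (intro subsetD[OF closure_subset] rangeI)
    then have "disc_ext ((deriv ^^ s) g) (z j) = a s j" using g(2) that \<phi>z[of s j] by (auto simp: Q_def)
    then show ?thesis using zD[of j] by (simp add: disc_ext_def)
  qed
  then show ?thesis by (intro that[OF g(1)])
qed

text \<open>The function \<open>g(w) (1 - cnj (z j) w) powr (-\<alpha>)\<close> is bounded uniformly in \<open>j\<close> and vanishes at
  all zeros, hence is divisible by every finite subproduct.\<close>

lemma interpolating_lower_bound:
  assumes int: "A_interpolating_blaschke n \<alpha> z B" and \<alpha>: "real n < \<alpha>" "\<alpha> < real n + 1" "n \<ge> 1"
  obtains c where "c > 0" "\<And>S j. finite S \<Longrightarrow> j \<notin> S \<Longrightarrow>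
    c * (min (sep_dist z j) (1 - norm (z j)) / (1 - norm (z j))) powr (\<alpha> - real n)
      \<le> norm (finite_blaschke z S (z j))"
proof -
  have z: "blaschke_seq z" "inj z" using int by (auto simp: A_interpolating_blaschke_def)
  note zD = blaschke_seqD(1)[OF z(1)] and d = sep_dist_pos[OF z]
  \<comment> \<open>The minimum serves two purposes: being at most \<open>sep_dist z j\<close> makes
    the jets admissible, and being at most \<open>1 - norm (z j)\<close> bounds it by the modulus of
    \<open>1 - cnj (z j) * w\<close> in the estimate of \<open>G\<close>.\<close>
  define m where "m = (\<lambda>j. min (sep_dist z j) (1 - norm (z j)))"
  have m: "m j > 0" "m j \<le> sep_dist z j" "m j \<le> 1 - norm (z j)" for j
    using zD d by (auto simp: m_def)
  define a where "a = (\<lambda>s j. if s = n then complex_of_real (m j powr (\<alpha> - real n)) else 0)"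
  obtain g where g: "g \<in> A_space \<alpha>" "\<And>s j. s \<le> n \<Longrightarrow> (deriv ^^ s) g (z j) = a s j"
  proof (rule interpolating_jets[OF int \<alpha>(1), of a 1])
    fix s j
    have "m j powr (\<alpha> - real n) \<le> sep_dist z j powr (\<alpha> - real n)"
      using m[of j] \<alpha> by (intro powr_mono2) auto
    then show "norm (a s j) \<le> 1 * sep_dist z j powr (\<alpha> - real s)" by (simp add: a_def)
  qed (rule that)
  obtain C where tb: "taylor_bound n \<alpha> C g" using A_space_taylor[OF g(1) \<alpha>(1,2)] .
  note C = taylor_boundD[OF tb]
  define K where "K = C + 1"
  define c where "c = 2 powr (-\<alpha>) / (fact n * K * 2 ^ n)"
  have K: "K > 0" using C(1) by (simp add: K_def)
  have "c * (m j / (1 - norm (z j))) powr (\<alpha> - real n) \<le> norm (finite_blaschke z S (z j))"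
    if S: "finite S" "j \<notin> S" for S j
  proof -
    define \<epsilon> where "\<epsilon> = 1 - norm (z j)"
    have \<epsilon>: "\<epsilon> > 0" "\<epsilon> \<le> 1" using zD by (auto simp: \<epsilon>_def)
    have zjD: "z j \<in> \<D>" using zD by simp
    define P where "P = (\<lambda>w. (1 - cnj (z j) * w) powr complex_of_real (-\<alpha>))"
    have Re: "Re (1 - cnj (z j) * w) > 0" if "w \<in> \<D>" for w
    proof -
      have "norm (z j) * norm w \<le> norm (z j)" using that by (intro mult_left_le) auto
      then have "norm (cnj (z j) * w) < 1" using zD[of j] by (simp add: norm_mult)
      then show ?thesis using complex_Re_le_cmod[of "cnj (z j) * w"] by simp
    qed
    have normP: "norm (P w) = norm (1 - cnj (z j) * w) powr (-\<alpha>)" if "w \<in> \<D>" for w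
      unfolding P_def by (subst norm_powr_real_powr') auto
    have holP: "P holomorphic_on \<D>"
      unfolding P_def using Re by (intro holomorphic_intros) (force simp: complex_nonpos_Reals_iff)
    have Pnz: "P w \<noteq> 0" if "w \<in> \<D>" for w
      using that one_minus_cnj_bounds(4)[of "z j" w] zD[of j] by (simp add: P_def)
    define G where "G = (\<lambda>w. g w * P w)"
    have bG: "norm (G w) \<le> K" if w: "w \<in> \<D>" for w
    proof -
      define D where "D = norm (1 - cnj (z j) * w)"
      have D: "D > 0" "m j \<le> D" "norm (w - z j) \<le> D"
        using one_minus_cnj_bounds[of "z j" w] zD[of j] w m(3)[of j] by (auto simp: D_def)
      have "norm (g w - taylor g n (z j) w) \<le> C * norm (w - z j) powr \<alpha>"
        using C(2)[of 0 w "z j"] w zjD by simp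
      also have "\<dots> \<le> C * D powr \<alpha>" using C D \<alpha> by (intro mult_left_mono powr_mono2) auto
      finally have 1: "norm (g w - taylor g n (z j) w) \<le> C * D powr \<alpha>" .
      have "norm (taylor g n (z j) w)
          \<le> (\<Sum>i\<le>n. norm ((deriv ^^ i) g (z j)) * norm (w - z j) ^ i)" by (rule norm_taylor_poly_le)
      also have "\<dots> = (\<Sum>i\<le>n. if i = n then m j powr (\<alpha> - real n) * norm (w - z j) ^ i else 0)"
        using g(2) by (intro sum.cong) (auto simp: a_def)
      also have "\<dots> = m j powr (\<alpha> - real n) * norm (w - z j) ^ n" by simp
      also have "\<dots> \<le> D powr (\<alpha> - real n) * D ^ n"
        using D m(1)[of j] \<alpha> by (intro mult_mono powr_mono2 power_mono) auto
      also have "\<dots> = D powr \<alpha>" using D by (simp add: powr_realpow[symmetric] powr_add[symmetric])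
      finally have "norm (g w) \<le> K * D powr \<alpha>"
        using 1 norm_triangle_sub[of "g w" "taylor g n (z j) w"]
        by (simp add: K_def distrib_right)
      then have "norm (G w) \<le> K * D powr \<alpha> * D powr (-\<alpha>)"
        unfolding G_def norm_mult normP[OF w] D_def[symmetric] by (intro mult_right_mono) auto
      also have "\<dots> = K" using D by (simp add: mult.assoc powr_add[symmetric])
      finally show ?thesis .
    qed
    obtain q where q: "q holomorphic_on \<D>" "\<And>w. w \<in> \<D> \<Longrightarrow> G w = finite_blaschke z S w * q w"
      "\<And>w. w \<in> \<D> \<Longrightarrow> norm (q w) \<le> K"
    proof (rule divide_finite_blaschke[OF S(1), of z G K])
      show "G holomorphic_on \<D>" unfolding G_def by (intro holomorphic_intros A_space_holomorphic[OF g(1)] holP)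
      \<comment> \<open>Only the jet of order \<open>n\<close> is nonzero; since
        \<open>n \<ge> 1\<close>, the values of \<open>g\<close> vanish at all zeros.\<close>
      show "G (z l) = 0" for l using g(2)[of 0 l] \<alpha> by (simp add: G_def a_def)
      show "inj_on z S" using z(2) by (simp add: inj_on_def)
    qed (use bG zD that in auto)
    define A where "A = \<D> - z ` S"
    have A: "open A" "z j \<in> A" "A \<subseteq> \<D>"
      using S z(2) zjD by (auto simp: A_def inj_eq intro!: open_Diff finite_imp_closed)
    have fbnz: "finite_blaschke z S w \<noteq> 0" if "w \<in> A" for w
      using that finite_blaschke_eq_0_iff[of S z w] zD S(1) by (auto simp: A_def)
    define E where "E = (\<lambda>w. P w / finite_blaschke z S w)"
    have holE: "E holomorphic_on A"
      unfolding E_def using fbnz A(3) zD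
      by (intro holomorphic_intros holomorphic_on_subset[OF holP]
            holomorphic_on_subset[OF holomorphic_on_disc_finite_blaschke]) auto
    \<comment> \<open>The derivatives of \<open>g\<close> of order below \<open>n\<close> vanish at
      \<open>z j\<close>, so Leibniz leaves one term, with \<open>finite_blaschke z S (z j)\<close>
      in the denominator. Cauchy's upper bound for this derivative of \<open>q\<close> becomes a
      lower bound for the product.\<close>
    have "(deriv ^^ n) q (z j) = (deriv ^^ n) (\<lambda>w. g w * E w) (z j)"
    proof (rule higher_deriv_cong_ev)
      show "\<forall>\<^sub>F w in nhds (z j). q w = g w * E w"
      proof (rule eventually_mono[OF eventually_nhds_in_open[OF A(1,2)]])
        fix w assume "w \<in> A"
        then show "q w = g w * E w" using q(2)[of w] fbnz[of w] A(3) by (auto simp: E_def G_def field_simps)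
      qed
    qed simp
    also have "\<dots> = (\<Sum>i = 0..n. of_nat (n choose i) * (deriv ^^ i) g (z j) * (deriv ^^ (n - i)) E (z j))"
      using holE A A_space_holomorphic[OF g(1)]
      by (intro higher_deriv_mult[of _ A]) (auto intro: holomorphic_on_subset)
    also have "\<dots> = (\<Sum>i = 0..n. if i = n then m j powr (\<alpha> - real n) * E (z j) else 0)"
      using g(2) by (intro sum.cong) (auto simp: a_def)
    also have "\<dots> = m j powr (\<alpha> - real n) * E (z j)" by simp
    finally have "m j powr (\<alpha> - real n) * norm (E (z j)) = norm ((deriv ^^ n) q (z j))"
      by (simp add: norm_mult)
    also have "\<dots> \<le> fact n * K * (2 / \<epsilon>) ^ n"
    proof (rule norm_higher_deriv_ball_le[OF _ \<epsilon>(1)])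
      have sub: "ball (z j) \<epsilon> \<subseteq> \<D>"
      proof
        fix w assume "w \<in> ball (z j) \<epsilon>"
        then show "w \<in> \<D>" using norm_triangle_sub[of w "z j"] by (simp add: \<epsilon>_def dist_norm norm_minus_commute)
      qed
      show "q holomorphic_on ball (z j) \<epsilon>" using q(1) sub by (rule holomorphic_on_subset)
      show "norm (q w) \<le> K" if "w \<in> ball (z j) \<epsilon>" for w using q(3) sub that by auto
    qed
    finally have 1: "m j powr (\<alpha> - real n) * norm (E (z j)) \<le> fact n * K * (2 / \<epsilon>) ^ n" .
    define b where "b = norm (finite_blaschke z S (z j))"
    have b: "b > 0" using fbnz A(2) by (simp add: b_def)
    have "(2 * \<epsilon>) powr (-\<alpha>) / b \<le> norm (E (z j))"
      unfolding E_def norm_divide b_def[symmetric] normP[OF zjD]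
      using one_minus_cnj_bounds(4,5)[of "z j" "z j"] zD[of j] b \<alpha>
      by (intro divide_right_mono powr_mono2') (auto simp: \<epsilon>_def)
    then have "m j powr (\<alpha> - real n) * ((2 * \<epsilon>) powr (-\<alpha>) / b) \<le> fact n * K * (2 / \<epsilon>) ^ n"
      using 1 by (meson mult_left_mono order_trans powr_ge_zero)
    then have "m j powr (\<alpha> - real n) * (2 * \<epsilon>) powr (-\<alpha>) * \<epsilon> ^ n / (fact n * K * 2 ^ n) \<le> b"
      using b \<epsilon> K by (simp add: field_simps)
    also have "m j powr (\<alpha> - real n) * (2 * \<epsilon>) powr (-\<alpha>) * \<epsilon> ^ n / (fact n * K * 2 ^ n)
        = c * (m j / \<epsilon>) powr (\<alpha> - real n)"
      using \<epsilon> m(1)[of j]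
      by (simp add: c_def powr_mult powr_divide powr_realpow[symmetric] powr_diff powr_minus field_simps)
    finally show ?thesis by (simp add: b_def \<epsilon>_def)
  qed
  moreover have "c > 0" using K by (simp add: c_def)
  ultimately show ?thesis by (intro that[of c]) (auto simp: m_def)
qed

text \<open>Carleson's condition on finite subproducts, so that no limit enters. The empty set gives
  \<open>\<delta> \<le> 1\<close>; singletons give separation and distinctness of the zeros.\<close>

locale carleson_seq =
  fixes z :: "nat \<Rightarrow> complex" and \<delta> :: real
  assumes norm_z: "norm (z j) < 1" and \<delta>_pos: "0 < \<delta>"
    and carleson: "finite S \<Longrightarrow> j \<notin> S \<Longrightarrow> \<delta> \<le> norm (finite_blaschke z S (z j))"

abbreviation (in carleson_seq) fb :: "nat set \<Rightarrow> complex \<Rightarrow> complex" where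
  "fb \<equiv> finite_blaschke z"

text \<open>A bootstrap. With \<open>t\<close> the separation relative to
  \<open>1 - norm (z j)\<close>, capped at 1, the lower bound for one factor belonging to a close
  zero reads \<open>c * t powr \<beta> \<le> 2 * t\<close>. As \<open>\<beta> < 1\<close>, this
  keeps \<open>t\<close> away from 0, and the lower bound for arbitrary \<open>S\<close> becomes
  uniform.\<close>

lemma interpolating_imp_carleson_seq:
  assumes int: "A_interpolating_blaschke n \<alpha> z B" and \<alpha>: "real n < \<alpha>" "\<alpha> < real n + 1" "n \<ge> 1"
  obtains \<delta> where "carleson_seq z \<delta>"
proof -
  have z: "blaschke_seq z" "inj z" using int by (auto simp: A_interpolating_blaschke_def)
  note zD = blaschke_seqD(1)[OF z(1)] and d = sep_dist_pos[OF z]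
  obtain c where c: "c > 0" "\<And>S j. finite S \<Longrightarrow> j \<notin> S \<Longrightarrow>
    c * (min (sep_dist z j) (1 - norm (z j)) / (1 - norm (z j))) powr (\<alpha> - real n)
      \<le> norm (finite_blaschke z S (z j))"
    by (rule interpolating_lower_bound[OF int \<alpha>]) (rule that)
  define \<beta> where "\<beta> = \<alpha> - real n"
  have \<beta>: "0 < \<beta>" "\<beta> < 1" using \<alpha> by (auto simp: \<beta>_def)
  define t where "t = (\<lambda>j. min (sep_dist z j) (1 - norm (z j)) / (1 - norm (z j)))"
  have t: "t j > 0" for j using d zD by (simp add: t_def)
  \<comment> \<open>The solution of \<open>c * t powr \<beta> = 2 * t\<close>, cut off at 1 for the
    case of large separation.\<close>
  define t0 where "t0 = min 1 ((c / 2) powr (1 / (1 - \<beta>)))"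
  have t0: "t0 > 0" using c(1) by (simp add: t0_def)
  have "t0 \<le> t j" for j
  proof (cases "sep_dist z j < 1 - norm (z j)")
    case True
    then have tj: "t j = sep_dist z j / (1 - norm (z j))" by (simp add: t_def)
    obtain l where l: "l \<noteq> j" "norm (z j - z l) < 2 * sep_dist z j"
      using sep_dist_attained[of z j "2 * sep_dist z j"] d[of j] by auto
    have "c * t j powr \<beta> \<le> norm (finite_blaschke z {l} (z j))"
      using c(2)[of "{l}" j] l(1) by (simp add: t_def \<beta>_def)
    also have "\<dots> = norm (z j - z l) / norm (1 - cnj (z l) * z j)"
      by (simp add: finite_blaschke_def norm_blaschke_factor)
    also have "\<dots> \<le> 2 * sep_dist z j / (1 - norm (z j))"
      using l(2) one_minus_cnj_bounds(2)[of "z l" "z j"] zD[of j] zD[of l] d[of j] by (intro frac_le) auto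
    finally have "c * t j powr \<beta> \<le> 2 * t j" by (simp add: tj)
    also have "2 * t j = (2 * t j powr (1 - \<beta>)) * t j powr \<beta>"
      using t[of j] by (simp add: mult.assoc powr_add[symmetric])
    finally have "c / 2 \<le> t j powr (1 - \<beta>)" using t[of j] by simp
    then have "(c / 2) powr (1 / (1 - \<beta>)) \<le> (t j powr (1 - \<beta>)) powr (1 / (1 - \<beta>))"
      using c(1) \<beta> by (intro powr_mono2) auto
    also have "\<dots> = t j" using \<beta> t[of j] by (simp add: powr_powr)
    finally show ?thesis by (simp add: t0_def)
  next
    case False
    then have "t j = 1" using zD[of j] by (simp add: t_def)
    then show ?thesis by (simp add: t0_def)
  qed
  then have le: "c * t0 powr \<beta> \<le> c * t j powr \<beta>" for j
    using c(1) t0 \<beta> by (intro mult_left_mono powr_mono2) auto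
  have "carleson_seq z (c * t0 powr \<beta>)"
  proof unfold_locales
    show "c * t0 powr \<beta> \<le> norm (finite_blaschke z S (z j))" if "finite S" "j \<notin> S" for S j
      using le[of j] c(2)[OF that] by (simp add: t_def \<beta>_def)
  qed (use zD c t0 in auto)
  then show ?thesis by (rule that)
qed

subsection \<open>Carleson sequences\<close>

context carleson_seq
begin

definition eps :: "nat \<Rightarrow> real" where "eps j = 1 - norm (z j)"

lemma eps: "0 < eps j" "eps j \<le> 1"
  using norm_z[of j] by (auto simp: eps_def)

lemma \<delta>_le_1: "\<delta> \<le> 1"
  using carleson[of "{}" 0] by simp

lemma separated:
  assumes "l \<noteq> j"
  shows "\<delta> * eps j \<le> norm (z j - z l)" "\<delta> * eps l \<le> norm (z j - z l)"
proof -
  have d: "0 < norm (1 - cnj (z l) * z j)" "eps j \<le> norm (1 - cnj (z l) * z j)" "eps l \<le> norm (1 - cnj (z l) * z j)"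
    using one_minus_cnj_bounds[of "z l" "z j"] norm_z[of l] norm_z[of j] by (auto simp: eps_def)
  have "\<delta> \<le> norm (z j - z l) / norm (1 - cnj (z l) * z j)"
    using carleson[of "{l}" j] assms by (simp add: finite_blaschke_def norm_blaschke_factor)
  then have "\<delta> * norm (1 - cnj (z l) * z j) \<le> norm (z j - z l)"
    using d by (simp add: pos_le_divide_eq)
  then show "\<delta> * eps j \<le> norm (z j - z l)" "\<delta> * eps l \<le> norm (z j - z l)"
    using mult_left_mono[OF d(2), of \<delta>] mult_left_mono[OF d(3), of \<delta>] \<delta>_pos by linarith+
qed

lemma inj_z: "inj z"
proof (rule injI)
  fix l j assume "z l = z j"
  then show "l = j"
    using separated(1)[of l j] mult_pos_pos[OF \<delta>_pos eps(1)[of j]] by fastforce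
qed

lemma holomorphic_fb: "fb S holomorphic_on \<D>"
  using norm_z by (intro holomorphic_on_disc_finite_blaschke)

lemma norm_fb_le_1: "norm w \<le> 1 \<Longrightarrow> norm (fb S w) \<le> 1"
  using norm_z by (intro norm_finite_blaschke_le_1)

lemma fb_eq_0_iff: "finite S \<Longrightarrow> norm w \<le> 1 \<Longrightarrow> fb S w = 0 \<longleftrightarrow> w \<in> z ` S"
  using norm_z by (intro finite_blaschke_eq_0_iff)

lemma ball_eps_subset: "norm (w - z j) < eps j \<Longrightarrow> w \<in> \<D>"
  using norm_triangle_sub[of w "z j"] by (simp add: eps_def)

text \<open>Cauchy bounds the derivative near \<open>z j\<close> by \<open>4 / eps j\<close>; over a
  distance of \<open>\<delta> / 8 * eps j\<close> the product therefore changes by at most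
  \<open>\<delta> / 2\<close>.\<close>

lemma fb_lower_near:
  assumes S: "finite S" "j \<notin> S" and w: "norm (w - z j) \<le> \<delta> / 8 * eps j"
  shows "\<delta> / 2 \<le> norm (fb S w)"
proof -
  let ?f = "fb S" and ?C = "cball (z j) (\<delta> / 8 * eps j)"
  have e8: "\<delta> / 8 * eps j \<le> eps j / 8" using \<delta>_le_1 eps(1)[of j] mult_right_mono[of \<delta> 1 "eps j"] by simp
  have D: "ball x (eps j / 2) \<subseteq> \<D>" if "x \<in> ?C" for x
  proof
    fix y assume "y \<in> ball x (eps j / 2)"
    then have "norm (y - x) < eps j / 2" by (simp add: dist_norm norm_minus_commute)
    moreover have "norm (x - z j) \<le> \<delta> / 8 * eps j" using that by (simp add: dist_norm norm_minus_commute)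
    ultimately have "norm (y - z j) < eps j"
      using e8 eps(1)[of j] norm_triangle_ineq[of "y - x" "x - z j", simplified] by linarith
    then show "y \<in> \<D>" by (rule ball_eps_subset)
  qed
  have "norm (?f w - ?f (z j)) \<le> (4 / eps j) * norm (w - z j)"
  proof (rule field_differentiable_bound[of ?C ?f "deriv ?f"])
    fix x assume x: "x \<in> ?C"
    have "x \<in> \<D>" using D[OF x] eps(1)[of j] by (auto simp: subset_iff)
    then show "(?f has_field_derivative deriv ?f x) (at x within ?C)"
      by (intro has_field_derivative_at_within[OF holomorphic_derivI[OF holomorphic_fb]]) auto
    have "norm ((deriv ^^ 1) ?f x) \<le> fact 1 * 1 * (2 / (eps j / 2)) ^ 1"
      using D[OF x] eps(1)[of j] norm_fb_le_1
      by (intro norm_higher_deriv_ball_le holomorphic_on_subset[OF holomorphic_fb]) (auto simp: subset_iff)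
    then show "norm (deriv ?f x) \<le> 4 / eps j" by simp
  qed (use w \<delta>_pos eps(1)[of j] in \<open>auto simp: dist_norm norm_minus_commute\<close>)
  also have "\<dots> \<le> (4 / eps j) * (\<delta> / 8 * eps j)"
    using w eps(1)[of j] by (intro mult_left_mono) auto
  also have "\<dots> = \<delta> / 2" using eps(1)[of j] by simp
  finally have "norm (?f (z j)) - norm (?f w) \<le> \<delta> / 2"
    using norm_triangle_ineq2[of "?f (z j)" "?f w"] by (simp add: norm_minus_commute)
  then show ?thesis using carleson[OF S] by linarith
qed

text \<open>The factor of \<open>z l\<close> itself is at least \<open>\<theta> / 3\<close> on this
  circle, and \<open>fb_lower_near\<close> bounds the others by \<open>\<delta> / 2\<close>.\<close>

lemma fb_lower_circle:
  assumes S: "finite S" "l \<in> S" and \<theta>: "0 < \<theta>" "\<theta> \<le> \<delta> / 8" and w: "norm (w - z l) = \<theta> * eps l"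
  shows "\<theta> * \<delta> / 6 \<le> norm (fb S w)"
proof -
  have "\<theta> * eps l \<le> \<delta> / 8 * eps l" using \<theta> eps(1)[of l] by (intro mult_right_mono) auto
  then have 1: "\<delta> / 2 \<le> norm (fb (S - {l}) w)"
    using S w by (intro fb_lower_near[of _ l]) auto
  have \<theta>1: "\<theta> * eps l \<le> eps l" "\<theta> * eps l < eps l" using \<theta> \<delta>_le_1 eps(1)[of l] by (auto simp: mult_le_cancel_right1)
  then have wD: "w \<in> \<D>" using w by (intro ball_eps_subset[of _ l]) auto
  then have d: "0 < norm (1 - cnj (z l) * w)" "norm (1 - cnj (z l) * w) \<le> 2 * eps l + norm (w - z l)"
    using one_minus_cnj_bounds(4,5)[of "z l" w] norm_z[of l] by (auto simp: eps_def)
  have "\<theta> / 3 = \<theta> * eps l / (3 * eps l)" using eps(1)[of l] by simp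
  also have "\<dots> \<le> norm (w - z l) / norm (1 - cnj (z l) * w)"
  proof -
    have "norm (1 - cnj (z l) * w) \<le> 3 * eps l" using d w \<theta>1 by linarith
    then show ?thesis unfolding w using d \<theta> eps(1)[of l] by (intro divide_left_mono) auto
  qed
  finally have "\<theta> / 3 * (\<delta> / 2) \<le> norm (blaschke_factor (z l) w) * norm (fb (S - {l}) w)"
    using 1 \<theta> \<delta>_pos unfolding norm_blaschke_factor by (intro mult_mono) auto
  then show ?thesis using finite_blaschke_remove[OF S, of z w] by (simp add: norm_mult)
qed

text \<open>Maximum principle for the reciprocal on the disc with small discs around the zeros removed;
  on the unit circle the product is unimodular.\<close>

lemma fb_lower:
  assumes S: "finite S" and \<theta>: "0 < \<theta>" "\<theta> \<le> \<delta> / 8" and wD: "w \<in> \<D>"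
    and w: "\<And>l. l \<in> S \<Longrightarrow> \<theta> * eps l \<le> norm (w - z l)"
  shows "\<theta> * \<delta> / 6 \<le> norm (fb S w)"
proof (cases "\<exists>l\<in>S. norm (w - z l) = \<theta> * eps l")
  case True
  then show ?thesis using fb_lower_circle[OF S _ \<theta>] by blast
next
  case False
  define U where "U = \<D> \<inter> (\<Inter>l\<in>S. {x. \<theta> * eps l < norm (x - z l)})"
  define V where "V = cball 0 1 \<inter> (\<Inter>l\<in>S. {x. \<theta> * eps l \<le> norm (x - z l)})"
  let ?f = "\<lambda>x. 1 / fb S x"
  have U: "open U"
    unfolding U_def using S by (intro open_Int open_INT ballI open_Collect_less continuous_intros) auto
  have "closed V"
    unfolding V_def by (intro closed_Int closed_INT ballI closed_Collect_le continuous_intros closed_cball)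
  then have UV: "closure U \<subseteq> V"
    by (intro closure_minimal) (auto simp: U_def V_def intro: less_imp_le)
  have nz: "fb S x \<noteq> 0" if xV: "x \<in> V" for x
  proof
    assume "fb S x = 0"
    then obtain l where "l \<in> S" "x = z l" using fb_eq_0_iff[OF S, of x] xV by (auto simp: V_def)
    then have "\<theta> * eps l \<le> 0" using xV by (auto simp: V_def)
    then show False using mult_pos_pos[OF \<theta>(1) eps(1)[of l]] by simp
  qed
  have c: "\<theta> * \<delta> / 6 \<le> 1" using mult_mono[of \<theta> 1 \<delta> 1] \<theta> \<delta>_pos \<delta>_le_1 by simp
  have "norm (?f w) \<le> 6 / (\<theta> * \<delta>)"
  proof (rule maximum_modulus_frontier[of ?f U])
    have "U \<subseteq> V" using UV closure_subset by fast
    then show "?f holomorphic_on interior U"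
      unfolding interior_open[OF U] using nz
      by (intro holomorphic_intros holomorphic_on_subset[OF holomorphic_fb]) (auto simp: U_def)
    have "continuous_on (cball 0 1) (fb S)"
      using one_minus_cnj_bounds(4) norm_z
      by (intro holomorphic_on_imp_continuous_on holomorphic_on_finite_blaschke) auto
    then have "continuous_on (closure U) (fb S)"
      by (rule continuous_on_subset) (use UV in \<open>auto simp: V_def\<close>)
    then show "continuous_on (closure U) ?f"
      using nz UV by (intro continuous_intros) auto
    show "bounded U" by (rule bounded_subset[OF bounded_ball[of 0 1]]) (auto simp: U_def)
    have "\<theta> * eps l < norm (w - z l)" if "l \<in> S" for l
      using w[OF that] False that by force
    then show "w \<in> U" using wD by (auto simp: U_def)
    fix x assume x: "x \<in> frontier U"
    then have xV: "x \<in> V" "x \<notin> U" using UV U by (auto simp: frontier_def interior_open)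
    have "\<theta> * \<delta> / 6 \<le> norm (fb S x)"
    proof (cases "norm x = 1")
      case True
      then show ?thesis using norm_finite_blaschke_eq_1[of S z x] norm_z c by simp
    next
      case False
      then have "x \<in> \<D>" using xV(1) by (auto simp: V_def)
      then obtain l where "l \<in> S" "norm (x - z l) = \<theta> * eps l"
        using xV by (force simp: U_def V_def)
      then show ?thesis using fb_lower_circle[OF S _ \<theta>] by blast
    qed
    then show "norm (?f x) \<le> 6 / (\<theta> * \<delta>)"
      using \<theta> \<delta>_pos nz[OF xV(1)] by (simp add: norm_divide field_simps)
  qed
  moreover have "w \<in> V" using wD w by (auto simp: V_def)
  ultimately show ?thesis
    using \<theta> \<delta>_pos nz[of w] by (simp add: norm_divide field_simps)
qed

text \<open>Reflection in the unit circle extends finite Blaschke products, with control, to discs that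
  stick out of the unit disc.\<close>

lemma fb_reflection:
  assumes S: "finite S" and wD: "w \<in> \<D>" and D: "0 < D" "\<And>l. l \<in> S \<Longrightarrow> D \<le> norm (w - z l)"
    and x: "x \<in> ball w (D / 12)" "norm x \<ge> 1"
  shows "\<And>l. l \<in> S \<Longrightarrow> 1 - cnj (z l) * x \<noteq> 0" "norm (fb S x) \<le> 48 / \<delta>\<^sup>2"
    "1 \<le> norm (fb S x)"
proof -
  define y where "y = 1 / cnj x"
  have xw: "norm (x - w) < D / 12" using x(1) by (simp add: dist_norm norm_minus_commute)
  have x1: "norm x - 1 < D / 12" using xw wD norm_triangle_ineq2[of x w] by simp
  have y: "norm y = 1 / norm x" by (simp add: y_def norm_divide)
  have "x \<noteq> 0" using x(2) by auto
  then have y1: "norm y \<le> 1" using x(2) by (simp add: y)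
  have "cnj x \<noteq> 0" using x(2) by auto
  then have "x - y = complex_of_real (norm x ^ 2 - 1) / cnj x"
    using complex_norm_square[of x] by (simp add: y_def field_simps)
  then have "norm (x - y) = (norm x ^ 2 - 1) / norm x"
    using x(2) by (simp only: norm_divide norm_of_real complex_mod_cnj) simp
  also have "\<dots> = (norm x - 1) * (1 + norm x) / norm x" by (simp add: power2_eq_square algebra_simps)
  also have "\<dots> \<le> (norm x - 1) * 2"
  proof -
    have "(1 + norm x) / norm x \<le> 2" using x(2) by (simp add: divide_le_eq)
    then show ?thesis using x(2) mult_left_mono[of "(1 + norm x) / norm x" 2 "norm x - 1"] by simp
  qed
  finally have xy: "norm (x - y) < D / 6" using x1 by simp
  \<comment> \<open>The radius \<open>D / 12\<close> is made for this:
    \<open>D / 12 + D / 6 = D / 4\<close>, so the reflected point keeps distance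
    \<open>3 / 4 * D\<close> from the zeros.\<close>
  have yw: "norm (y - w) < D / 4"
    using norm_triangle_lt[of "y - x" "x - w" "D / 4"] xy xw by (simp add: norm_minus_commute)
  \<comment> \<open>The second bound holds because \<open>y\<close> is within \<open>D / 12\<close>
    of the circle. It makes \<open>fb_lower\<close> applicable at \<open>y\<close> with
    \<open>\<theta> = \<delta> / 8\<close>, and the product with the value at \<open>x\<close> is
    unimodular.\<close>
  have yz: "3 / 4 * D \<le> norm (y - z l)" "eps l \<le> 2 * norm (y - z l)" if "l \<in> S" for l
  proof -
    show 1: "3 / 4 * D \<le> norm (y - z l)"
      using D(2)[OF that] yw norm_triangle_ineq[of "w - y" "y - z l"] by (simp add: norm_minus_commute)
    have "1 - norm y \<le> norm x - 1"
    proof -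
      have "1 - norm y = (norm x - 1) / norm x" using \<open>x \<noteq> 0\<close> by (simp add: y field_simps)
      also have "\<dots> \<le> (norm x - 1) / 1" using x(2) by (intro divide_left_mono) auto
      finally show ?thesis by simp
    qed
    moreover have "eps l \<le> (1 - norm y) + norm (y - z l)"
      using norm_triangle_sub[of y "z l"] by (simp add: eps_def)
    ultimately show "eps l \<le> 2 * norm (y - z l)" using 1 x1 D(1) by linarith
  qed
  have ynz: "y \<notin> z ` S" using yz(1) D(1) by force
  then show "\<And>l. l \<in> S \<Longrightarrow> 1 - cnj (z l) * x \<noteq> 0"
    using norm_blaschke_factor_reflect(2)[OF norm_z x(2)] unfolding y_def by auto
  have prod1: "norm (fb S x) * norm (fb S y) = 1"
    using norm_finite_blaschke_reflect[of S z x] norm_z x(2) ynz by (simp add: y_def)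
  have "y \<noteq> 0" using x(2) by (auto simp: y_def)
  show "1 \<le> norm (fb S x)"
    using prod1 norm_fb_le_1[OF y1, of S] mult_left_mono[of "norm (fb S y)" 1 "norm (fb S x)"] by simp
  have "\<delta>\<^sup>2 / 48 \<le> norm (fb S y)"
  proof (cases "norm y = 1")
    case True
    moreover have "\<delta>\<^sup>2 \<le> 1" using \<delta>_pos \<delta>_le_1 by (simp add: power_le_one)
    ultimately show ?thesis using norm_finite_blaschke_eq_1[of S z y] norm_z by simp
  next
    case False
    have "\<delta> / 8 * \<delta> / 6 \<le> norm (fb S y)"
    proof (rule fb_lower[OF S])
      fix l assume l: "l \<in> S"
      have "\<delta> / 8 * eps l \<le> 1 / 2 * eps l" using \<delta>_le_1 eps(1)[of l] by (intro mult_right_mono) auto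
      then show "\<delta> / 8 * eps l \<le> norm (y - z l)" using yz(2)[OF l] by simp
    qed (use \<delta>_pos y1 False in auto)
    then show ?thesis by (simp add: power2_eq_square)
  qed
  then have "norm (fb S x) * (\<delta>\<^sup>2 / 48) \<le> 1"
    using prod1 mult_left_mono[of "\<delta>\<^sup>2 / 48" _ "norm (fb S x)"] by fastforce
  then show "norm (fb S x) \<le> 48 / \<delta>\<^sup>2" using \<delta>_pos by (simp add: field_simps)
qed

lemma one_le_48: "1 \<le> 48 / \<delta>\<^sup>2"
  using \<delta>_pos \<delta>_le_1 power_le_one[of \<delta> 2] by (simp add: field_simps)

lemma fb_extension:
  assumes S: "finite S" and wD: "w \<in> \<D>" and D: "0 < D" "\<And>l. l \<in> S \<Longrightarrow> D \<le> norm (w - z l)"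
  shows "fb S holomorphic_on ball w (D / 12)"
    "\<And>x. x \<in> ball w (D / 12) \<Longrightarrow> norm (fb S x) \<le> 48 / \<delta>\<^sup>2"
proof -
  have "1 - cnj (z l) * x \<noteq> 0" if "l \<in> S" "x \<in> ball w (D / 12)" for l x
    using fb_reflection(1)[OF S wD D that(2) _ that(1)] one_minus_cnj_bounds(4)[of "z l" x] norm_z[of l]
    by (cases "norm x \<ge> 1") auto
  then show "fb S holomorphic_on ball w (D / 12)"
    by (intro holomorphic_on_finite_blaschke)
  show "norm (fb S x) \<le> 48 / \<delta>\<^sup>2" if "x \<in> ball w (D / 12)" for x
  proof (cases "norm x \<ge> 1")
    case True
    then show ?thesis using fb_reflection(2)[OF S wD D that] by blast
  next
    case False
    then show ?thesis using norm_fb_le_1[of x S] one_le_48 by simp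
  qed
qed

text \<open>A bound for the reciprocal needs more than distance to the zeros: that distance has to
  be comparable with each \<open>eps l\<close>. The hypothesis on \<open>\<kappa>\<close> ensures it
  through \<open>eps l \<le> (\<kappa> + 1) * norm (w - z l)\<close>.\<close>

lemma fb_inverse_extension:
  assumes S: "finite S" and wD: "w \<in> \<D>" and D: "0 < D" "\<And>l. l \<in> S \<Longrightarrow> D \<le> norm (w - z l)"
    and \<kappa>: "0 \<le> \<kappa>" "1 - norm w \<le> \<kappa> * D"
  shows "(\<lambda>x. 1 / fb S x) holomorphic_on ball w (D / 12)"
    "\<And>x. x \<in> ball w (D / 12) \<Longrightarrow> norm (1 / fb S x) \<le> 96 * (\<kappa> + 1) / \<delta>\<^sup>2"
proof -
  \<comment> \<open>Small enough for \<open>fb_lower\<close> and to absorb the factor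
    \<open>(\<kappa> + 1) * 12 / 11\<close> that arises in passing from \<open>w\<close> to
    \<open>x\<close>.\<close>
  define \<theta> where "\<theta> = \<delta> / (16 * (\<kappa> + 1))"
  have \<theta>: "0 < \<theta>" "\<theta> \<le> \<delta> / 8"
    using \<delta>_pos \<kappa>(1) unfolding \<theta>_def by (simp, intro divide_left_mono) auto
  have c: "\<theta> * \<delta> / 6 = \<delta>\<^sup>2 / (96 * (\<kappa> + 1))" by (simp add: \<theta>_def power2_eq_square field_simps)
  have low: "\<delta>\<^sup>2 / (96 * (\<kappa> + 1)) \<le> norm (fb S x)" if x: "x \<in> ball w (D / 12)" for x
  proof (cases "norm x \<ge> 1")
    case True
    have "\<delta>\<^sup>2 / (96 * (\<kappa> + 1)) \<le> 1 / 1"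
      using \<kappa>(1) \<delta>_pos \<delta>_le_1 by (intro frac_le) (auto intro!: power_le_one)
    then show ?thesis using fb_reflection(3)[OF S wD D x True] by simp
  next
    case False
    have "\<theta> * \<delta> / 6 \<le> norm (fb S x)"
    proof (rule fb_lower[OF S \<theta>])
      show "x \<in> \<D>" using False by simp
      fix l assume l: "l \<in> S"
      have wl: "D \<le> norm (w - z l)" using D(2)[OF l] .
      have "norm (w - z l) \<le> norm (w - x) + norm (x - z l)" using norm_triangle_ineq[of "w - x" "x - z l"] by simp
      then have 1: "norm (w - z l) \<le> 12 / 11 * norm (x - z l)" using x wl by (simp add: dist_norm)
      have "eps l \<le> (1 - norm w) + norm (w - z l)"
        using norm_triangle_sub[of w "z l"] by (simp add: eps_def)
      also have "\<dots> \<le> \<kappa> * norm (w - z l) + norm (w - z l)"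
        using \<kappa> wl mult_left_mono[OF wl \<kappa>(1)] by linarith
      also have "\<dots> = (\<kappa> + 1) * norm (w - z l)" by (simp add: distrib_right)
      also have "\<dots> \<le> (\<kappa> + 1) * (12 / 11 * norm (x - z l))" using 1 \<kappa> by (intro mult_left_mono) auto
      finally have "\<theta> * eps l \<le> \<theta> * ((\<kappa> + 1) * (12 / 11 * norm (x - z l)))"
        using \<theta> by (intro mult_left_mono) auto
      also have "\<dots> = \<delta> * (12 / 176) * norm (x - z l)" using \<kappa>(1) by (simp add: \<theta>_def field_simps)
      also have "\<dots> \<le> 1 * norm (x - z l)" using \<delta>_le_1 by (intro mult_right_mono) auto
      finally show "\<theta> * eps l \<le> norm (x - z l)" by simp
    qed
    then show ?thesis by (simp add: c)
  qed
  have pos: "\<delta>\<^sup>2 / (96 * (\<kappa> + 1)) > 0" using \<delta>_pos \<kappa> by simp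
  show "(\<lambda>x. 1 / fb S x) holomorphic_on ball w (D / 12)"
    using low pos by (intro holomorphic_intros fb_extension(1)[OF S wD D]) fastforce+
  show "norm (1 / fb S x) \<le> 96 * (\<kappa> + 1) / \<delta>\<^sup>2" if "x \<in> ball w (D / 12)" for x
    using low[OF that] pos le_imp_inverse_le[OF low[OF that] pos] by (simp add: norm_divide inverse_eq_divide)
qed

text \<open>Logarithms turn a lower bound for the product into an upper bound for a sum:
  \<open>1 - t \<le> - ln t\<close> with \<open>t\<close> the squared modulus of each
  factor.\<close>

lemma carleson_sum_aux:
  assumes S: "finite S" and w: "w \<in> \<D>" and b: "0 < b" "b \<le> norm (fb S w)"
  shows "(\<Sum>l\<in>S. eps l / norm (1 - cnj (z l) * w) ^ 2) * (1 - norm w) \<le> - 2 * ln b"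
proof -
  have nz: "norm (blaschke_factor (z l) w) > 0" if "l \<in> S" for l
    using b that prod_zero[OF S, of "\<lambda>l. blaschke_factor (z l) w"] by (force simp: finite_blaschke_def)
  have "(\<Sum>l\<in>S. eps l / norm (1 - cnj (z l) * w) ^ 2) * (1 - norm w)
      = (\<Sum>l\<in>S. eps l * (1 - norm w) / norm (1 - cnj (z l) * w) ^ 2)"
    by (simp add: sum_distrib_right)
  also have "\<dots> \<le> (\<Sum>l\<in>S. - 2 * ln (norm (blaschke_factor (z l) w)))"
  proof (rule sum_mono)
    fix l assume l: "l \<in> S"
    have sq: "x \<le> 1 - (1 - x) ^ 2" if "0 \<le> x" "x \<le> 1" for x :: real
      using mult_left_le[of x x] that by (simp add: power2_eq_square algebra_simps)
    have "eps l * (1 - norm w) \<le> (1 - norm (z l) ^ 2) * (1 - norm w ^ 2)"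
      using sq[of "1 - norm (z l)"] sq[of "1 - norm w"] norm_z[of l] w
      by (intro mult_mono) (auto simp: eps_def)
    then have "eps l * (1 - norm w) / norm (1 - cnj (z l) * w) ^ 2
        \<le> (1 - norm (z l) ^ 2) * (1 - norm w ^ 2) / norm (1 - cnj (z l) * w) ^ 2"
      by (intro divide_right_mono) auto
    also have "\<dots> = 1 - norm (blaschke_factor (z l) w) ^ 2"
      using one_minus_norm_blaschke_factor_power2[of "z l" w] norm_z[of l] w by simp
    also have "\<dots> \<le> - ln (norm (blaschke_factor (z l) w) ^ 2)"
      using ln_le_minus_one[of "norm (blaschke_factor (z l) w) ^ 2"] nz[OF l] by simp
    also have "\<dots> = - 2 * ln (norm (blaschke_factor (z l) w))"
      using nz[OF l] by (simp add: ln_realpow)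
    finally show "eps l * (1 - norm w) / norm (1 - cnj (z l) * w) ^ 2
        \<le> - 2 * ln (norm (blaschke_factor (z l) w))" .
  qed
  also have "\<dots> = - 2 * ln (norm (fb S w))"
    using nz S unfolding finite_blaschke_def prod_norm[symmetric]
    by (subst ln_prod) (auto simp: sum_distrib_left)
  also have "\<dots> \<le> - 2 * ln b"
    using b ln_mono[of b "norm (fb S w)"] by linarith
  finally show ?thesis .
qed

text \<open>The masses \<open>eps l\<close> at the zeros form a Carleson measure, tested on the
  usual kernels. If \<open>w\<close> is so close to a zero that the product may be small, that zero
  is removed; its own term is at most 1, whence the 1 in \<open>K\<close>.\<close>

lemma carleson_measure:
  obtains K where "K > 0" "\<And>(S :: nat set) w. finite S \<Longrightarrow> w \<in> \<D> \<Longrightarrow>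
    (\<Sum>l\<in>S. eps l / norm (1 - cnj (z l) * w) ^ 2) \<le> K / (1 - norm w)"
proof
  define b where "b = \<delta>\<^sup>2 / 48"
  have b: "0 < b" "b \<le> 1" "b \<le> \<delta> / 2"
    using \<delta>_pos \<delta>_le_1 power_le_one[of \<delta> 2] mult_left_mono[of \<delta> 1 \<delta>] by (auto simp: b_def power2_eq_square)
  define K where "K = 1 - 2 * ln b"
  have "ln b \<le> 0" using b by simp
  then show "K > 0" by (simp add: K_def)
  fix S :: "nat set" and w assume S: "finite S" and w: "w \<in> \<D>"
  have "(\<Sum>l\<in>S. eps l / norm (1 - cnj (z l) * w) ^ 2) * (1 - norm w) \<le> K"
  proof (cases "\<exists>j\<in>S. norm (w - z j) < \<delta> / 8 * eps j")
    case True
    then obtain j where j: "j \<in> S" "norm (w - z j) < \<delta> / 8 * eps j" by blast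
    have "b \<le> norm (fb (S - {j}) w)"
      using fb_lower_near[of "S - {j}" j w] j S b by simp
    then have 1: "(\<Sum>l\<in>S - {j}. eps l / norm (1 - cnj (z l) * w) ^ 2) * (1 - norm w) \<le> - 2 * ln b"
      using S w b by (intro carleson_sum_aux) auto
    have d: "eps j \<le> norm (1 - cnj (z j) * w)" "1 - norm w \<le> norm (1 - cnj (z j) * w)" "0 < norm (1 - cnj (z j) * w)"
      using one_minus_cnj_bounds[of "z j" w] norm_z[of j] w by (auto simp: eps_def)
    have "eps j * (1 - norm w) \<le> norm (1 - cnj (z j) * w) ^ 2"
      unfolding power2_eq_square using d w by (intro mult_mono) auto
    then have 2: "eps j / norm (1 - cnj (z j) * w) ^ 2 * (1 - norm w) \<le> 1" using d by (simp add: divide_le_eq)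
    show ?thesis
      unfolding sum.remove[OF S j(1)] using 1 2 by (simp only: K_def distrib_right)
  next
    case False
    have "\<delta> / 8 * \<delta> / 6 \<le> norm (fb S w)"
      using False \<delta>_pos w by (intro fb_lower[OF S]) (auto simp: not_less)
    then have "b \<le> norm (fb S w)" by (simp add: b_def power2_eq_square)
    from carleson_sum_aux[OF S w b(1) this] show ?thesis by (simp add: K_def)
  qed
  then show "(\<Sum>l\<in>S. eps l / norm (1 - cnj (z l) * w) ^ 2) \<le> K / (1 - norm w)"
    using w by (simp add: pos_le_divide_eq)
qed

end

subsection \<open>Multiplication by functions with controlled extensions\<close>

text \<open>\<open>f\<close> is split into \<open>T\<close> and \<open>f - T\<close>, and Cauchy's
  estimate is used at two scales: radius \<open>c * D\<close> for \<open>T\<close>, which may leave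
  the unit disc, and \<open>c * (1 - norm w)\<close> for the remainder, which need not
  continue.\<close>

lemma norm_higher_deriv_mult_le:
  assumes w: "w \<in> \<D>" and D: "1 - norm w \<le> D" and c: "0 < c" "c \<le> 1/2" and \<alpha>: "0 < \<alpha>" "\<alpha> < real m"
    and holf: "f holomorphic_on \<D>" and holT: "T holomorphic_on ball w (c * D)"
    and hol\<Phi>: "\<Phi> holomorphic_on ball w (c * D)"
    and K: "\<And>x. x \<in> ball w (c * D) \<Longrightarrow> norm (\<Phi> x) \<le> K"
    and T: "\<And>x. x \<in> ball w (c * D) \<Longrightarrow> norm (T x) \<le> C * D powr \<alpha>"
    and fT: "\<And>x. x \<in> ball w (c * (1 - norm w)) \<Longrightarrow> norm (f x - T x) \<le> C * (1 - norm w) powr \<alpha>"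
  shows "norm ((deriv ^^ m) (\<lambda>x. f x * \<Phi> x) w)
    \<le> 2 * fact m * C * K * (2 / c) ^ m * (1 - norm w) powr (\<alpha> - real m)"
proof -
  define r where "r = 1 - norm w"
  have r: "0 < r" "r \<le> D" using w D by (auto simp: r_def)
  have C0: "0 \<le> C" using order_trans[OF norm_ge_zero T[of w]] r c by (simp add: zero_le_mult_iff)
  have K0: "0 \<le> K" using order_trans[OF norm_ge_zero K[of w]] r c by simp
  have sub: "ball w (c * r) \<subseteq> ball w (c * D)" using r c by (intro subset_ball mult_left_mono) auto
  have subD: "ball w (c * r) \<subseteq> \<D>"
  proof
    fix x assume "x \<in> ball w (c * r)"
    moreover have "c * r \<le> 1 * r" using c r by (intro mult_right_mono) auto
    ultimately show "x \<in> \<D>" using norm_triangle_sub[of x w] by (simp add: r_def dist_norm norm_minus_commute)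
  qed
  have hol1: "(\<lambda>x. (f x - T x) * \<Phi> x) holomorphic_on ball w (c * r)"
    using sub subD by (intro holomorphic_intros holomorphic_on_subset[OF holf]
        holomorphic_on_subset[OF holT] holomorphic_on_subset[OF hol\<Phi>]) auto
  have hol2: "(\<lambda>x. T x * \<Phi> x) holomorphic_on ball w (c * D)"
    by (intro holomorphic_intros holT hol\<Phi>)
  have "(\<lambda>x. f x * \<Phi> x) = (\<lambda>x. (f x - T x) * \<Phi> x + T x * \<Phi> x)"
    by (simp add: left_diff_distrib)
  then have eq: "(deriv ^^ m) (\<lambda>x. f x * \<Phi> x) w
      = (deriv ^^ m) (\<lambda>x. (f x - T x) * \<Phi> x) w + (deriv ^^ m) (\<lambda>x. T x * \<Phi> x) w"
    using r c by (simp only:) (intro higher_deriv_add[OF hol1 holomorphic_on_subset[OF hol2 sub]], auto)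
  have pow: "fact m * (C * y powr \<alpha> * K) * (2 / (c * y)) ^ m = fact m * C * K * (2 / c) ^ m * y powr (\<alpha> - real m)"
    if "y > 0" for y
    using that c by (simp add: power_divide power_mult_distrib powr_diff powr_realpow field_simps)
  define X where "X = fact m * C * K * (2 / c) ^ m * r powr (\<alpha> - real m)"
  have "norm ((deriv ^^ m) (\<lambda>x. (f x - T x) * \<Phi> x) w) \<le> fact m * (C * r powr \<alpha> * K) * (2 / (c * r)) ^ m"
  proof (rule norm_higher_deriv_ball_le[OF hol1])
    show "norm ((f x - T x) * \<Phi> x) \<le> C * r powr \<alpha> * K" if "x \<in> ball w (c * r)" for x
      unfolding norm_mult using fT[of x] K[of x] that sub C0 K0 by (intro mult_mono) (auto simp: r_def)
  qed (use r c in auto)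
  then have 1: "norm ((deriv ^^ m) (\<lambda>x. (f x - T x) * \<Phi> x) w) \<le> X"
    unfolding pow[OF r(1)] X_def .
  have "norm ((deriv ^^ m) (\<lambda>x. T x * \<Phi> x) w) \<le> fact m * (C * D powr \<alpha> * K) * (2 / (c * D)) ^ m"
  proof (rule norm_higher_deriv_ball_le[OF hol2])
    show "norm (T x * \<Phi> x) \<le> C * D powr \<alpha> * K" if "x \<in> ball w (c * D)" for x
      unfolding norm_mult using T[OF that] K[OF that] C0 K0 by (intro mult_mono) auto
  qed (use r c in auto)
  also have "\<dots> = fact m * C * K * (2 / c) ^ m * D powr (\<alpha> - real m)" using r by (intro pow) auto
  \<comment> \<open>Here \<open>\<alpha> < real m\<close> is essential: the exponent is negative, so
    the larger scale \<open>D\<close> gives the smaller bound.\<close>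
  also have "\<dots> \<le> X"
    unfolding X_def using r \<alpha> c C0 K0 by (intro mult_left_mono powr_mono2') auto
  finally have 2: "norm ((deriv ^^ m) (\<lambda>x. T x * \<Phi> x) w) \<le> X" .
  have "2 * fact m * C * K * (2 / c) ^ m * (1 - norm w) powr (\<alpha> - real m) = X + X"
    by (simp add: X_def r_def)
  then show ?thesis
    unfolding eq using norm_triangle_le[OF add_mono[OF 1 2]] by simp
qed

text \<open>Transfers a bound on the jet at a zero \<open>v\<close> to the Taylor polynomial at
  \<open>w\<close>. The point \<open>x\<close> is within \<open>2 * D\<close> of \<open>v\<close>,
  which produces the factor \<open>2 powr \<alpha>\<close>.\<close>

lemma taylor_poly_bound_of_jet:
  assumes tb: "taylor_bound n \<alpha> C f"
    and \<alpha>: "real n < \<alpha>" and P: "P \<ge> 0" and wv: "w \<in> \<D>" "v \<in> \<D>" "norm (w - v) \<le> D"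
    and D: "D > 0" "norm (x - w) \<le> D"
    and jet: "\<And>s. s \<le> n \<Longrightarrow> norm ((deriv ^^ s) f v) \<le> P * D powr (\<alpha> - real s)"
  shows "norm (taylor f n w x) \<le> real (Suc n) * (C + P * 2 powr \<alpha>) * D powr \<alpha>"
proof -
  have "norm (taylor f n v x) \<le> real (Suc n) * (P * (2 * D) powr \<alpha>)"
  proof (rule norm_taylor_poly_le_powr)
    fix i assume i: "i \<le> n"
    have "P * D powr (\<alpha> - real i) \<le> P * (2 * D) powr (\<alpha> - real i)"
      using P D \<alpha> i by (intro mult_left_mono powr_mono2) auto
    then show "norm ((deriv ^^ i) f v) \<le> P * (2 * D) powr (\<alpha> - real i)" using jet[OF i] by linarith
  next
    show "norm (x - v) \<le> 2 * D" using norm_triangle_ineq[of "x - w" "w - v"] wv D by simp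
  qed (use D in auto)
  moreover have "norm (taylor f n w x - taylor f n v x)
      \<le> real (Suc n) * (C * D powr \<alpha>)"
    by (rule A_space_jet_diff[OF tb]) (use \<alpha> wv D in auto)
  ultimately have "norm (taylor f n w x)
      \<le> real (Suc n) * (C * D powr \<alpha>) + real (Suc n) * (P * (2 * D) powr \<alpha>)"
    using norm_triangle_sub[of "taylor f n w x"] by (smt (verit, best))
  also have "\<dots> = real (Suc n) * (C + P * 2 powr \<alpha>) * D powr \<alpha>"
    using D by (simp add: powr_mult algebra_simps)
  finally show ?thesis .
qed

text \<open>A bound from \<open>one_minus_cnj_bounds\<close> freed of the restriction to the closed
  disc, for use on discs that stick out of it.\<close>

lemma norm_one_minus_cnj_le:
  assumes "norm a < 1"
  shows "norm (1 - cnj a * w) \<le> 2 * (1 - norm a) + norm (w - a)"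
proof -
  have "1 - cnj a * w = (1 - cnj a * a) - cnj a * (w - a)" by (simp add: algebra_simps)
  then have "norm (1 - cnj a * w) \<le> norm (1 - cnj a * a) + norm (cnj a * (w - a))"
    by (metis norm_triangle_ineq4)
  also have "norm (cnj a * (w - a)) \<le> norm (w - a)"
    using assms by (simp add: norm_mult mult_left_le_one_le)
  finally show ?thesis using one_minus_cnj_bounds(5)[of a a] assms by simp
qed

subsection \<open>Functions that a power of the Blaschke product keeps smooth\<close>

text \<open>At a zero whose distance \<open>d j\<close> to the other zeros is large the function looks like
  \<open>(1 - cnj (z j) x) ^ k\<close>, which cancels the poles of \<open>B ^ k\<close> at the reflected zero.\<close>

lemma (in carleson_seq) smooth_mult_bound:
  fixes d :: "nat \<Rightarrow> real"
  assumes f: "f \<in> A_space \<alpha>" and \<alpha>: "real n < \<alpha>" "\<alpha> < real n + 1" and k: "k \<le> n"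
    and d: "\<And>j. 0 < d j" "\<And>j. \<delta> * eps j \<le> d j" "\<And>j l. l \<noteq> j \<Longrightarrow> d j \<le> norm (z j - z l)"
    and jet: "\<And>j s. s \<le> n \<Longrightarrow> norm ((deriv ^^ s) f (z j)) \<le> P * d j powr (\<alpha> - real s)"
    and poly: "\<And>j x. taylor f n (z j) x
      = complex_of_real (d j powr (\<alpha> - real k)) * (1 - cnj (z j) * x) ^ k"
  obtains M where "\<And>S w. finite S \<Longrightarrow> S \<noteq> {} \<Longrightarrow> w \<in> \<D> \<Longrightarrow>
    norm ((deriv ^^ Suc n) (\<lambda>x. f x * fb S x ^ k) w) \<le> M * (1 - norm w) powr (\<alpha> - real (Suc n))"
proof -
  obtain C where tb: "taylor_bound n \<alpha> C f" using A_space_taylor[OF f \<alpha>] .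
  note C = taylor_boundD[OF tb]
  note holf = A_space_holomorphic[OF f]
  define m where "m = Suc n"
  have \<alpha>m: "0 < \<alpha>" "\<alpha> < real m" using \<alpha> by (auto simp: m_def)
  define K where "K = 48 / \<delta>\<^sup>2"
  have K: "1 \<le> K" using one_le_48 by (simp add: K_def)
  have P: "0 \<le> P"
  proof -
    have "0 \<le> P * d 0 powr \<alpha>" using order_trans[OF norm_ge_zero jet[of 0 0]] by simp
    then show ?thesis using d(1)[of 0] by (simp add: zero_le_mult_iff)
  qed
  have near: "norm (f x - taylor f n w x) \<le> C * (1 - norm w) powr \<alpha>"
    if "w \<in> \<D>" "x \<in> ball w (c * (1 - norm w))" "0 < c" "c \<le> 1/2" for x w c
  proof -
    have "c * (1 - norm w) \<le> 1 * (1 - norm w)" using that by (intro mult_right_mono) auto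
    moreover have "norm (x - w) < c * (1 - norm w)" using that by (simp add: dist_norm norm_minus_commute)
    ultimately have xw: "norm (x - w) < 1 - norm w" by simp
    then have "x \<in> \<D>" using norm_triangle_sub[of x w] by simp
    then have "norm (f x - taylor f n w x) \<le> C * norm (x - w) powr \<alpha>"
      using C(2)[of 0 x w] that by simp
    also have "\<dots> \<le> C * (1 - norm w) powr \<alpha>" using C xw \<alpha>m by (intro mult_left_mono powr_mono2) auto
    finally show ?thesis .
  qed
  define C1 where "C1 = max C (real (Suc n) * (C + (P * 48 powr \<alpha>) * 2 powr \<alpha>))"
  define M1 where "M1 = 2 * fact m * C1 * K ^ k * (2 / (1/12)) ^ m"
  define C2 where "C2 = real (Suc n) * C"
  \<comment> \<open>Near \<open>z j\<close> the distance \<open>D\<close> below is at most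
    \<open>3 * d j / \<delta>\<close>, so that \<open>c * D \<le> d j / 24\<close> and the disc
    stays where the other factors are controlled.\<close>
  define c where "c = \<delta> / 72"
  have c: "0 < c" "c \<le> 1/2" using \<delta>_pos \<delta>_le_1 by (auto simp: c_def)
  define M2 where "M2 = 2 * fact m * C2 * (4 * K) ^ k * (2 / c) ^ m"
  define M3 where "M3 = fact m * K ^ k * 48 ^ m * (\<delta> / 2) powr (\<alpha> - real m)"
  define M where "M = max M1 (M2 + M3)"
  have "norm ((deriv ^^ m) (\<lambda>x. f x * fb S x ^ k) w) \<le> M * (1 - norm w) powr (\<alpha> - real m)"
    if S: "finite S" "S \<noteq> {}" and w: "w \<in> \<D>" for S w
  proof (cases "\<exists>j\<in>S. norm (w - z j) < d j / 48")
    case False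
    obtain j where j: "j \<in> S" "\<And>l. l \<in> S \<Longrightarrow> norm (w - z j) \<le> norm (w - z l)"
      using ex_is_arg_min_if_finite[OF S, of "\<lambda>l. norm (w - z l)"] by (auto simp: is_arg_min_linorder)
    define D0 where "D0 = norm (w - z j)"
    \<comment> \<open>If the distance to the zeros dominates, reflection controls the product on the
      larger disc; if \<open>1 - norm w\<close> dominates, the disc stays inside and the product is
      bounded by 1.\<close>
    define D where "D = max (1 - norm w) D0"
    have dj: "d j \<le> 48 * D0" using False j(1) by (auto simp: D0_def)
    have D0: "0 < D0" using d(1)[of j] dj by linarith
    have D: "1 - norm w \<le> D" "D0 \<le> D" "0 < D" using D0 by (auto simp: D_def)
    have fbD: "fb S holomorphic_on ball w (1/12 * D)"
        "\<And>x. x \<in> ball w (1/12 * D) \<Longrightarrow> norm (fb S x) \<le> K"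
    proof -
      show "fb S holomorphic_on ball w (1/12 * D)"
        "\<And>x. x \<in> ball w (1/12 * D) \<Longrightarrow> norm (fb S x) \<le> K"
      proof (atomize (full), cases "D = D0")
        case True
        then show "fb S holomorphic_on ball w (1/12 * D) \<and>
            (\<forall>x. x \<in> ball w (1/12 * D) \<longrightarrow> norm (fb S x) \<le> K)"
          using fb_extension[OF S(1) w D0] j(2) by (simp add: D0_def K_def)
      next
        case False
        then have "D = 1 - norm w" by (auto simp: D_def)
        have sub: "ball w (1/12 * D) \<subseteq> \<D>"
        proof
          fix x assume "x \<in> ball w (1/12 * D)"
          then have "norm (x - w) < 1/12 * D" by (simp add: dist_norm norm_minus_commute)
          then show "x \<in> \<D>" using \<open>D = 1 - norm w\<close> D(3) norm_triangle_sub[of x w] by simp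
        qed
        then have "norm (fb S x) \<le> K" if "x \<in> ball w (1/12 * D)" for x
          using norm_fb_le_1[of x S] K that by force
        then show "fb S holomorphic_on ball w (1/12 * D) \<and>
            (\<forall>x. x \<in> ball w (1/12 * D) \<longrightarrow> norm (fb S x) \<le> K)"
          using holomorphic_on_subset[OF holomorphic_fb sub] by blast
      qed
    qed
    have "norm ((deriv ^^ m) (\<lambda>x. f x * fb S x ^ k) w)
        \<le> 2 * fact m * C1 * K ^ k * (2 / (1/12)) ^ m * (1 - norm w) powr (\<alpha> - real m)"
    proof (rule norm_higher_deriv_mult_le[OF w D(1) _ _ \<alpha>m holf, of "1/12" "taylor f n w"])
      show "(\<lambda>x. fb S x ^ k) holomorphic_on ball w (1/12 * D)"
        by (intro holomorphic_intros fbD)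
      show "norm (fb S x ^ k) \<le> K ^ k" if "x \<in> ball w (1/12 * D)" for x
        using fbD(2)[OF that] by (simp add: norm_power power_mono)
      have "norm (taylor f n w x)
          \<le> real (Suc n) * (C + (P * 48 powr \<alpha>) * 2 powr \<alpha>) * D powr \<alpha>" if x: "x \<in> ball w (1/12 * D)" for x
      proof (rule taylor_poly_bound_of_jet[OF tb \<alpha>(1)])
        fix s assume s: "s \<le> n"
        have "norm ((deriv ^^ s) f (z j)) \<le> P * d j powr (\<alpha> - real s)" by (rule jet[OF s])
        also have "\<dots> \<le> P * (48 * D) powr (\<alpha> - real s)"
          using P dj D d(1)[of j] s \<alpha> by (intro mult_left_mono powr_mono2) auto
        also have "\<dots> = P * 48 powr (\<alpha> - real s) * D powr (\<alpha> - real s)" using D by (simp add: powr_mult)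
        also have "\<dots> \<le> P * 48 powr \<alpha> * D powr (\<alpha> - real s)"
          using P by (intro mult_right_mono mult_left_mono powr_mono) auto
        finally show "norm ((deriv ^^ s) f (z j)) \<le> P * 48 powr \<alpha> * D powr (\<alpha> - real s)" .
      qed (use w norm_z D x P in \<open>auto simp: D0_def dist_norm norm_minus_commute\<close>)
      note bT = this
      have "real (Suc n) * (C + (P * 48 powr \<alpha>) * 2 powr \<alpha>) * D powr \<alpha> \<le> C1 * D powr \<alpha>"
        by (intro mult_right_mono) (auto simp: C1_def)
      then show "norm (taylor f n w x) \<le> C1 * D powr \<alpha>"
        if "x \<in> ball w (1/12 * D)" for x
        using bT[OF that] by linarith
      have "C * (1 - norm w) powr \<alpha> \<le> C1 * (1 - norm w) powr \<alpha>"
        by (intro mult_right_mono) (auto simp: C1_def)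
      then show "norm (f x - taylor f n w x) \<le> C1 * (1 - norm w) powr \<alpha>"
        if "x \<in> ball w (1/12 * (1 - norm w))" for x
        using near[OF w that] by linarith
    qed (auto intro: holomorphic_taylor_poly)
    also have "\<dots> \<le> M * (1 - norm w) powr (\<alpha> - real m)"
      by (intro mult_right_mono) (auto simp: M_def M1_def)
    finally show ?thesis .
  next
    case True
    then obtain j where j: "j \<in> S" "norm (w - z j) < d j / 48" by blast
    define S' where "S' = S - {j}"
    have S': "finite S'" "\<And>l. l \<in> S' \<Longrightarrow> d j \<le> norm (z j - z l)" using S d(3) by (auto simp: S'_def)
    have zjD: "z j \<in> \<D>" using norm_z by simp
    define p where "p = (\<lambda>x. complex_of_real (d j powr (\<alpha> - real k)) * (1 - cnj (z j) * x) ^ k)"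
    have holp: "p holomorphic_on A" for A unfolding p_def by (intro holomorphic_intros)
    have ext: "fb S' holomorphic_on ball (z j) (d j / 12)"
      "\<And>x. x \<in> ball (z j) (d j / 12) \<Longrightarrow> norm (fb S' x) \<le> K"
      using fb_extension[OF S'(1) zjD d(1)[of j] S'(2)] by (simp_all add: K_def)
    have fbS: "fb S x = blaschke_factor (z j) x * fb S' x" for x
      unfolding S'_def using finite_blaschke_remove[OF S(1) j(1)] .
    have \<epsilon>: "eps j \<le> d j / \<delta>" using d(2)[of j] \<delta>_pos by (simp add: field_simps)
    have d\<delta>: "d j \<le> d j / \<delta>" using \<delta>_pos \<delta>_le_1 d(1)[of j] by (simp add: field_simps)
    \<comment> \<open>The factor of \<open>z j\<close> now has its pole within reach, so for
      \<open>f - p\<close> the scale is the distance to that pole. The part \<open>p\<close> is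
      treated separately, on a disc that may contain the pole.\<close>
    define D where "D = norm (1 - cnj (z j) * w)"
    have D: "1 - norm w \<le> D" "norm (w - z j) \<le> D" "D \<le> 2 * eps j + norm (w - z j)" "0 < D"
      using one_minus_cnj_bounds[of "z j" w] norm_z[of j] w by (auto simp: D_def eps_def)
    have cD: "c * D \<le> d j / 24"
    proof -
      have "D \<le> 3 * (d j / \<delta>)" using D(3) j(2) \<epsilon> d\<delta> d(1)[of j] by linarith
      then have "c * D \<le> c * (3 * (d j / \<delta>))" using c by (intro mult_left_mono) auto
      also have "\<dots> = d j / 24" using \<delta>_pos by (simp add: c_def)
      finally show ?thesis .
    qed
    have sub: "ball w (c * D) \<subseteq> ball (z j) (d j / 12)" "ball w (d j / 24) \<subseteq> ball (z j) (d j / 12)"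
    proof -
      show "ball w (d j / 24) \<subseteq> ball (z j) (d j / 12)"
        using j(2) d(1)[of j] by (simp add: ball_subset_ball_iff dist_norm)
      then show "ball w (c * D) \<subseteq> ball (z j) (d j / 12)" using cD by force
    qed
    have den: "D / 2 \<le> norm (1 - cnj (z j) * x)" "norm (x - z j) \<le> 2 * D" if x: "x \<in> ball w (c * D)" for x
    proof -
      have cD2: "c * D \<le> 1 / 2 * D" using c D by (intro mult_right_mono) auto
      have xw: "norm (x - w) \<le> D / 2" using x cD2 by (simp add: dist_norm norm_minus_commute)
      have "norm (cnj (z j) * (x - w)) \<le> norm (x - w)"
        using norm_z[of j] by (simp add: norm_mult mult_left_le_one_le)
      moreover have e: "1 - cnj (z j) * x = (1 - cnj (z j) * w) - cnj (z j) * (x - w)" by (simp add: algebra_simps)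
      ultimately show "D / 2 \<le> norm (1 - cnj (z j) * x)"
        using norm_triangle_ineq2[of "1 - cnj (z j) * w" "cnj (z j) * (x - w)"] xw
        unfolding e D_def[symmetric] by linarith
      show "norm (x - z j) \<le> 2 * D"
        using norm_triangle_ineq[of "x - w" "w - z j"] xw D by simp
    qed
    have fbb: "fb S holomorphic_on ball w (c * D)"
      "\<And>x. x \<in> ball w (c * D) \<Longrightarrow> norm (fb S x) \<le> 4 * K"
    proof -
      have "1 - cnj (z j) * x \<noteq> 0" if "x \<in> ball w (c * D)" for x using den(1)[OF that] D(4) by auto
      then show "fb S holomorphic_on ball w (c * D)"
        unfolding fbS[abs_def]
        by (intro holomorphic_on_mult holomorphic_on_blaschke_factor holomorphic_on_subset[OF ext(1) sub(1)])
      fix x assume x: "x \<in> ball w (c * D)"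
      have "norm (blaschke_factor (z j) x) \<le> 2 * D / (D / 2)"
        unfolding norm_blaschke_factor using den[OF x] D(4) by (intro frac_le) auto
      also have "\<dots> = 4" using D(4) by simp
      finally show "norm (fb S x) \<le> 4 * K"
        unfolding fbS norm_mult using ext(2)[of x] x sub(1) by (intro mult_mono) auto
    qed
    have 1: "norm ((deriv ^^ m) (\<lambda>x. (f x - p x) * fb S x ^ k) w)
        \<le> 2 * fact m * C2 * (4 * K) ^ k * (2 / c) ^ m * (1 - norm w) powr (\<alpha> - real m)"
    proof (rule norm_higher_deriv_mult_le[OF w D(1) c \<alpha>m,
          of "\<lambda>x. f x - p x" "\<lambda>x. taylor f n w x - p x"])
      show "(\<lambda>x. f x - p x) holomorphic_on \<D>" by (intro holomorphic_intros holf holp)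
      show "(\<lambda>x. taylor f n w x - p x) holomorphic_on ball w (c * D)"
        by (intro holomorphic_intros holp)
      show "(\<lambda>x. fb S x ^ k) holomorphic_on ball w (c * D)"
        by (intro holomorphic_intros fbb)
      show "norm (fb S x ^ k) \<le> (4 * K) ^ k" if "x \<in> ball w (c * D)" for x
        unfolding norm_power by (intro power_mono fbb(2)[OF that]) auto
      show "norm (taylor f n w x - p x) \<le> C2 * D powr \<alpha>"
        if x: "x \<in> ball w (c * D)" for x
      proof -
        have "c * D \<le> 1 * D" using c D by (intro mult_right_mono) auto
        then have "norm (x - w) \<le> D" using x by (simp add: dist_norm norm_minus_commute)
        then have "norm (taylor f n w x - taylor f n (z j) x)
            \<le> real (Suc n) * (C * D powr \<alpha>)"
          by (intro A_space_jet_diff[OF tb]) (use \<alpha> w zjD D in auto)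
        then show ?thesis unfolding poly p_def C2_def by (simp add: mult.assoc)
      qed
      show "norm (f x - p x - (taylor f n w x - p x)) \<le> C2 * (1 - norm w) powr \<alpha>"
        if "x \<in> ball w (c * (1 - norm w))" for x
      proof -
        have "C * (1 - norm w) powr \<alpha> \<le> C2 * (1 - norm w) powr \<alpha>"
          using C by (intro mult_right_mono) (auto simp: C2_def)
        then show ?thesis using near[OF w that c] by simp
      qed
    qed
    \<comment> \<open>This is \<open>p\<close> times the \<open>k\<close>-th power of the product
      with the denominators of the factor of \<open>z j\<close> cancelled; it is holomorphic on a
      disc of radius \<open>d j / 24\<close>, across the pole.\<close>
    define H where "H = (\<lambda>x. complex_of_real (d j powr (\<alpha> - real k)) *
       (blaschke_const (z j) * (x - z j)) ^ k * fb S' x ^ k)"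
    have holH: "H holomorphic_on ball w (d j / 24)"
      unfolding H_def by (intro holomorphic_intros holomorphic_on_subset[OF ext(1) sub(2)])
    have "(deriv ^^ m) (\<lambda>x. p x * fb S x ^ k) w = (deriv ^^ m) H w"
    proof (rule higher_deriv_cong_ev)
      show "\<forall>\<^sub>F x in nhds w. p x * fb S x ^ k = H x"
      proof (rule eventually_mono[OF eventually_nhds_in_open[OF _ w]])
        fix x :: complex assume "x \<in> \<D>"
        then have "1 - cnj (z j) * x \<noteq> 0" using one_minus_cnj_bounds(4)[of "z j" x] norm_z[of j] by auto
        then have "(1 - cnj (z j) * x) * blaschke_factor (z j) x = blaschke_const (z j) * (x - z j)"
          by (simp add: blaschke_factor_eq)
        then show "p x * fb S x ^ k = H x"
          unfolding p_def H_def fbS by (simp add: power_mult_distrib mult.assoc) (metis mult.assoc power_mult_distrib)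
      qed auto
    qed simp
    also have "norm \<dots> \<le> fact m * (d j powr \<alpha> * K ^ k) * (2 / (d j / 24)) ^ m"
    proof (rule norm_higher_deriv_ball_le[OF holH])
      fix x assume x: "x \<in> ball w (d j / 24)"
      then have x': "x \<in> ball (z j) (d j / 12)" using sub by auto
      then have "norm (x - z j) \<le> d j" using d(1)[of j] by (simp add: dist_norm norm_minus_commute)
      then have "norm (H x) \<le> d j powr (\<alpha> - real k) * d j ^ k * K ^ k"
        unfolding H_def norm_mult norm_power using ext(2)[OF x'] d(1)[of j]
        by (intro mult_mono power_mono) auto
      also have "\<dots> = d j powr \<alpha> * K ^ k" using d(1)[of j] by (simp add: powr_diff powr_realpow)
      finally show "norm (H x) \<le> d j powr \<alpha> * K ^ k" .
    qed (use d(1)[of j] in auto)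
    also have "\<dots> = fact m * K ^ k * 48 ^ m * d j powr (\<alpha> - real m)"
      using d(1)[of j] by (simp add: powr_diff powr_realpow power_divide)
    also have "\<dots> \<le> fact m * K ^ k * 48 ^ m * (\<delta> / 2 * (1 - norm w)) powr (\<alpha> - real m)"
    proof (intro mult_left_mono powr_mono2')
      have "1 - norm w \<le> eps j + norm (w - z j)" using norm_triangle_sub[of "z j" w]
        by (simp add: eps_def norm_minus_commute)
      also have "\<dots> \<le> 2 * (d j / \<delta>)" using \<epsilon> d\<delta> j(2) d(1)[of j] by linarith
      finally show "\<delta> / 2 * (1 - norm w) \<le> d j" using \<delta>_pos by (simp add: field_simps)
    qed (use \<alpha>m K w \<delta>_pos in auto)
    also have "\<dots> = M3 * (1 - norm w) powr (\<alpha> - real m)"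
      using powr_mult[of "\<delta> / 2" "1 - norm w" "\<alpha> - real m"] w \<delta>_pos by (simp add: M3_def)
    finally have 2: "norm ((deriv ^^ m) (\<lambda>x. p x * fb S x ^ k) w) \<le> M3 * (1 - norm w) powr (\<alpha> - real m)" .
    have "(\<lambda>x. f x * fb S x ^ k) =
        (\<lambda>x. (f x - p x) * fb S x ^ k + p x * fb S x ^ k)"
      by (simp add: left_diff_distrib)
    then have "(deriv ^^ m) (\<lambda>x. f x * fb S x ^ k) w =
        (deriv ^^ m) (\<lambda>x. (f x - p x) * fb S x ^ k) w + (deriv ^^ m) (\<lambda>x. p x * fb S x ^ k) w"
      using w by (simp only:) (intro higher_deriv_add[of _ \<D>] holomorphic_intros holf holp holomorphic_fb, auto)
    then have "norm ((deriv ^^ m) (\<lambda>x. f x * fb S x ^ k) w)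
        \<le> M2 * (1 - norm w) powr (\<alpha> - real m) + M3 * (1 - norm w) powr (\<alpha> - real m)"
      using norm_triangle_le[OF add_mono[OF 1 2]] by (simp add: M2_def)
    also have "\<dots> = (M2 + M3) * (1 - norm w) powr (\<alpha> - real m)" by (simp add: distrib_right)
    also have "\<dots> \<le> M * (1 - norm w) powr (\<alpha> - real m)"
      by (intro mult_right_mono) (auto simp: M_def)
    finally show ?thesis .
  qed
  then show ?thesis by (intro that[of M]) (auto simp: m_def)
qed

lemma affine_power_eq_taylor_poly:
  assumes "k \<le> n"
  shows "A * (1 - c * x) ^ k =
    taylor_poly (\<lambda>i. A * of_nat (k choose i) * fact i * (- c) ^ i * (1 - c * v) ^ (k - i)) n v x"
proof -
  have "(1 - c * x) ^ k = ((- c) * (x - v) + (1 - c * v)) ^ k" by (simp add: algebra_simps)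
  also have "\<dots> = (\<Sum>i\<le>k. of_nat (k choose i) * ((- c) * (x - v)) ^ i * (1 - c * v) ^ (k - i))"
    by (rule binomial_ring)
  also have "\<dots> = (\<Sum>i\<le>n. of_nat (k choose i) * ((- c) * (x - v)) ^ i * (1 - c * v) ^ (k - i))"
    using assms by (intro sum.mono_neutral_left) auto
  finally have "A * (1 - c * x) ^ k = (\<Sum>i\<le>n. A * (of_nat (k choose i) * ((- c) * (x - v)) ^ i * (1 - c * v) ^ (k - i)))"
    by (simp add: sum_distrib_left)
  also have "\<dots> = taylor_poly (\<lambda>i. A * of_nat (k choose i) * fact i * (- c) ^ i * (1 - c * v) ^ (k - i)) n v x"
    unfolding taylor_poly_def power_mult_distrib by (intro sum.cong refl) (simp add: mult_ac)
  finally show ?thesis .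
qed

text \<open>The jets are those of the model polynomials. Since
  \<open>eps j \<le> d j / \<delta>\<close>, the model is of size \<open>d j powr \<alpha>\<close>
  on the disc of radius \<open>d j\<close>, and Cauchy gives precisely the bounds that
  \<open>interpolating_jets\<close> asks for.\<close>

lemma J_mult_witness:
  assumes int: "A_interpolating_blaschke n \<alpha> z B" and \<alpha>: "real n < \<alpha>" "\<alpha> < real n + 1" "n \<ge> 1" and k: "k \<le> n"
  obtains f where "f \<in> J_mult \<alpha> B k"
    "\<And>j. f (z j) = complex_of_real (sep_dist z j powr (\<alpha> - real k)) * (1 - cnj (z j) * z j) ^ k"
proof -
  have z: "blaschke_seq z" "inj z" and B: "B = blaschke_product z"
    using int by (auto simp: A_interpolating_blaschke_def)
  obtain \<delta> where "carleson_seq z \<delta>" using interpolating_imp_carleson_seq[OF int \<alpha>] .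
  then interpret carleson_seq z \<delta> .
  define d where "d = sep_dist z"
  have d0: "0 < d j" for j using sep_dist_pos[OF z] by (simp add: d_def)
  have d1: "\<delta> * eps j \<le> d j" for j
  proof -
    have "Suc j \<in> UNIV - {j}" by simp
    then have "UNIV - {j} \<noteq> {}" by blast
    then show ?thesis unfolding d_def sep_dist_def using separated(1) by (intro cINF_greatest) auto
  qed
  define A where "A = (\<lambda>j. complex_of_real (d j powr (\<alpha> - real k)))"
  define b where "b = (\<lambda>j i. A j * of_nat (k choose i) * fact i * (- cnj (z j)) ^ i * (1 - cnj (z j) * z j) ^ (k - i))"
  have p: "A j * (1 - cnj (z j) * x) ^ k = taylor_poly (b j) n (z j) x" for j x
    unfolding b_def by (rule affine_power_eq_taylor_poly[OF k])
  define P where "P = fact n * (2 / \<delta> + 1) ^ k * 2 ^ n"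
  have bb: "norm (b j s) \<le> P * d j powr (\<alpha> - real s)" if s: "s \<le> n" for s j
  proof -
    have "norm ((deriv ^^ s) (taylor_poly (b j) n (z j)) (z j)) \<le> fact s * ((2 / \<delta> + 1) ^ k * d j powr \<alpha>) * (2 / d j) ^ s"
    proof (rule norm_higher_deriv_ball_le[OF holomorphic_taylor_poly d0])
      fix x assume "x \<in> ball (z j) (d j)"
      then have "norm (x - z j) \<le> d j" by (simp add: dist_norm norm_minus_commute)
      moreover have "eps j \<le> d j / \<delta>" using d1[of j] \<delta>_pos by (simp add: field_simps)
      ultimately have "norm (1 - cnj (z j) * x) \<le> 2 * (d j / \<delta>) + d j"
        using norm_one_minus_cnj_le[OF norm_z, of j x] by (simp add: eps_def)
      also have "\<dots> = (2 / \<delta> + 1) * d j" by (simp add: algebra_simps)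
      finally have "norm (taylor_poly (b j) n (z j) x) \<le> d j powr (\<alpha> - real k) * ((2 / \<delta> + 1) * d j) ^ k"
        unfolding p[symmetric] A_def norm_mult norm_power by (intro mult_mono power_mono) auto
      also have "\<dots> = (2 / \<delta> + 1) ^ k * d j powr \<alpha>"
        using d0[of j] by (simp add: power_mult_distrib powr_diff powr_realpow)
      finally show "norm (taylor_poly (b j) n (z j) x) \<le> (2 / \<delta> + 1) ^ k * d j powr \<alpha>" .
    qed
    also have "\<dots> = (fact s * (2 / \<delta> + 1) ^ k * 2 ^ s) * d j powr (\<alpha> - real s)"
      using d0[of j] by (simp add: power_divide powr_diff powr_realpow)
    also have "\<dots> \<le> P * d j powr (\<alpha> - real s)"
      unfolding P_def using s \<delta>_pos by (intro mult_right_mono mult_mono fact_mono power_increasing) auto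
    finally show ?thesis using s by (simp add: higher_deriv_taylor_poly)
  qed
  obtain f where f: "f \<in> A_space \<alpha>" "\<And>s j. s \<le> n \<Longrightarrow> (deriv ^^ s) f (z j) = b j s"
  proof (rule interpolating_jets[OF int \<alpha>(1), of "\<lambda>s j. b j s" P])
    show "norm (b j s) \<le> P * sep_dist z j powr (\<alpha> - real s)" if "s \<le> n" for s j
      using bb[OF that] by (simp add: d_def)
  qed (rule that)
  have poly: "taylor f n (z j) x = A j * (1 - cnj (z j) * x) ^ k" for j x
    unfolding p taylor_poly_def using f(2) by (intro sum.cong) auto
  obtain M where M: "\<And>S w. finite S \<Longrightarrow> S \<noteq> {} \<Longrightarrow> w \<in> \<D> \<Longrightarrow>
    norm ((deriv ^^ Suc n) (\<lambda>x. f x * finite_blaschke z S x ^ k) w) \<le> M * (1 - norm w) powr (\<alpha> - real (Suc n))"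
  proof (rule smooth_mult_bound[OF f(1) \<alpha>(1,2) k, of d P])
    show "d j \<le> norm (z j - z l)" if "l \<noteq> j" for j l using sep_dist_le[OF that] by (simp add: d_def)
    show "norm ((deriv ^^ s) f (z j)) \<le> P * d j powr (\<alpha> - real s)" if "s \<le> n" for j s
      using bb f(2) that by simp
    show "taylor f n (z j) x
      = complex_of_real (d j powr (\<alpha> - real k)) * (1 - cnj (z j) * x) ^ k" for j x
      using poly by (simp add: A_def)
  qed (use d0 d1 that in auto)
  obtain C where C: "C > 0" "\<And>w. w \<in> \<D> \<Longrightarrow> norm (f w) \<le> C" using A_space_boundedE[OF f(1)] by blast
  \<comment> \<open>\<open>Suc N\<close> keeps the index set nonempty, as the derivative bound
    requires.\<close>
  let ?F = "\<lambda>N x. f x * finite_blaschke z {..<Suc N} x ^ k"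
  obtain r G where G: "strict_mono (r :: nat \<Rightarrow> nat)" "G \<in> A_space \<alpha>"
    "\<And>w. w \<in> \<D> \<Longrightarrow> (\<lambda>N. ?F (r N) w) \<longlonglongrightarrow> G w"
  proof (rule A_space_limit[of ?F C \<alpha> "Suc n" M])
    show "?F N holomorphic_on \<D>" for N
      by (intro holomorphic_on_mult holomorphic_on_power A_space_holomorphic[OF f(1)] holomorphic_fb)
    show "norm (?F N w) \<le> C" if "w \<in> \<D>" for N w
    proof -
      have "norm (finite_blaschke z {..<Suc N} w) ^ k \<le> 1"
        using norm_fb_le_1[of w "{..<Suc N}"] that by (intro power_le_one) auto
      then show ?thesis
        using mult_mono[OF C(2)[OF that], of "norm (finite_blaschke z {..<Suc N} w) ^ k" 1] C(1)
        by (simp add: norm_mult norm_power)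
    qed
    show "\<alpha> < real (Suc n)" using \<alpha> by simp
    show "norm ((deriv ^^ Suc n) (?F N) w) \<le> M * (1 - norm w) powr (\<alpha> - real (Suc n))" if "w \<in> \<D>" for N w
      using M[of "{..<Suc N}" w] that by auto
  qed (rule that)
  have "(\<lambda>w. f w * B w ^ k) \<in> A_space \<alpha>"
  proof (rule A_space_cong[OF G(2)])
    fix w :: complex assume w: "w \<in> \<D>"
    have "(\<lambda>N. finite_blaschke z {..<Suc N} w) \<longlonglongrightarrow> B w"
      unfolding B using w by (intro LIMSEQ_Suc finite_blaschke_tendsto z) auto
    then have "(\<lambda>N. ?F N w) \<longlonglongrightarrow> f w * B w ^ k" by (intro tendsto_intros)
    from LIMSEQ_subseq_LIMSEQ[OF this G(1)] show "G w = f w * B w ^ k"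
      using LIMSEQ_unique[OF G(3)[OF w]] by (simp add: o_def)
  qed
  then have "f \<in> J_mult \<alpha> B k" using f(1) by (simp add: J_mult_def)
  moreover have "f (z j) = complex_of_real (sep_dist z j powr (\<alpha> - real k)) * (1 - cnj (z j) * z j) ^ k" for j
    using f(2)[of 0 j] by (simp add: b_def A_def d_def)
  ultimately show ?thesis by (rule that)
qed

subsection \<open>Integrals over circles\<close>

lemma cauchy_integral_circle:
  fixes F :: "complex \<Rightarrow> complex"
  assumes F: "F holomorphic_on ball 0 R" and \<rho>: "norm w < \<rho>" "\<rho> < R"
  shows "((\<lambda>t. F (complex_of_real \<rho> * cis t) * (complex_of_real \<rho> * cis t / (complex_of_real \<rho> * cis t - w)))
    has_integral (2 * pi * F w)) {0..2 * pi}"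
proof -
  have \<rho>0: "0 < \<rho>" using \<rho>(1) norm_ge_zero[of w] by linarith
  have "F holomorphic_on cball 0 \<rho>" using \<rho> by (intro holomorphic_on_subset[OF F]) auto
  then have "((\<lambda>u. F u / (u - w)) has_contour_integral (2 * of_real pi * \<i> * F w)) (circlepath 0 \<rho>)"
    using \<rho> by (intro Cauchy_integral_circlepath_simple) auto
  then have "((\<lambda>t. F (0 + complex_of_real \<rho> * cis t) / (0 + complex_of_real \<rho> * cis t - w) * complex_of_real \<rho> * \<i> * cis t)
      has_integral (2 * of_real pi * \<i> * F w)) {0..2 * pi}"
    unfolding circlepath_def by (subst (asm) has_contour_integral_part_circlepath_iff) auto
  from has_integral_mult_right[OF this, of "- \<i>"] show ?thesis
    by (simp add: mult_ac)
qed

lemma cis_minus_eq: "cis t - cnj a = cis t * cnj (1 - a * cis t)"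
proof -
  have "cis t * cnj (cis t) = 1" by (simp add: cis_cnj cis_mult)
  moreover have "cis t * cnj (1 - a * cis t) = cis t - cnj a * (cis t * cnj (cis t))"
    by (simp add: algebra_simps)
  ultimately show ?thesis by simp
qed

text \<open>Cauchy's formula for \<open>1 / (1 - a * w)\<close> at the point \<open>cnj a\<close>:
  on the unit circle the Cauchy kernel is the conjugate of this function.\<close>

lemma poisson_integral:
  assumes a: "norm a < 1"
  shows "((\<lambda>t. 1 / norm (1 - a * cis t) ^ 2) has_integral (2 * pi / (1 - norm a ^ 2))) {0..2 * pi}"
proof -
  \<comment> \<open>Any radius above 1 that keeps the pole \<open>1 / a\<close> outside; for
    \<open>a = 0\<close> there is no pole.\<close>
  define R where "R = (if a = 0 then 2 else 1 / norm a)"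
  have R: "1 < R" "norm a * R \<le> 1" using a by (auto simp: R_def)
  have "1 - a * w \<noteq> 0" if "w \<in> ball 0 R" for w
  proof
    assume "1 - a * w = 0"
    then have e: "norm a * norm w = 1" by (metis eq_iff_diff_eq_0 norm_mult norm_one)
    then have "norm a > 0" by (metis mult_zero_left norm_ge_zero order_le_less zero_neq_one)
    then have "norm a * norm w < norm a * R" using that by simp
    then show False using e R by linarith
  qed
  then have "(\<lambda>w. 1 / (1 - a * w)) holomorphic_on ball 0 R" by (intro holomorphic_intros) auto
  from cauchy_integral_circle[OF this, of "cnj a" 1]
  have *: "((\<lambda>t. 1 / (1 - a * cis t) * (cis t / (cis t - cnj a))) has_integral
     (2 * pi * (1 / (1 - a * cnj a)))) {0..2 * pi}" using a R by simp
  have e1: "1 / (1 - a * cis t) * (cis t / (cis t - cnj a)) = complex_of_real (1 / norm (1 - a * cis t) ^ 2)" for t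
  proof -
    have "cis t - cnj a = cis t * cnj (1 - a * cis t)" by (rule cis_minus_eq)
    then have "1 / (1 - a * cis t) * (cis t / (cis t - cnj a)) = 1 / ((1 - a * cis t) * cnj (1 - a * cis t))"
      by (simp del: complex_cnj_diff complex_cnj_mult)
    then show ?thesis by (simp only: complex_norm_square[symmetric] of_real_divide of_real_1)
  qed
  have e2: "2 * pi * (1 / (1 - a * cnj a)) = complex_of_real (2 * pi / (1 - norm a ^ 2))"
    by (simp add: complex_norm_square[symmetric])
  show ?thesis
    using has_integral_linear[OF *[unfolded e1 e2] bounded_linear_Re] by (simp only: o_def Re_complex_of_real)
qed

lemma integral_poisson:
  assumes "norm a < 1"
  shows "integrable (lebesgue_on {0..2 * pi}) (\<lambda>t. 1 / norm (1 - a * cis t) ^ 2)"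
    "integral\<^sup>L (lebesgue_on {0..2 * pi}) (\<lambda>t. 1 / norm (1 - a * cis t) ^ 2) \<le> 2 * pi / (1 - norm a)"
proof -
  have "1 - a * cis t \<noteq> 0" for t
    using norm_triangle_ineq2[of 1 "a * cis t"] assms by (auto simp: norm_mult)
  then show int: "integrable (lebesgue_on {0..2 * pi}) (\<lambda>t. 1 / norm (1 - a * cis t) ^ 2)"
    by (intro continuous_imp_integrable_real continuous_intros) auto
  have "integral\<^sup>L (lebesgue_on {0..2 * pi}) (\<lambda>t. 1 / norm (1 - a * cis t) ^ 2) = 2 * pi / (1 - norm a ^ 2)"
    using lebesgue_integral_eq_integral[OF int] integral_unique[OF poisson_integral[OF assms]] by simp
  also have "\<dots> \<le> 2 * pi / (1 - norm a)"
    using assms mult_left_le[of "norm a" "norm a"]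
    by (intro divide_left_mono) (auto simp: power2_eq_square intro!: mult_pos_pos)
  finally show "integral\<^sup>L (lebesgue_on {0..2 * pi}) (\<lambda>t. 1 / norm (1 - a * cis t) ^ 2) \<le> 2 * pi / (1 - norm a)" .
qed

lemma norm_one_minus_cnj_cis: "norm (1 - cnj a * cis t) = norm (cis t - a)"
proof -
  have "cis t - a = cis t * cnj (1 - cnj a * cis t)" using cis_minus_eq[of t "cnj a"] by simp
  then show ?thesis by (metis complex_mod_cnj mult_1 norm_cis norm_mult)
qed

text \<open>Markov's inequality for the Poisson kernel bounds the measure of the exceptional set of
  \<open>z j\<close> by a multiple of \<open>1 - norm (z j)\<close>; Borel-Cantelli concludes. The
  constant 4 leaves room for \<open>boundary_sum_tendsto\<close>.\<close>

lemma blaschke_seq_AE_far: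
  assumes z: "blaschke_seq z"
  shows "AE t in lebesgue_on {0..2 * pi}. \<forall>\<^sub>F j in sequentially. 4 * (1 - norm (z j)) \<le> norm (cis t - z j)"
proof -
  note zD = blaschke_seqD[OF z]
  let ?M = "lebesgue_on {0..2 * pi}"
  define A where "A = (\<lambda>j. {t \<in> space ?M. 1 / norm (1 - cnj (z j) * cis t) ^ 2 \<ge> 1 / (4 * (1 - norm (z j))) ^ 2})"
  have meas[measurable]: "A j \<in> sets ?M" for j
  proof -
    have "(\<lambda>t. 1 / norm (1 - cnj (z j) * cis t) ^ 2) \<in> borel_measurable ?M"
      using integral_poisson(1)[of "cnj (z j)"] zD(1) by (intro borel_measurable_integrable) auto
    then show ?thesis unfolding A_def by measurable
  qed
  have le: "measure ?M (A j) \<le> 32 * pi * (1 - norm (z j))" for j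
  proof -
    have \<epsilon>: "1 - norm (z j) > 0" using zD(1) by simp
    have "measure ?M (A j) \<le> (\<integral>t. 1 / norm (1 - cnj (z j) * cis t) ^ 2 \<partial>?M) / (1 / (4 * (1 - norm (z j))) ^ 2)"
      unfolding A_def
      using integral_poisson(1)[of "cnj (z j)"] zD(1)[of j] \<epsilon>
      by (intro integral_Markov_inequality_measure[of _ _ "{}"]) auto
    also have "\<dots> \<le> (2 * pi / (1 - norm (cnj (z j)))) / (1 / (4 * (1 - norm (z j))) ^ 2)"
      using integral_poisson(2)[of "cnj (z j)"] zD(1)[of j] by (intro divide_right_mono) auto
    also have "\<dots> = 32 * pi * (1 - norm (z j))"
      using \<epsilon> by (simp add: power2_eq_square field_simps)
    finally show ?thesis .
  qed
  have "AE t in ?M. \<forall>\<^sub>F j in sequentially. t \<in> space ?M - A j"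
  proof (rule borel_cantelli_AE1[OF meas])
    show "emeasure ?M (A j) < \<infinity>" for j
    proof -
      have "finite_measure ?M" by (intro finite_measure_lebesgue_on) auto
      then show ?thesis using finite_measure.emeasure_finite[of ?M "A j"] by (simp add: less_top)
    qed
    show "summable (\<lambda>j. measure ?M (A j))"
      by (rule summable_comparison_test'[OF summable_mult[OF zD(2), of "32 * pi"], of 0]) (use le in auto)
  qed
  then show ?thesis
  proof eventually_elim
    case (elim t)
    then show ?case
    proof eventually_elim
      case (elim j)
      have \<epsilon>: "1 - norm (z j) > 0" using zD(1) by simp
      have "1 - cnj (z j) * cis t \<noteq> 0" using one_minus_cnj_bounds(4)[of "z j" "cis t"] zD(1) by simp
      then have pos: "0 < norm (cis t - z j)" unfolding norm_one_minus_cnj_cis[symmetric] by simp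
      have "1 / norm (cis t - z j) ^ 2 < 1 / (4 * (1 - norm (z j))) ^ 2"
        using elim by (auto simp: A_def norm_one_minus_cnj_cis)
      then have "(4 * (1 - norm (z j))) ^ 2 < norm (cis t - z j) ^ 2"
      proof (rule contrapos_pp)
        assume "\<not> (4 * (1 - norm (z j))) ^ 2 < norm (cis t - z j) ^ 2"
        then have le: "norm (cis t - z j) ^ 2 \<le> (4 * (1 - norm (z j))) ^ 2" by (simp only: not_less)
        have "1 / (4 * (1 - norm (z j))) ^ 2 \<le> 1 / norm (cis t - z j) ^ 2"
          by (rule divide_left_mono[OF le]) (use pos \<epsilon> in auto)
        then show "\<not> 1 / norm (cis t - z j) ^ 2 < 1 / (4 * (1 - norm (z j))) ^ 2"
          by (simp only: not_less)
      qed
      from power2_le_imp_le[OF less_imp_le[OF this] norm_ge_zero] show ?case .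
    qed
  qed
qed

text \<open>A zero on the radius would satisfy \<open>norm (cis t - z j) = 1 - norm (z j)\<close>,
  which rules out all but finitely many. Needed because division by 0 yields 0, so the quotient by
  \<open>B\<close> is meaningless at the zeros.\<close>

lemma eventually_radius_avoids:
  assumes z: "\<And>j. norm (z j) < 1"
    and far: "\<forall>\<^sub>F j in sequentially. 4 * (1 - norm (z j)) \<le> norm (cis t - z j)"
  shows "\<forall>\<^sub>F r in at_left 1. complex_of_real r * cis t \<notin> range z"
proof -
  obtain N where N: "\<And>j. j \<ge> N \<Longrightarrow> 4 * (1 - norm (z j)) \<le> norm (cis t - z j)"
    using far by (auto simp: eventually_sequentially)
  have "\<forall>\<^sub>F r in at_left (1::real). \<forall>j\<in>{..<N}. norm (z j) < r"
    using z by (intro eventually_ball_finite ballI) (auto intro: eventually_at_leftI[of "norm (z _)"])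
  moreover have "\<forall>\<^sub>F r in at_left 1. r \<in> {0<..<(1::real)}" by (rule eventually_at_left_real) simp
  ultimately show ?thesis
  proof eventually_elim
    case (elim r)
    show ?case
    proof
      assume "complex_of_real r * cis t \<in> range z"
      then obtain j where j: "z j = complex_of_real r * cis t" by auto
      then have nz: "norm (z j) = r" using elim by (simp add: norm_mult)
      have "cis t - z j = complex_of_real (1 - r) * cis t" by (simp add: j algebra_simps)
      then have "norm (cis t - z j) = 1 - r" using elim by (simp only: norm_mult norm_of_real norm_cis) simp
      then have "j < N" using N[of j] nz elim by (force simp: not_less[symmetric])
      then show False using elim nz by auto
    qed
  qed
qed

subsection \<open>Values at the zeros of a function divisible by the Blaschke product\<close>

text \<open>On the circle \<open>f - B g = B cnj h\<close>, and \<open>B cnj h\<close> is integrated against a kernel that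
  annihilates \<open>B\<close> times polynomials of degree \<open>n\<close> in \<open>cnj w\<close> and that decays fast away from \<open>z j\<close>,
  so that only the Taylor remainder of \<open>h\<close> at \<open>z j\<close> contributes.\<close>

lemma division_imp_decay:
  assumes f: "f \<in> A_space \<alpha>" and g: "g \<in> A_space \<alpha>" and h: "h \<in> A_space \<alpha>"
    and \<alpha>: "real n < \<alpha>" "\<alpha> < real n + 1" "n \<ge> 1" and z: "blaschke_seq z"
    and ae: "AE t in lebesgue_on {0..2 * pi}.
      ((\<lambda>r. f (complex_of_real r * cis t) / blaschke_product z (complex_of_real r * cis t))
        \<longlongrightarrow> disc_ext g (cis t) + cnj (disc_ext h (cis t))) (at_left 1)"
  obtains C where "\<And>j. norm (f (z j)) \<le> C * (1 - norm (z j)) powr \<alpha>"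
proof -
  let ?M = "lebesgue_on {0..2 * pi}"
  note zD = blaschke_seqD(1)[OF z]
  define B where "B = blaschke_product z"
  have holB: "B holomorphic_on \<D>" unfolding B_def by (rule blaschke_product_holomorphic[OF z])
  have B1: "norm (B w) \<le> 1" if "w \<in> \<D>" for w using norm_blaschke_product_le_1[OF z] that by (simp add: B_def)
  have B0: "B w = 0 \<longleftrightarrow> w \<in> range z" if "w \<in> \<D>" for w
    using blaschke_product_eq_0_iff[OF z] that by (simp add: B_def)
  note holf = A_space_holomorphic[OF f] and holg = A_space_holomorphic[OF g] and holh = A_space_holomorphic[OF h]
  obtain Mf where Mf: "Mf > 0" "\<And>w. w \<in> \<D> \<Longrightarrow> norm (f w) \<le> Mf" using A_space_boundedE[OF f] by blast
  obtain Mg where Mg: "Mg > 0" "\<And>w. w \<in> \<D> \<Longrightarrow> norm (g w) \<le> Mg" using A_space_boundedE[OF g] by blast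
  obtain Mh where Mh: "Mh > 0" "\<And>w. w \<in> \<D> \<Longrightarrow> norm (h w) \<le> Mh" using A_space_boundedE[OF h] by blast
  obtain C where tb: "taylor_bound n \<alpha> C h" using A_space_taylor[OF h \<alpha>(1,2)] .
  note C = taylor_boundD[OF tb]
  \<comment> \<open>\<open>u\<close> is holomorphic with the values of \<open>f\<close> at the
    zeros; \<open>v\<close> equals \<open>B\<close> times \<open>f / B - g - cnj h\<close> off the
    zeros and tends to 0 radially almost everywhere.\<close>
  define u where "u = (\<lambda>w. f w - B w * g w)"
  define v where "v = (\<lambda>w. u w - B w * cnj (h w))"
  define V where "V = Mf + Mg + Mh"
  have holu: "u holomorphic_on \<D>" unfolding u_def by (intro holomorphic_intros holf holB holg)
  have contv: "continuous_on \<D> v"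
    unfolding v_def by (intro continuous_intros holomorphic_on_imp_continuous_on holu holB holh)
  have V: "norm (v w) \<le> V" if w: "w \<in> \<D>" for w
  proof -
    have "norm (B w * g w) \<le> 1 * Mg" "norm (B w * cnj (h w)) \<le> 1 * Mh"
      unfolding norm_mult complex_mod_cnj
      by (intro mult_mono B1[OF w] Mg(2)[OF w] Mh(2)[OF w]; simp)+
    then show ?thesis
      using Mf(2)[OF w] norm_triangle_ineq4[of "f w" "B w * g w"] norm_triangle_ineq4[of "u w" "B w * cnj (h w)"]
      by (simp add: v_def V_def u_def)
  qed
  have V0: "0 \<le> V" using Mf Mg Mh by (simp add: V_def)
  have vlim: "AE t in ?M. ((\<lambda>r. v (complex_of_real r * cis t)) \<longlongrightarrow> 0) (at_left 1)"
    using ae blaschke_seq_AE_far[OF z]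
  proof eventually_elim
    case (elim t)
    define F where "F = (\<lambda>r. f (complex_of_real r * cis t) / B (complex_of_real r * cis t)
        - g (complex_of_real r * cis t) - cnj (h (complex_of_real r * cis t)))"
    have "(F \<longlongrightarrow> disc_ext g (cis t) + cnj (disc_ext h (cis t)) - disc_ext g (cis t) - cnj (disc_ext h (cis t))) (at_left 1)"
      unfolding F_def B_def
      by (intro tendsto_diff tendsto_cnj elim(1) A_space_radial_limit[OF g \<alpha>] A_space_radial_limit[OF h \<alpha>])
    then have "(F \<longlongrightarrow> 0) (at_left 1)" by simp
    then have "((\<lambda>r. norm (F r)) \<longlongrightarrow> 0) (at_left 1)" by (rule tendsto_norm_zero)
    moreover have "\<forall>\<^sub>F r in at_left 1. norm (v (complex_of_real r * cis t)) \<le> norm (F r)"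
    proof -
      have "\<forall>\<^sub>F r in at_left 1. r \<in> {0<..<(1::real)}" by (rule eventually_at_left_real) simp
      then show ?thesis
        using eventually_radius_avoids[OF zD elim(2)]
      proof eventually_elim
        case (elim r)
        define w where "w = complex_of_real r * cis t"
        have w: "w \<in> \<D>" using elim by (simp add: w_def norm_mult)
        have "B w \<noteq> 0" using B0[OF w] elim by (simp add: w_def)
        moreover have "F r = f w / B w - g w - cnj (h w)" by (simp add: F_def w_def)
        ultimately have "v w = B w * F r" by (simp add: v_def u_def right_diff_distrib)
        then show ?case using B1[OF w] by (simp add: norm_mult mult_left_le_one_le w_def)
      qed
    qed
    ultimately show ?case by (rule Lim_null_comparison[rotated])
  qed
  define C3 where "C3 = C * 2 ^ (2 * n + 2)"
  have C3: "C3 > 0" using C by (simp add: C3_def)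
  \<comment> \<open>The kernel contains a division by \<open>a ^ n\<close>, so zeros near 0 are
    excluded; for them boundedness of \<open>f\<close> suffices.\<close>
  have main: "norm (f (z j)) \<le> C3 * (1 - norm (z j)) powr \<alpha>" if j: "1 / 2 \<le> norm (z j)" for j
  proof -
    define a where "a = z j"
    define \<epsilon> where "\<epsilon> = 1 - norm a"
    have aD: "a \<in> \<D>" and a: "1 / 2 \<le> norm a" "norm a < 1" using zD j by (auto simp: a_def)
    have a0: "a \<noteq> 0" using a by auto
    have \<epsilon>: "0 < \<epsilon>" "\<epsilon> \<le> 1" using a by (auto simp: \<epsilon>_def)
    have Ba: "B a = 0" using B0[OF aD] by (simp add: a_def)
    \<comment> \<open>Normalised so that \<open>q a = 1\<close>. The factor \<open>w ^ n\<close> of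
      \<open>q\<close> clears the negative powers coming from \<open>cnj w\<close>. Of the exponent
      \<open>n + 2\<close>, two powers serve as a Poisson kernel and \<open>n\<close> provide
      decay.\<close>
    define Q where "Q = (\<lambda>w. ((1 - norm a ^ 2) / (1 - cnj a * w)) ^ (n + 2) / a ^ n)"
    define q where "q = (\<lambda>w. w ^ n * Q w)"
    define T where "T = taylor h n a"
    have nz: "1 - cnj a * w \<noteq> 0" if "w \<in> \<D>" for w
      using one_minus_cnj_bounds(4)[of a w] a that by auto
    have holQ: "Q holomorphic_on \<D>" unfolding Q_def using nz a0 by (intro holomorphic_intros) auto
    have holq: "q holomorphic_on \<D>" unfolding q_def by (intro holomorphic_intros holQ)
    have "1 - cnj a * a = complex_of_real (1 - norm a ^ 2)"
      using complex_norm_square[of a] by (simp add: mult.commute)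
    then have qa: "q a = 1" using nz[OF aD] a0 by (simp add: q_def Q_def)
    have ua: "u a = f a" using Ba by (simp add: u_def)
    have qb: "norm (q w) \<le> 2 ^ n * ((2 * \<epsilon>) ^ (n + 2) / norm (1 - cnj a * w) ^ (n + 2))" if w: "w \<in> \<D>" for w
    proof -
      have "norm (w / a) \<le> 2" using w a a0 by (simp add: norm_divide divide_le_eq)
      have "1 - norm a ^ 2 = (1 + norm a) * \<epsilon>" by (simp add: \<epsilon>_def power2_eq_square algebra_simps)
      then have "1 - norm a ^ 2 \<le> 2 * \<epsilon>" "0 \<le> 1 - norm a ^ 2" using a \<epsilon> by (auto intro!: mult_right_mono)
      then have "norm (complex_of_real (1 - norm a ^ 2)) \<le> 2 * \<epsilon>" by (simp only: norm_of_real abs_of_nonneg)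
      then have "norm ((complex_of_real (1 - norm a ^ 2)) / (1 - cnj a * w)) \<le> 2 * \<epsilon> / norm (1 - cnj a * w)"
        unfolding norm_divide by (intro divide_right_mono) auto
      moreover have "q w = (w / a) ^ n * ((complex_of_real (1 - norm a ^ 2)) / (1 - cnj a * w)) ^ (n + 2)"
        by (simp add: q_def Q_def power_divide)
      ultimately have "norm (q w) \<le> 2 ^ n * (2 * \<epsilon> / norm (1 - cnj a * w)) ^ (n + 2)"
        using \<open>norm (w / a) \<le> 2\<close> by (simp only: norm_mult norm_power) (intro mult_mono power_mono, auto)
      then show ?thesis by (simp add: power_divide)
    qed
    define \<rho> where "\<rho> = (\<lambda>i. 1 - \<epsilon> / 2 / real (Suc i))"
    have \<rho>: "norm a < \<rho> i" "\<rho> i < 1" "0 < \<rho> i" "\<epsilon> / 2 \<le> \<rho> i - norm a" for i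
    proof -
      define x where "x = \<epsilon> / 2 / real (Suc i)"
      have "x \<le> \<epsilon> / 2 / 1" unfolding x_def using \<epsilon> by (intro divide_left_mono) auto
      moreover have "0 < x" using \<epsilon> by (simp add: x_def)
      moreover have "\<rho> i = 1 - x" "norm a = 1 - \<epsilon>" by (simp_all add: \<rho>_def x_def \<epsilon>_def)
      ultimately show "norm a < \<rho> i" "\<rho> i < 1" "\<epsilon> / 2 \<le> \<rho> i - norm a"
        using \<epsilon> by linarith+
      then show "0 < \<rho> i" using norm_ge_zero[of a] by linarith
    qed
    define \<zeta> where "\<zeta> = (\<lambda>i t. complex_of_real (\<rho> i) * cis t)"
    have n\<zeta>: "norm (\<zeta> i t) = \<rho> i" for i t using \<rho>(3)[of i] by (simp add: \<zeta>_def norm_mult)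
    then have \<zeta>D: "\<zeta> i t \<in> \<D>" for i t using \<rho>(2)[of i] by simp
    have \<zeta>a: "\<epsilon> / 2 \<le> norm (\<zeta> i t - a)" for i t
      using norm_triangle_ineq2[of "\<zeta> i t" a] \<rho>(4)[of i] n\<zeta>[of i t] by linarith
    have \<zeta>a0: "\<zeta> i t \<noteq> a" for i t using \<zeta>a[of i t] \<epsilon> by auto
    define k where "k = (\<lambda>i t. \<zeta> i t / (\<zeta> i t - a))"
    have kb: "norm (k i t) \<le> 1 / norm (\<zeta> i t - a)" for i t
      unfolding k_def norm_divide using n\<zeta>[of i t] \<rho>(2)[of i] by (intro divide_right_mono) auto
    have cont\<zeta>: "continuous_on A (\<zeta> i)" for A i unfolding \<zeta>_def by (intro continuous_intros)
    have contk: "continuous_on A (k i)" for A i unfolding k_def using \<zeta>a0 by (intro continuous_intros cont\<zeta>) auto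
    have compD: "continuous_on A (\<lambda>t. G (\<zeta> i t))" if "continuous_on \<D> G" for G :: "complex \<Rightarrow> complex" and A i
      using \<zeta>D by (intro continuous_on_compose2[OF that cont\<zeta>[of A i]]) blast
    define I where "I = (\<lambda>i t. v (\<zeta> i t) * q (\<zeta> i t) * k i t)"
    \<comment> \<open>\<open>I\<close> carries the boundary defect \<open>v\<close> and vanishes in
      the limit; \<open>J\<close> carries \<open>cnj h\<close> minus its Taylor polynomial and gives
      the estimate.\<close>
    define J where "J = (\<lambda>i t. B (\<zeta> i t) * cnj (h (\<zeta> i t) - T (\<zeta> i t)) * q (\<zeta> i t) * k i t)"
    have contI: "continuous_on {0..2*pi} (I i)" for i
      unfolding I_def by (intro continuous_intros compD contv contk holomorphic_on_imp_continuous_on[OF holq])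
    have contJ: "continuous_on {0..2*pi} (J i)" for i
      unfolding J_def T_def
      by (intro continuous_intros compD contk holomorphic_on_imp_continuous_on holq holB holh holomorphic_taylor_poly)
    have sum: "((\<lambda>t. I i t + J i t) has_integral (2 * pi * f a)) {0..2 * pi}" for i
    proof -
      \<comment> \<open>On the circle of radius \<open>\<rho> i\<close> one has
        \<open>cnj w = \<rho> i ^ 2 / w\<close>, so \<open>w ^ n * cnj (T w)\<close> is a polynomial
        in \<open>w\<close> there. Thus \<open>W\<close> is holomorphic, equals
        \<open>B * cnj T * q\<close> on this circle and vanishes at \<open>a\<close> because
        \<open>B\<close> does: subtracting it leaves Cauchy's value unchanged.\<close>
      define W where "W = (\<lambda>w. B w * Q w * (\<Sum>s\<le>n. cnj ((deriv ^^ s) h a) / fact s * w ^ (n - s) * (complex_of_real (\<rho> i) ^ 2 - cnj a * w) ^ s))"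
      have "W holomorphic_on \<D>" unfolding W_def by (intro holomorphic_intros holB holQ) auto
      moreover have "(\<lambda>w. u w * q w) holomorphic_on \<D>" by (intro holomorphic_intros holu holq)
      ultimately have "(\<lambda>w. u w * q w - W w) holomorphic_on ball 0 1" by (intro holomorphic_on_diff)
      from cauchy_integral_circle[OF this \<rho>(1,2)]
      have "((\<lambda>t. (u (\<zeta> i t) * q (\<zeta> i t) - W (\<zeta> i t)) * k i t) has_integral (2 * pi * f a)) {0..2 * pi}"
        by (simp add: qa ua W_def Ba \<zeta>_def k_def)
      moreover have "(u (\<zeta> i t) * q (\<zeta> i t) - W (\<zeta> i t)) * k i t = I i t + J i t" for t
      proof -
        define w where "w = \<zeta> i t"
        have ww: "w * cnj w = complex_of_real (\<rho> i) ^ 2" using complex_norm_square[of w] n\<zeta>[of i t] by (simp add: w_def)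
        have "w ^ n * cnj (T w) = (\<Sum>s\<le>n. cnj ((deriv ^^ s) h a) / fact s * w ^ (n - s) * (complex_of_real (\<rho> i) ^ 2 - cnj a * w) ^ s)"
          unfolding T_def taylor_poly_def cnj_sum sum_distrib_left
        proof (intro sum.cong refl)
          fix s assume "s \<in> {..n}"
          then have "w ^ n = w ^ (n - s) * w ^ s" by (simp add: power_add[symmetric])
          moreover have "w ^ s * (cnj w - cnj a) ^ s = (complex_of_real (\<rho> i) ^ 2 - cnj a * w) ^ s"
            unfolding power_mult_distrib[symmetric] ww[symmetric] by (simp add: algebra_simps)
          ultimately show "w ^ n * cnj ((deriv ^^ s) h a * (w - a) ^ s / fact s) =
            cnj ((deriv ^^ s) h a) / fact s * w ^ (n - s) * (complex_of_real (\<rho> i) ^ 2 - cnj a * w) ^ s"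
            by (simp add: mult_ac)
        qed
        then have "W w = B w * Q w * (w ^ n * cnj (T w))" by (simp add: W_def)
        then have "W w = B w * cnj (T w) * q w" by (simp add: q_def)
        then show ?thesis
          unfolding I_def J_def v_def w_def[symmetric] by (simp add: algebra_simps)
      qed
      ultimately show ?thesis by simp
    qed
    define C' where "C' = C3 * \<epsilon> powr (\<alpha> + 1)"
    \<comment> \<open>The remainder gives \<open>norm (w - a) powr \<alpha>\<close>, the Cauchy
      kernel costs one power, and \<open>q\<close> supplies a multiple of
      \<open>(\<epsilon> / X) ^ (n + 2)\<close>. Keeping \<open>1 / X ^ 2\<close> as a Poisson
      kernel leaves the exponent \<open>\<alpha> - 1 - real n\<close>, which is negative, so
      \<open>X\<close> can be replaced by \<open>\<epsilon>\<close>.\<close>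
    have Jb: "norm (J i t) \<le> C' * (1 / norm (1 - (cnj a * complex_of_real (\<rho> i)) * cis t) ^ 2)" for i t
    proof -
      define w where "w = \<zeta> i t"
      define X where "X = norm (1 - cnj a * w)"
      have wD: "w \<in> \<D>" using \<zeta>D by (simp add: w_def)
      have X: "\<epsilon> \<le> X" "norm (w - a) \<le> X" "0 < X" using one_minus_cnj_bounds[of a w] wD a by (auto simp: X_def \<epsilon>_def)
      have wa: "0 < norm (w - a)" using \<zeta>a0 by (simp add: w_def)
      define Qb where "Qb = 2 ^ n * ((2 * \<epsilon>) ^ (n + 2) / X ^ (n + 2))"
      have Qb: "norm (q w) \<le> Qb" "0 \<le> Qb" using qb[OF wD] X \<epsilon> unfolding Qb_def X_def by auto
      have kw: "norm (k i t) \<le> 1 / norm (w - a)" using kb[of i t] by (simp add: w_def)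
      have hT: "norm (h w - T w) \<le> C * norm (w - a) powr \<alpha>" using C(2)[of 0 w a] wD aD by (simp add: T_def)
      have "norm (J i t) \<le> 1 * (C * norm (w - a) powr \<alpha>) * Qb * (1 / norm (w - a))"
        unfolding J_def norm_mult complex_mod_cnj w_def[symmetric]
        by (intro mult_mono B1[OF wD] hT Qb kw mult_nonneg_nonneg) (use C Qb in auto)
      also have "\<dots> = C * norm (w - a) powr (\<alpha> - 1) * Qb"
        using wa by (simp add: powr_diff)
      also have "\<dots> \<le> C * X powr (\<alpha> - 1) * Qb"
        using X \<alpha> C Qb by (intro mult_right_mono mult_left_mono powr_mono2) auto
      also have "\<dots> = C3 * \<epsilon> ^ (n + 2) * (X powr (\<alpha> - 1 - real n) / X ^ 2)"
      proof -
        have "X powr (\<alpha> - 1 - real n) = X powr (\<alpha> - 1) / X ^ n"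
          using X powr_diff[of X "\<alpha> - 1" "real n"] by (simp add: powr_realpow)
        moreover have "(4::real) ^ n = 2 ^ n * 2 ^ n" by (simp add: power_mult_distrib[symmetric])
        ultimately show ?thesis
          using X by (simp add: Qb_def C3_def power_mult_distrib power_add power_mult power2_eq_square field_simps)
      qed
      also have "X powr (\<alpha> - 1 - real n) / X ^ 2 \<le> \<epsilon> powr (\<alpha> - 1 - real n) / X ^ 2"
        using X \<epsilon> \<alpha> by (intro divide_right_mono powr_mono2') auto
      also have "C3 * \<epsilon> ^ (n + 2) * (\<epsilon> powr (\<alpha> - 1 - real n) / X ^ 2) = C' * (1 / X ^ 2)"
      proof -
        have "\<epsilon> ^ (n + 2) * \<epsilon> powr (\<alpha> - 1 - real n) = \<epsilon> powr (\<alpha> + 1)"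
          using \<epsilon> by (simp add: powr_realpow[symmetric] powr_add[symmetric] add.commute del: power_Suc power_Suc2)
        then show ?thesis by (simp add: C'_def)
      qed
      finally have "norm (J i t) \<le> C' * (1 / X ^ 2)" using C3 \<epsilon> by (simp add: mult_left_mono)
      then show ?thesis by (simp add: X_def w_def \<zeta>_def mult.assoc)
    qed
    have near: "norm (2 * pi * f a - integral {0..2*pi} (I i)) \<le> 2 * pi * (C' / \<epsilon>)" for i
    proof -
      have iI: "I i integrable_on {0..2*pi}" and iJ: "J i integrable_on {0..2*pi}"
        using contI contJ by (auto intro: integrable_continuous_interval)
      have na: "norm (cnj a * complex_of_real (\<rho> i)) \<le> norm a" "norm (cnj a * complex_of_real (\<rho> i)) < 1"
      proof -
        show "norm (cnj a * complex_of_real (\<rho> i)) \<le> norm a"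
          using \<rho>(2,3)[of i] by (simp add: norm_mult mult_left_le)
        then show "norm (cnj a * complex_of_real (\<rho> i)) < 1" using a by linarith
      qed
      note poi = has_integral_mult_right[OF poisson_integral[OF na(2)], of C']
      have "2 * pi * f a = integral {0..2*pi} (I i) + integral {0..2*pi} (J i)"
        using integral_unique[OF sum[of i]] integral_add[OF iI iJ] by simp
      then have "norm (2 * pi * f a - integral {0..2*pi} (I i)) = norm (integral {0..2*pi} (J i))" by simp
      also have "\<dots> \<le> integral {0..2*pi} (\<lambda>t. C' * (1 / norm (1 - (cnj a * complex_of_real (\<rho> i)) * cis t) ^ 2))"
        using Jb poi by (intro integral_norm_bound_integral iJ) (auto simp: has_integral_integrable)
      also have "\<dots> = C' * (2 * pi / (1 - norm (cnj a * complex_of_real (\<rho> i)) ^ 2))"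
        using poi by (rule integral_unique)
      also have "\<dots> \<le> C' * (2 * pi / \<epsilon>)"
      proof (intro mult_left_mono divide_left_mono)
        have "norm (cnj a * complex_of_real (\<rho> i)) ^ 2 \<le> norm (cnj a * complex_of_real (\<rho> i)) ^ 1"
          using na by (intro power_decreasing) auto
        then show "\<epsilon> \<le> 1 - norm (cnj a * complex_of_real (\<rho> i)) ^ 2" using na by (simp add: \<epsilon>_def)
        then show "0 < (1 - norm (cnj a * complex_of_real (\<rho> i)) ^ 2) * \<epsilon>" using \<epsilon> by simp
        show "0 \<le> C'" using C3 by (simp add: C'_def)
      qed auto
      finally show ?thesis by (simp add: mult_ac)
    qed
    define c where "c = (2 ^ n * 2 ^ (n + 2)) * (2 / \<epsilon>)"
    have c0: "0 \<le> c" using \<epsilon> by (simp add: c_def)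
    have Ic: "norm (I i t) \<le> norm (v (\<zeta> i t)) * c" for i t
    proof -
      have X: "\<epsilon> \<le> norm (1 - cnj a * \<zeta> i t)"
        using one_minus_cnj_bounds(1)[of a "\<zeta> i t"] \<zeta>D[of i t] a by (simp add: \<epsilon>_def)
      have "(2 * \<epsilon>) ^ (n + 2) / norm (1 - cnj a * \<zeta> i t) ^ (n + 2) \<le> (2 * \<epsilon>) ^ (n + 2) / \<epsilon> ^ (n + 2)"
        using X \<epsilon> by (intro divide_left_mono power_mono mult_pos_pos zero_less_power) auto
      also have "\<dots> = 2 ^ (n + 2)" using \<epsilon> by (simp add: power_mult_distrib)
      finally have q1: "norm (q (\<zeta> i t)) \<le> 2 ^ n * 2 ^ (n + 2)"
        using qb[OF \<zeta>D[of i t]] by (meson mult_left_mono order_trans zero_le_numeral zero_le_power)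
      have "1 / norm (\<zeta> i t - a) \<le> 1 / (\<epsilon> / 2)" using \<zeta>a[of i t] \<epsilon> by (intro divide_left_mono mult_pos_pos) auto
      then have k1: "norm (k i t) \<le> 2 / \<epsilon>" using kb[of i t] by simp
      have "norm (q (\<zeta> i t)) * norm (k i t) \<le> c" unfolding c_def by (intro mult_mono q1 k1) auto
      then show ?thesis unfolding I_def norm_mult mult.assoc by (intro mult_left_mono) auto
    qed
    \<comment> \<open>For a fixed zero a constant majorant is enough, and it may depend on
      \<open>\<epsilon>\<close>: only the bound \<open>near\<close>, which holds for every radius,
      enters the result.\<close>
    have "(\<lambda>i. integral\<^sup>L ?M (I i)) \<longlonglongrightarrow> integral\<^sup>L ?M (\<lambda>_. 0)"
    proof (rule integral_dominated_convergence)
      show "integrable ?M (\<lambda>_. V * c)" by (intro continuous_imp_integrable_real continuous_intros)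
      show "I i \<in> borel_measurable ?M" for i
        by (intro borel_measurable_integrable continuous_imp_integrable_real contI)
      show "AE t in ?M. norm (I i t) \<le> V * c" for i
        using order_trans[OF Ic mult_right_mono[OF V[OF \<zeta>D] c0]] by (intro AE_I2)
      have \<rho>lim: "\<rho> \<longlonglongrightarrow> 1 - 0"
        unfolding \<rho>_def by (intro tendsto_diff tendsto_const LIMSEQ_Suc lim_const_over_n)
      have lf: "filterlim \<rho> (at_left 1) sequentially"
        unfolding filterlim_at using \<rho>lim \<rho>(2) by (auto intro!: always_eventually simp: less_imp_neq)
      show "AE t in ?M. (\<lambda>i. I i t) \<longlonglongrightarrow> 0"
        using vlim
      proof eventually_elim
        case (elim t)
        have v0: "(\<lambda>i. v (\<zeta> i t)) \<longlonglongrightarrow> 0"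
          using filterlim_compose[OF elim lf] by (simp add: \<zeta>_def)
        have "(\<lambda>i. norm (v (\<zeta> i t)) * c) \<longlonglongrightarrow> 0"
          by (rule tendsto_mult_left_zero[OF tendsto_norm_zero[OF v0]])
        then show ?case by (rule Lim_null_comparison[OF always_eventually[OF allI[OF Ic]]])
      qed
    qed simp
    moreover have "integral\<^sup>L ?M (I i) = integral {0..2*pi} (I i)" for i
      by (intro lebesgue_integral_eq_integral continuous_imp_integrable_real contI) auto
    ultimately have "(\<lambda>i. integral {0..2*pi} (I i)) \<longlonglongrightarrow> 0" by simp
    then have "(\<lambda>i. 2 * pi * f a - integral {0..2*pi} (I i)) \<longlonglongrightarrow> 2 * pi * f a - 0"
      by (intro tendsto_intros)
    then have "norm (2 * pi * f a - 0) \<le> 2 * pi * (C' / \<epsilon>)"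
      by (rule Lim_norm_ubound[rotated]) (use near in auto)
    then have "2 * pi * norm (f a) \<le> 2 * pi * (C' / \<epsilon>)" by (simp only: diff_zero norm_mult norm_of_real) simp
    then have "norm (f a) \<le> C' / \<epsilon>" by (rule mult_left_le_imp_le) simp
    also have "C' / \<epsilon> = C3 * \<epsilon> powr \<alpha>" using \<epsilon> by (simp add: C'_def powr_add)
    finally show ?thesis by (simp add: a_def \<epsilon>_def)
  qed
  show ?thesis
  proof (rule that)
    fix j
    show "norm (f (z j)) \<le> max C3 (Mf * 2 powr \<alpha>) * (1 - norm (z j)) powr \<alpha>"
    proof (cases "1 / 2 \<le> norm (z j)")
      case True
      have "C3 * (1 - norm (z j)) powr \<alpha> \<le> max C3 (Mf * 2 powr \<alpha>) * (1 - norm (z j)) powr \<alpha>"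
        by (intro mult_right_mono) auto
      then show ?thesis using main[OF True] by linarith
    next
      case False
      have "norm (f (z j)) \<le> Mf" using Mf zD by auto
      also have "Mf = Mf * 2 powr \<alpha> * (1 / 2) powr \<alpha>" by (simp add: powr_divide)
      also have "\<dots> \<le> Mf * 2 powr \<alpha> * (1 - norm (z j)) powr \<alpha>"
        using False Mf \<alpha> by (intro mult_left_mono powr_mono2) auto
      also have "\<dots> \<le> max C3 (Mf * 2 powr \<alpha>) * (1 - norm (z j)) powr \<alpha>"
        by (intro mult_right_mono) auto
      finally show ?thesis .
    qed
  qed
qed

subsection \<open>Functions vanishing to high order at two close points\<close>

lemma higher_deriv_mult_power_eq_0:
  fixes a :: complex
  assumes A: "open A" "a \<in> A" and f: "f holomorphic_on A" and g: "g holomorphic_on A" "g a = 0" and "s < k"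
  shows "(deriv ^^ s) (\<lambda>x. f x * g x ^ k) a = 0"
  using \<open>s < k\<close>
proof (induction k arbitrary: s)
  case (Suc k)
  have "(\<lambda>x. f x * g x ^ Suc k) = (\<lambda>x. (f x * g x ^ k) * g x)" by (simp add: mult_ac)
  then have "(deriv ^^ s) (\<lambda>x. f x * g x ^ Suc k) a =
      (\<Sum>i = 0..s. of_nat (s choose i) * (deriv ^^ i) (\<lambda>x. f x * g x ^ k) a * (deriv ^^ (s - i)) g a)"
    by (simp only:) (intro higher_deriv_mult[of _ A] holomorphic_intros f g A)
  also have "\<dots> = 0"
  proof (intro sum.neutral ballI)
    fix i assume i: "i \<in> {0..s}"
    show "of_nat (s choose i) * (deriv ^^ i) (\<lambda>x. f x * g x ^ k) a * (deriv ^^ (s - i)) g a = 0"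
    proof (cases "i < k")
      case True
      then show ?thesis using Suc.IH by simp
    next
      case False
      then have "s - i = 0" using i Suc.prems by auto
      then show ?thesis using g(2) by simp
    qed
  qed
  finally show ?case .
qed simp

text \<open>The Taylor polynomial at \<open>v\<close> is \<open>(x - v) ^ k\<close> times a polynomial of degree less than \<open>k\<close>,
  which is determined by its jet at \<open>u\<close>.\<close>

lemma two_point_bound:
  assumes tb: "taylor_bound n \<alpha> C F"
    and \<alpha>: "real n < \<alpha>" and k: "k \<le> n" "n < 2 * k" and L: "L > 0"
  obtains M where "M > 0" "\<And>u v \<eta> x. u \<in> \<D> \<Longrightarrow> v \<in> \<D> \<Longrightarrow> u \<noteq> v \<Longrightarrow> \<forall>s<k. (deriv ^^ s) F v = 0 \<Longrightarrow>
     \<forall>s<k. (deriv ^^ s) F u = 0 \<Longrightarrow> \<eta> \<le> L * norm (u - v) \<Longrightarrow> norm (u - v) \<le> L * \<eta> \<Longrightarrow>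
     x \<in> \<D> \<Longrightarrow> norm (x - v) \<le> \<eta> \<Longrightarrow> norm (F x) \<le> M * \<eta> powr \<alpha>"
proof -
  note C = taylor_boundD(1)[OF tb] and taylor = taylor_boundD(2)[OF tb]
  define K where "K = real (Suc n) * (C * 2 ^ k * 2 ^ n * fact n * 4 ^ n)"
  have K: "K > 0" using C by (simp add: K_def)
  define M where "M = C + real (Suc n) * K * ((L + 1) * L) powr (\<alpha> - real k)"
  have "norm (F x) \<le> M * \<eta> powr \<alpha>"
    if u: "u \<in> \<D>" and v: "v \<in> \<D>" and uv: "u \<noteq> v" and Fv: "\<forall>s<k. (deriv ^^ s) F v = 0"
      and Fu: "\<forall>s<k. (deriv ^^ s) F u = 0" and \<eta>1: "\<eta> \<le> L * norm (u - v)"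
      and \<eta>2: "norm (u - v) \<le> L * \<eta>" and x: "x \<in> \<D>" "norm (x - v) \<le> \<eta>" for u v \<eta> x
  proof -
    define e where "e = norm (u - v)"
    have e: "e > 0" using uv by (simp add: e_def)
    have \<eta>: "\<eta> > 0" using order.strict_trans2[OF e \<eta>2[folded e_def]] L by (simp add: zero_less_mult_iff)
    define a where "a = (\<lambda>i. (deriv ^^ i) F v)"
    have a0: "a i = 0" if "i < k" for i using Fv that by (simp add: a_def)
    define P where "P = taylor_poly a n v"
    \<comment> \<open>The coefficients of the quotient of \<open>P\<close> by the
      \<open>k\<close>-th power, renormalised because \<open>taylor_poly\<close> divides by
      factorials.\<close>
    define b where "b = (\<lambda>i. a (i + k) * fact i / fact (i + k))"
    define Q where "Q = taylor_poly b (n - k) v"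
    have PQ: "P y = (y - v) ^ k * Q y" for y
    proof -
      have "P y = (\<Sum>i\<in>{k..n}. a i * (y - v) ^ i / fact i)"
        unfolding P_def taylor_poly_def using a0 by (intro sum.mono_neutral_right) auto
      also have "\<dots> = (\<Sum>i\<le>n - k. a (k + i) * (y - v) ^ (k + i) / fact (k + i))"
        unfolding sum.atLeastAtMost_shift_0[OF k(1)] atMost_atLeast0 by (simp add: o_def)
      also have "\<dots> = (y - v) ^ k * Q y"
        unfolding Q_def taylor_poly_def sum_distrib_left
        by (intro sum.cong refl) (simp add: b_def power_add add.commute)
      finally show ?thesis .
    qed
    \<comment> \<open>The derivatives of \<open>F\<close> of order below \<open>k\<close> vanish at
      \<open>u\<close>, so those of \<open>P\<close> are Taylor remainders of \<open>F\<close> up to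
      sign.\<close>
    have Pu: "norm ((deriv ^^ i) P u) \<le> C * e powr (\<alpha> - real i)" if "i < k" for i
    proof -
      have "(deriv ^^ i) P u = taylor_poly (\<lambda>j. (deriv ^^ (j + i)) F v) (n - i) v u"
        unfolding P_def a_def using that k by (intro higher_deriv_taylor_poly) auto
      then show ?thesis using taylor[of i u v] that k u v Fu by (simp add: e_def)
    qed
    define R where "R = (\<lambda>y. 1 / (y - v) ^ k)"
    have far: "e / 2 \<le> norm (y - v)" if "y \<in> ball u (e / 2)" for y
      using norm_triangle_ineq[of "u - y" "y - v"] that by (simp add: e_def dist_norm)
    then have yv: "y \<noteq> v" if "y \<in> ball u (e / 2)" for y using that e by force
    have holR: "R holomorphic_on ball u (e / 2)"
      unfolding R_def using yv by (intro holomorphic_intros) auto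
    have Ru: "norm ((deriv ^^ i) R u) \<le> fact i * (2 / e) ^ k * (2 / (e / 2)) ^ i" for i
    proof (rule norm_higher_deriv_ball_le[OF holR])
      fix y assume y: "y \<in> ball u (e / 2)"
      have "norm (R y) = (1 / norm (y - v)) ^ k" by (simp add: R_def norm_divide norm_power power_divide)
      also have "\<dots> \<le> (1 / (e / 2)) ^ k"
        using far[OF y] e by (intro power_mono divide_left_mono mult_pos_pos) auto
      finally show "norm (R y) \<le> (2 / e) ^ k" by simp
    qed (use e in auto)
    \<comment> \<open>Near \<open>u\<close>, \<open>Q = P * R\<close>, and Leibniz involves
      derivatives of \<open>P\<close> of order at most \<open>n - k\<close>. These are below
      \<open>k\<close>, hence covered by \<open>Pu\<close>, because
      \<open>n < 2 * k\<close>.\<close>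
    have Qu: "norm ((deriv ^^ s) Q u) \<le> K * e powr (\<alpha> - real k - real s)" if s: "s \<le> n - k" for s
    proof -
      have "(deriv ^^ s) Q u = (deriv ^^ s) (\<lambda>y. P y * R y) u"
      proof (rule higher_deriv_cong_ev)
        show "\<forall>\<^sub>F y in nhds u. Q y = P y * R y"
          by (rule eventually_mono[OF eventually_nhds_ball[of "e / 2"]]) (use e yv in \<open>auto simp: PQ R_def\<close>)
      qed simp
      also have "\<dots> = (\<Sum>i = 0..s. of_nat (s choose i) * (deriv ^^ i) P u * (deriv ^^ (s - i)) R u)"
        using e by (intro higher_deriv_mult[of _ "ball u (e / 2)"] holR) (auto simp: P_def intro: holomorphic_taylor_poly)
      also have "norm \<dots> \<le> of_nat (card {0..s}) * (C * 2 ^ k * 2 ^ n * fact n * 4 ^ n * e powr (\<alpha> - real k - real s))"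
      proof (rule sum_norm_bound)
        fix i assume i: "i \<in> {0..s}"
        have "norm (of_nat (s choose i) * (deriv ^^ i) P u * (deriv ^^ (s - i)) R u)
            \<le> 2 ^ n * (C * e powr (\<alpha> - real i)) * (fact (s - i) * (2 / e) ^ k * (2 / (e / 2)) ^ (s - i))"
          unfolding norm_mult
        proof (intro mult_mono Ru Pu)
          have "real (s choose i) \<le> 2 ^ s" using binomial_le_pow2[of s i] by (metis of_nat_le_iff of_nat_numeral of_nat_power)
          also have "\<dots> \<le> 2 ^ n" using s by (intro power_increasing) auto
          finally show "norm (of_nat (s choose i) :: complex) \<le> 2 ^ n" by simp
        qed (use i s k C e in auto)
        also have "\<dots> = (C * 2 ^ k * 2 ^ n * fact (s - i) * 4 ^ (s - i)) * (e powr (\<alpha> - real i) / e ^ k / e ^ (s - i))"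
          by (simp add: power_divide)
        also have "e powr (\<alpha> - real i) / e ^ k / e ^ (s - i) = e powr (\<alpha> - real k - real s)"
          using e i by (simp add: powr_realpow[symmetric] powr_diff[symmetric] of_nat_diff algebra_simps)
        also have "(C * 2 ^ k * 2 ^ n * fact (s - i) * 4 ^ (s - i)) * e powr (\<alpha> - real k - real s)
            \<le> (C * 2 ^ k * 2 ^ n * fact n * 4 ^ n) * e powr (\<alpha> - real k - real s)"
          using C s by (intro mult_right_mono mult_mono mult_left_mono fact_mono power_increasing) auto
        finally show "norm (of_nat (s choose i) * (deriv ^^ i) P u * (deriv ^^ (s - i)) R u)
            \<le> C * 2 ^ k * 2 ^ n * fact n * 4 ^ n * e powr (\<alpha> - real k - real s)" .
      qed
      also have "\<dots> \<le> K * e powr (\<alpha> - real k - real s)"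
        unfolding K_def mult.assoc using s C by (intro mult_right_mono) auto
      finally show ?thesis .
    qed
    have "Q x = taylor_poly (\<lambda>s. (deriv ^^ s) Q u) (n - k) u x"
      unfolding Q_def taylor_poly_recenter[of b "n - k" v x u]
      unfolding taylor_poly_def[of _ "n - k" u] by (intro sum.cong refl) (simp add: higher_deriv_taylor_poly)
    also have "norm \<dots> \<le> real (Suc (n - k)) * (K * ((L + 1) * e) powr (\<alpha> - real k))"
    proof (rule norm_taylor_poly_le_powr)
      fix s assume s: "s \<le> n - k"
      have "e \<le> (L + 1) * e" using L e by (simp add: distrib_right)
      moreover have "0 \<le> \<alpha> - real k - real s" using s k \<alpha> by linarith
      ultimately have "K * e powr (\<alpha> - real k - real s) \<le> K * ((L + 1) * e) powr (\<alpha> - real k - real s)"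
        using e K by (intro mult_left_mono powr_mono2) auto
      then show "norm ((deriv ^^ s) Q u) \<le> K * ((L + 1) * e) powr (\<alpha> - real k - real s)"
        using Qu[OF s] by linarith
    next
      show "norm (x - u) \<le> (L + 1) * e"
        using norm_triangle_ineq[of "x - v" "v - u"] x \<eta>1 by (simp add: e_def norm_minus_commute distrib_right)
    qed (use L e in auto)
    also have "\<dots> \<le> real (Suc n) * (K * ((L + 1) * (L * \<eta>)) powr (\<alpha> - real k))"
      using K L \<eta>2 e k \<alpha> by (intro mult_mono mult_left_mono powr_mono2) (auto simp: e_def)
    also have "((L + 1) * (L * \<eta>)) powr (\<alpha> - real k) = ((L + 1) * L) powr (\<alpha> - real k) * \<eta> powr (\<alpha> - real k)"
      using L \<eta> powr_mult[of "(L + 1) * L" \<eta> "\<alpha> - real k"] by (simp add: mult.assoc)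
    finally have Qx: "norm (Q x) \<le> real (Suc n) * K * ((L + 1) * L) powr (\<alpha> - real k) * \<eta> powr (\<alpha> - real k)"
      by (simp add: mult.assoc)
    have "norm (P x) \<le> \<eta> ^ k * (real (Suc n) * K * ((L + 1) * L) powr (\<alpha> - real k) * \<eta> powr (\<alpha> - real k))"
      unfolding PQ norm_mult norm_power using x \<eta> by (intro mult_mono Qx power_mono) auto
    also have "\<dots> = real (Suc n) * K * ((L + 1) * L) powr (\<alpha> - real k) * \<eta> powr \<alpha>"
      using \<eta> by (simp add: powr_diff powr_realpow)
    finally have Px: "norm (P x) \<le> real (Suc n) * K * ((L + 1) * L) powr (\<alpha> - real k) * \<eta> powr \<alpha>" .
    have "norm (F x - P x) \<le> C * norm (x - v) powr \<alpha>"
      using taylor[of 0 x v] x v by (simp add: P_def a_def)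
    also have "\<dots> \<le> C * \<eta> powr \<alpha>" using x C \<alpha> by (intro mult_left_mono powr_mono2) auto
    finally have "norm (F x) \<le> C * \<eta> powr \<alpha> + real (Suc n) * K * ((L + 1) * L) powr (\<alpha> - real k) * \<eta> powr \<alpha>"
      using norm_triangle_sub[of "F x" "P x"] Px by linarith
    then show ?thesis by (simp add: M_def distrib_right)
  qed
  moreover have "M > 0" using C K L by (auto simp: M_def intro!: add_pos_nonneg mult_nonneg_nonneg)
  ultimately show ?thesis by (intro that[of M])
qed

section \<open>Small jets from smoothness of the product\<close>

context carleson_seq
begin

text \<open>By the hypothesis on \<open>M\<close> each zero has a neighbour at distance comparable
  with \<open>eps j\<close>, so \<open>two_point_bound\<close> makes \<open>F\<close> small near
  \<open>z j\<close>. On a small circle around \<open>z j\<close> the product is bounded below and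
  can be divided out; the maximum principle fills the disc, and Cauchy gives the jets.\<close>

lemma jets_of_smooth_mult:
  assumes z: "blaschke_seq z" and f: "f \<in> A_space \<alpha>" and \<alpha>: "real n < \<alpha>" "\<alpha> < real n + 1"
    and F: "(\<lambda>w. f w * blaschke_product z w ^ k) \<in> A_space \<alpha>" and k: "k \<le> n" "n < 2 * k"
    and M: "\<And>j. sep_dist z j \<le> M * eps j"
  obtains P where "P \<ge> 0" "\<And>s j. s \<le> n \<Longrightarrow> norm ((deriv ^^ s) f (z j)) \<le> P * eps j powr (\<alpha> - real s)"
proof -
  define B where "B = blaschke_product z"
  define F where "F = (\<lambda>w. f w * B w ^ k)"
  have FA: "F \<in> A_space \<alpha>" using F by (simp add: F_def B_def)
  have holB: "B holomorphic_on \<D>" unfolding B_def by (rule blaschke_product_holomorphic[OF z])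
  note holf = A_space_holomorphic[OF f]
  obtain C where tb: "taylor_bound n \<alpha> C F" using A_space_taylor[OF FA \<alpha>] .
  note C = taylor_boundD[OF tb]
  \<comment> \<open>\<open>1 / \<delta>\<close> comes from the separation; the factor 2 allows for a
    neighbour that is only nearly closest.\<close>
  define L where "L = max (1 / \<delta>) (2 * max M 1)"
  have L: "L > 0" by (simp add: L_def)
  obtain M' where M': "M' > 0" "\<And>u v \<eta> x. u \<in> \<D> \<Longrightarrow> v \<in> \<D> \<Longrightarrow> u \<noteq> v \<Longrightarrow> \<forall>s<k. (deriv ^^ s) F v = 0 \<Longrightarrow>
     \<forall>s<k. (deriv ^^ s) F u = 0 \<Longrightarrow> \<eta> \<le> L * norm (u - v) \<Longrightarrow> norm (u - v) \<le> L * \<eta> \<Longrightarrow>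
     x \<in> \<D> \<Longrightarrow> norm (x - v) \<le> \<eta> \<Longrightarrow> norm (F x) \<le> M' * \<eta> powr \<alpha>"
    by (rule two_point_bound[OF tb \<alpha>(1) k L]) (rule that)
  have zD: "z j \<in> \<D>" for j using norm_z by simp
  have Fz: "(deriv ^^ s) F (z j) = 0" if "s < k" for s j
    unfolding F_def using that blaschke_product_eq_0_iff[OF z, of "z j"] norm_z
    by (intro higher_deriv_mult_power_eq_0[of \<D>] holf holB) (auto simp: B_def)
  have Fb: "norm (F x) \<le> M' * eps j powr \<alpha>" if x: "norm (x - z j) < eps j" for x j
  proof -
    have "M * eps j \<le> max M 1 * eps j" using eps(1)[of j] by (intro mult_right_mono) auto
    moreover have "0 < max M 1 * eps j" using eps(1)[of j] by (intro mult_pos_pos) auto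
    ultimately have "sep_dist z j < 2 * max M 1 * eps j" using M[of j] by linarith
    then obtain l where l: "l \<noteq> j" "norm (z j - z l) < 2 * max M 1 * eps j" by (rule sep_dist_attained)
    show ?thesis
    proof (rule M'(2)[of "z l" "z j"])
      show "z l \<noteq> z j" using l inj_z by (simp add: inj_eq)
      have "eps j \<le> 1 / \<delta> * norm (z l - z j)"
        using separated(1)[OF l(1)] \<delta>_pos by (simp add: field_simps norm_minus_commute)
      also have "\<dots> \<le> L * norm (z l - z j)" by (intro mult_right_mono) (auto simp: L_def)
      finally show "eps j \<le> L * norm (z l - z j)" .
      have "norm (z l - z j) \<le> 2 * max M 1 * eps j" using l(2) by (simp add: norm_minus_commute)
      also have "\<dots> \<le> L * eps j" using eps(1)[of j] by (intro mult_right_mono) (auto simp: L_def)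
      finally show "norm (z l - z j) \<le> L * eps j" .
      show "x \<in> \<D>" using ball_eps_subset[OF x] .
    qed (use zD Fz x in auto)
  qed
  define \<theta> where "\<theta> = \<delta> / 8"
  have \<theta>: "0 < \<theta>" "\<theta> \<le> \<delta> / 8" "\<theta> < 1" using \<delta>_pos \<delta>_le_1 by (auto simp: \<theta>_def)
  define b where "b = \<theta> * \<delta> / 6"
  have b: "b > 0" using \<theta> \<delta>_pos by (simp add: b_def)
  define P0 where "P0 = M' / b ^ k"
  have P0: "P0 \<ge> 0" using M' b by (simp add: P0_def)
  have circ: "norm (f x) \<le> P0 * eps j powr \<alpha>" if x: "norm (x - z j) = \<theta> * eps j" for x j
  proof -
    have lt: "norm (x - z j) < eps j" using x \<theta> eps(1)[of j] by simp
    then have xD: "x \<in> \<D>" by (rule ball_eps_subset)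
    have "b \<le> norm (B x)" unfolding B_def
    proof (rule tendsto_lowerbound[OF tendsto_norm[OF finite_blaschke_tendsto[OF z]]])
      show "norm x < 1" using xD by simp
      show "\<forall>\<^sub>F N in sequentially. b \<le> norm (fb {..<N} x)"
        using eventually_gt_at_top[of j] unfolding b_def
        by eventually_elim (use fb_lower_circle[OF _ _ \<theta>(1,2) x] in auto)
    qed auto
    then have "norm (f x) * b ^ k \<le> norm (f x) * norm (B x) ^ k"
      using b by (intro mult_left_mono power_mono) auto
    also have "\<dots> = norm (F x)" by (simp add: F_def norm_mult norm_power)
    also have "\<dots> \<le> M' * eps j powr \<alpha>" by (rule Fb[OF lt])
    finally show ?thesis using b by (simp add: P0_def field_simps)
  qed
  have disc: "norm (f x) \<le> P0 * eps j powr \<alpha>" if x: "x \<in> ball (z j) (\<theta> * eps j)" for x j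
  proof (rule maximum_modulus_frontier[of f "ball (z j) (\<theta> * eps j)"])
    have r0: "0 < \<theta> * eps j" using \<theta> eps(1)[of j] by simp
    have "\<theta> * eps j < eps j" using \<theta> eps(1)[of j] by simp
    then have sub: "cball (z j) (\<theta> * eps j) \<subseteq> \<D>"
      using ball_eps_subset[of _ j] by (auto simp: dist_norm norm_minus_commute)
    then have "ball (z j) (\<theta> * eps j) \<subseteq> \<D>" using ball_subset_cball by blast
    then show "f holomorphic_on interior (ball (z j) (\<theta> * eps j))"
      unfolding interior_open[OF open_ball] by (rule holomorphic_on_subset[OF holf])
    show "continuous_on (closure (ball (z j) (\<theta> * eps j))) f"
      using sub r0 by (intro holomorphic_on_imp_continuous_on holomorphic_on_subset[OF holf]) auto
    show "norm (f y) \<le> P0 * eps j powr \<alpha>" if "y \<in> frontier (ball (z j) (\<theta> * eps j))" for y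
      using that r0 by (intro circ) (auto simp: dist_norm norm_minus_commute)
  qed (use x in auto)
  define P where "P = P0 * fact n * (1 + 2 / \<theta>) ^ n"
  have "norm ((deriv ^^ s) f (z j)) \<le> P * eps j powr (\<alpha> - real s)" if s: "s \<le> n" for s j
  proof -
    have r0: "0 < \<theta> * eps j" using \<theta> eps(1)[of j] by simp
    have "\<theta> * eps j < eps j" using \<theta> eps(1)[of j] by simp
    then have sub: "ball (z j) (\<theta> * eps j) \<subseteq> \<D>"
      using ball_eps_subset[of _ j] by (auto simp: dist_norm norm_minus_commute)
    have "norm ((deriv ^^ s) f (z j)) \<le> fact s * (P0 * eps j powr \<alpha>) * (2 / (\<theta> * eps j)) ^ s"
      by (rule norm_higher_deriv_ball_le[OF holomorphic_on_subset[OF holf sub] r0 disc])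
    also have "\<dots> = P0 * fact s * (2 / \<theta>) ^ s * eps j powr (\<alpha> - real s)"
      using \<theta> eps(1)[of j] by (simp add: powr_diff powr_realpow power_divide power_mult_distrib)
    also have "\<dots> \<le> P * eps j powr (\<alpha> - real s)"
    proof -
      have "(2 / \<theta>) ^ s \<le> (1 + 2 / \<theta>) ^ s" using \<theta> by (intro power_mono) auto
      also have "\<dots> \<le> (1 + 2 / \<theta>) ^ n" using \<theta> s by (intro power_increasing) auto
      finally show ?thesis
        unfolding P_def using P0 \<theta> s by (intro mult_right_mono mult_mono mult_left_mono fact_mono) auto
    qed
    finally show ?thesis .
  qed
  moreover have "P \<ge> 0" using P0 \<theta> by (simp add: P_def)
  ultimately show ?thesis by (intro that)
qed

end

subsection \<open>Splitting the quotient by a finite Blaschke product\<close>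

lemma higher_deriv_sum:
  fixes F :: "'i \<Rightarrow> complex \<Rightarrow> complex"
  assumes "finite S" "open A" "w \<in> A" "\<And>j. j \<in> S \<Longrightarrow> F j holomorphic_on A"
  shows "(deriv ^^ m) (\<lambda>x. \<Sum>j\<in>S. F j x) w = (\<Sum>j\<in>S. (deriv ^^ m) (F j) w)"
  using assms(1,4)
proof (induction S rule: finite_induct)
  case empty
  have "(deriv ^^ m) (\<lambda>_. 0) w = (0::complex)" by (induction m arbitrary: w) auto
  then show ?case by simp
next
  case (insert j S)
  have "(deriv ^^ m) (\<lambda>x. F j x + (\<Sum>j\<in>S. F j x)) w = (deriv ^^ m) (F j) w + (deriv ^^ m) (\<lambda>x. \<Sum>j\<in>S. F j x) w"
    using insert.prems by (intro higher_deriv_add[OF _ _ assms(2,3)] holomorphic_intros) auto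
  then show ?case using insert by simp
qed

context carleson_seq
begin

text \<open>With \<open>X\<close> the modulus in the denominator, the term is at most
  \<open>eps l / X ^ 2\<close> times \<open>X powr (\<alpha> - (n + 1))\<close>. This exponent is
  negative, so \<open>1 - norm w\<close> can replace \<open>X\<close>, and the Carleson sum remains.
  With \<open>n + 2\<close> in the denominator it would be positive; hence one more derivative than
  the product needs.\<close>

lemma carleson_decay_sum:
  assumes \<alpha>: "real n < \<alpha>" "\<alpha> < real n + 1"
  obtains K where "K > 0" "\<And>(S :: nat set) w. finite S \<Longrightarrow> w \<in> \<D> \<Longrightarrow>
    (\<Sum>l\<in>S. eps l powr (\<alpha> + 1) / norm (1 - cnj (z l) * w) ^ (n + 3)) \<le> K * (1 - norm w) powr (\<alpha> - real (n + 2))"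
proof -
  obtain K where K: "K > 0" "\<And>(S :: nat set) w. finite S \<Longrightarrow> w \<in> \<D> \<Longrightarrow>
    (\<Sum>l\<in>S. eps l / norm (1 - cnj (z l) * w) ^ 2) \<le> K / (1 - norm w)"
    by (rule carleson_measure) (rule that)
  have "(\<Sum>l\<in>S. eps l powr (\<alpha> + 1) / norm (1 - cnj (z l) * w) ^ (n + 3)) \<le> K * (1 - norm w) powr (\<alpha> - real (n + 2))"
    if S: "finite S" and w: "w \<in> \<D>" for S :: "nat set" and w
  proof -
    define r where "r = 1 - norm w"
    have r: "0 < r" using w by (simp add: r_def)
    have "(\<Sum>l\<in>S. eps l powr (\<alpha> + 1) / norm (1 - cnj (z l) * w) ^ (n + 3))
        \<le> (\<Sum>l\<in>S. eps l / norm (1 - cnj (z l) * w) ^ 2 * r powr (\<alpha> - real (n + 1)))"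
    proof (rule sum_mono)
      fix l
      define X where "X = norm (1 - cnj (z l) * w)"
      have X: "0 < X" "eps l \<le> X" "r \<le> X"
        using one_minus_cnj_bounds[of "z l" w] norm_z[of l] w by (auto simp: X_def eps_def r_def)
      have "eps l powr (\<alpha> + 1) / X ^ (n + 3) = eps l * eps l powr \<alpha> / X ^ (n + 3)"
        using eps(1)[of l] by (simp add: powr_add mult.commute)
      also have "\<dots> \<le> eps l * X powr \<alpha> / X ^ (n + 3)"
        using X eps(1)[of l] \<alpha> by (intro divide_right_mono mult_left_mono powr_mono2) auto
      also have "\<dots> = eps l / X ^ 2 * (X powr \<alpha> / X ^ (n + 1))"
      proof -
        have "X ^ (n + 3) = X ^ 2 * X ^ (n + 1)" unfolding power_add[symmetric] by (rule arg_cong[where f = "\<lambda>i. X ^ i"]) simp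
        then show ?thesis by (simp only: times_divide_times_eq)
      qed
      also have "X powr \<alpha> / X ^ (n + 1) = X powr (\<alpha> - real (n + 1))"
        using X by (simp only: powr_diff powr_realpow)
      also have "eps l / X ^ 2 * X powr (\<alpha> - real (n + 1)) \<le> eps l / X ^ 2 * r powr (\<alpha> - real (n + 1))"
        using X r eps(1)[of l] \<alpha> by (intro mult_left_mono powr_mono2') auto
      finally show "eps l powr (\<alpha> + 1) / norm (1 - cnj (z l) * w) ^ (n + 3)
          \<le> eps l / norm (1 - cnj (z l) * w) ^ 2 * r powr (\<alpha> - real (n + 1))" by (simp only: X_def)
    qed
    also have "\<dots> = (\<Sum>l\<in>S. eps l / norm (1 - cnj (z l) * w) ^ 2) * r powr (\<alpha> - real (n + 1))"
      by (simp add: sum_distrib_right)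
    also have "\<dots> \<le> K / r * r powr (\<alpha> - real (n + 1))"
      using K(2)[OF S w] by (intro mult_right_mono) (auto simp: r_def)
    also have "\<dots> = K * r powr (\<alpha> - real (n + 2))"
    proof -
      have "r powr (\<alpha> - real (n + 2)) = r powr (\<alpha> - real (n + 1)) / r"
        using r powr_diff[of r "\<alpha> - real (n + 1)" 1] by (simp add: algebra_simps)
      then show ?thesis by simp
    qed
    finally show ?thesis by (simp add: r_def)
  qed
  with K(1) show ?thesis by (intro that[of K])
qed

text \<open>For \<open>j\<close> in \<open>S\<close>, the residue of \<open>f / fb S\<close> at
  \<open>z j\<close>.\<close>

definition principal_coeff :: "(complex \<Rightarrow> complex) \<Rightarrow> nat set \<Rightarrow> nat \<Rightarrow> complex" where
  "principal_coeff f S j = f (z j) * complex_of_real (1 - norm (z j) ^ 2)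
     / (blaschke_const (z j) * fb (S - {j}) (z j))"

lemma norm_principal_coeff_le:
  assumes P: "P \<ge> 0" "\<And>j. norm (f (z j)) \<le> P * eps j powr \<alpha>" and S: "finite S"
  shows "norm (principal_coeff f S j) \<le> 2 * P / \<delta> * eps j powr (\<alpha> + 1)"
proof -
  have "1 - norm (z j) ^ 2 = (1 + norm (z j)) * eps j" by (simp add: eps_def power2_eq_square algebra_simps)
  moreover have "(1 + norm (z j)) * eps j \<le> 2 * eps j" "0 \<le> (1 + norm (z j)) * eps j"
    using norm_z[of j] eps(1)[of j] by (auto intro!: mult_right_mono)
  ultimately have 1: "norm (complex_of_real (1 - norm (z j) ^ 2)) \<le> 2 * eps j"
    by (simp only: norm_of_real abs_of_nonneg)
  have "norm (principal_coeff f S j) \<le> (P * eps j powr \<alpha>) * (2 * eps j) / (1 * \<delta>)"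
    unfolding principal_coeff_def norm_divide norm_mult norm_blaschke_const
    using 1 P carleson[of "S - {j}" j] S \<delta>_pos eps(1)[of j]
    by (intro frac_le mult_mono mult_nonneg_nonneg) auto
  also have "\<dots> = 2 * P / \<delta> * eps j powr (\<alpha> + 1)" using eps(1)[of j] by (simp add: powr_add)
  finally show ?thesis .
qed

text \<open>Multiplied by \<open>fb S\<close>, the principal parts become the functions
  \<open>G j\<close>, bounded by \<open>norm (p j) / eps j\<close> on the disc. Subtracting them
  from \<open>f\<close> gives a function vanishing at the zeros in \<open>S\<close>, and dividing it
  by \<open>fb S\<close> does not enlarge its bound.\<close>

lemma quotient_split:
  assumes S: "finite S" and holf: "f holomorphic_on \<D>"
    and b: "\<And>w. w \<in> \<D> \<Longrightarrow> norm (f w) \<le> Mf"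
    and Q: "(\<Sum>j\<in>S. norm (principal_coeff f S j) / eps j) \<le> Q"
  obtains q where "q holomorphic_on \<D>" "\<And>w. w \<in> \<D> \<Longrightarrow> norm (q w) \<le> Mf + Q"
    "\<And>w. w \<in> \<D> \<Longrightarrow> w \<notin> z ` S \<Longrightarrow> q w = f w * (1 / fb S w) - (\<Sum>j\<in>S. principal_coeff f S j / (w - z j))"
proof -
  define p where "p = principal_coeff f S"
  define G where "G = (\<lambda>j w. p j * (blaschke_const (z j) * fb (S - {j}) w / (1 - cnj (z j) * w)))"
  define U where "U = (\<lambda>w. f w - (\<Sum>j\<in>S. G j w))"
  have nz: "1 - cnj (z j) * w \<noteq> 0" if "w \<in> \<D>" for j w
    using one_minus_cnj_bounds(4)[of "z j" w] norm_z[of j] that by auto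
  have holG: "G j holomorphic_on \<D>" for j
    unfolding G_def using nz by (intro holomorphic_on_mult holomorphic_on_divide holomorphic_fb holomorphic_intros) auto
  have holU: "U holomorphic_on \<D>" unfolding U_def by (intro holomorphic_intros holf holG)
  have Ub: "norm (U w) \<le> Mf + Q" if w: "w \<in> \<D>" for w
  proof -
    have "norm (\<Sum>j\<in>S. G j w) \<le> (\<Sum>j\<in>S. norm (p j) / eps j)"
    proof (rule sum_norm_le)
      fix j
      have X: "eps j \<le> norm (1 - cnj (z j) * w)"
        using one_minus_cnj_bounds(1)[of "z j" w] norm_z[of j] w by (simp add: eps_def)
      have "norm (G j w) = norm (p j) * (norm (fb (S - {j}) w) / norm (1 - cnj (z j) * w))"
        by (simp add: G_def norm_mult norm_divide)
      also have "\<dots> \<le> norm (p j) * (1 / eps j)"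
        using X norm_fb_le_1[of w "S - {j}"] w eps(1)[of j] by (intro mult_left_mono frac_le) auto
      finally show "norm (G j w) \<le> norm (p j) / eps j" by simp
    qed
    then show ?thesis
      using b[OF w] Q norm_triangle_ineq4[of "f w" "\<Sum>j\<in>S. G j w"] by (simp add: U_def p_def)
  qed
  have Uz: "U (z i) = 0" if i: "i \<in> S" for i
  proof -
    have zi: "norm (z i) < 1" by (rule norm_z)
    have "G j (z i) = 0" if "j \<in> S - {i}" for j
    proof -
      have "fb (S - {j}) (z i) = 0"
        using fb_eq_0_iff[of "S - {j}" "z i"] S i that zi by auto
      then show ?thesis by (simp add: G_def)
    qed
    then have "(\<Sum>j\<in>S. G j (z i)) = G i (z i)" using S i by (simp add: sum.remove)
    also have "\<dots> = f (z i)"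
    proof -
      have "fb (S - {i}) (z i) \<noteq> 0" using carleson[of "S - {i}" i] S \<delta>_pos by auto
      moreover have e: "complex_of_real (1 - norm (z i) ^ 2) = 1 - cnj (z i) * z i"
        using complex_norm_square[of "z i"] by (simp add: mult.commute)
      moreover have "1 - cnj (z i) * z i \<noteq> 0" using nz[of "z i" i] zi by simp
      ultimately show ?thesis unfolding G_def p_def principal_coeff_def e by simp
    qed
    finally show ?thesis by (simp add: U_def)
  qed
  obtain q where q: "q holomorphic_on \<D>" "\<And>w. w \<in> \<D> \<Longrightarrow> U w = fb S w * q w"
    "\<And>w. w \<in> \<D> \<Longrightarrow> norm (q w) \<le> Mf + Q"
  proof (rule divide_finite_blaschke[of S z U "Mf + Q"])
    show "inj_on z S" using inj_z by (rule inj_on_subset) simp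
    show "norm (z j) < 1" for j by (rule norm_z)
    show "norm (U w) \<le> Mf + Q" if "w \<in> \<D>" for w by (rule Ub[OF that])
    show "U (z j) = 0" if "j \<in> S" for j by (rule Uz[OF that])
  qed ((rule S holU)+, rule that)
  show ?thesis
  proof (rule that[OF q(1) q(3)])
    fix w assume w: "w \<in> \<D>" "w \<notin> z ` S"
    have fb: "fb S w \<noteq> 0" using fb_eq_0_iff[OF S, of w] w by auto
    have "G j w / fb S w = p j / (w - z j)" if j: "j \<in> S" for j
    proof -
      have wz: "w - z j \<noteq> 0" using w j by auto
      have e: "fb S w = blaschke_const (z j) * ((w - z j) / (1 - cnj (z j) * w)) * fb (S - {j}) w"
        using finite_blaschke_remove[OF S j, of z w] by (simp only: blaschke_factor_eq)
      then have "fb (S - {j}) w \<noteq> 0" using fb by auto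
      then show ?thesis unfolding e G_def using nz[OF w(1), of j] wz by simp
    qed
    then have "(\<Sum>j\<in>S. G j w) / fb S w = (\<Sum>j\<in>S. p j / (w - z j))"
      unfolding sum_divide_distrib by (intro sum.cong) auto
    moreover have "q w = U w / fb S w" using q(2)[OF w(1)] fb by simp
    ultimately show "q w = f w * (1 / fb S w) - (\<Sum>j\<in>S. principal_coeff f S j / (w - z j))"
      by (simp add: U_def p_def diff_divide_distrib)
  qed
qed

text \<open>Away from the zeros \<open>f / B\<close> and the principal parts are estimated separately; near a zero
  their difference is holomorphic and the maximum principle applies.\<close>

lemma quotient_deriv_bound:
  assumes f: "f \<in> A_space \<alpha>" and \<alpha>: "real n < \<alpha>" "\<alpha> < real n + 1"
    and P: "P \<ge> 0" "\<And>s j. s \<le> n \<Longrightarrow> norm ((deriv ^^ s) f (z j)) \<le> P * eps j powr (\<alpha> - real s)"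
  obtains M where "\<And>S q w. finite S \<Longrightarrow> S \<noteq> {} \<Longrightarrow> q holomorphic_on \<D> \<Longrightarrow>
    \<forall>w\<in>\<D> - z ` S. q w = f w * (1 / fb S w) - (\<Sum>j\<in>S. principal_coeff f S j / (w - z j)) \<Longrightarrow>
    w \<in> \<D> \<Longrightarrow> norm ((deriv ^^ (n + 2)) q w) \<le> M * (1 - norm w) powr (\<alpha> - real (n + 2))"
proof -
  define m where "m = n + 2"
  have \<alpha>m: "0 < \<alpha>" "\<alpha> < real m" using \<alpha> by (auto simp: m_def)
  obtain C where tb: "taylor_bound n \<alpha> C f" using A_space_taylor[OF f \<alpha>] .
  note C = taylor_boundD[OF tb]
  note holf = A_space_holomorphic[OF f]
  obtain K where K: "K > 0" "\<And>(S :: nat set) w. finite S \<Longrightarrow> w \<in> \<D> \<Longrightarrow>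
    (\<Sum>l\<in>S. eps l powr (\<alpha> + 1) / norm (1 - cnj (z l) * w) ^ (n + 3)) \<le> K * (1 - norm w) powr (\<alpha> - real (n + 2))"
    by (rule carleson_decay_sum[OF \<alpha>]) (rule that)
  have f0: "norm (f (z j)) \<le> P * eps j powr \<alpha>" for j using P(2)[of 0 j] by simp
  define \<theta> where "\<theta> = \<delta> / 8"
  have \<theta>: "0 < \<theta>" "\<theta> \<le> 1 / 8" using \<delta>_pos \<delta>_le_1 by (auto simp: \<theta>_def)
  \<comment> \<open>Off the small discs \<open>eps j \<le> D0 / \<theta>\<close>, so
    \<open>D = \<kappa> * D0\<close> dominates both \<open>eps j\<close> and
    \<open>1 - norm w\<close>; \<open>c\<close> is then chosen to make \<open>c * D\<close> the
    radius \<open>D0 / 12\<close> of the extension.\<close>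
  define \<kappa> where "\<kappa> = 1 / \<theta> + 1"
  have \<kappa>: "1 \<le> \<kappa>" using \<theta> by (simp add: \<kappa>_def)
  then have \<kappa>0: "0 < \<kappa>" by simp
  define c where "c = 1 / (12 * \<kappa>)"
  have c: "0 < c" "c \<le> 1 / 2" using \<kappa> \<kappa>0 by (auto simp: c_def divide_le_eq)
  define C1 where "C1 = real (Suc n) * (C + P * 2 powr \<alpha>)"
  have C1: "C \<le> C1"
  proof -
    have "1 * (C + 0) \<le> real (Suc n) * (C + P * 2 powr \<alpha>)" using C P by (intro mult_mono add_mono) auto
    then show ?thesis by (simp add: C1_def)
  qed
  define K1 where "K1 = 96 * (\<kappa> + 1) / \<delta>\<^sup>2"
  define M1 where "M1 = 2 * fact m * C1 * K1 * (2 / c) ^ m"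
  define Pc where "Pc = 2 * P / \<delta>"
  have Pc: "0 \<le> Pc" using P \<delta>_pos by (simp add: Pc_def)
  define A where "A = fact m * (2 * Pc) * 4 ^ m * (2 / \<theta> + 1) ^ (m + 1)"
  have A: "0 \<le> A" using Pc \<theta> by (simp add: A_def)
  define M0 where "M0 = M1 + A * K"
  have away: "norm ((deriv ^^ m) q w) \<le> M0 * (1 - norm w) powr (\<alpha> - real m)"
    if S: "finite S" "S \<noteq> {}" and holq: "q holomorphic_on \<D>"
      and q: "\<And>w. w \<in> \<D> \<Longrightarrow> w \<notin> z ` S \<Longrightarrow> q w = f w * (1 / fb S w) - (\<Sum>j\<in>S. principal_coeff f S j / (w - z j))"
      and w: "w \<in> \<D>" and far: "\<And>l. l \<in> S \<Longrightarrow> \<theta> * eps l \<le> norm (w - z l)" for S q w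
  proof -
    define r where "r = 1 - norm w"
    obtain j where j: "j \<in> S" "\<And>l. l \<in> S \<Longrightarrow> norm (w - z j) \<le> norm (w - z l)"
      using ex_is_arg_min_if_finite[OF S, of "\<lambda>l. norm (w - z l)"] by (auto simp: is_arg_min_linorder)
    define D0 where "D0 = norm (w - z j)"
    have epsD0: "eps j \<le> D0 / \<theta>" using far[OF j(1)] \<theta> by (simp add: D0_def field_simps)
    have D0: "0 < D0" unfolding D0_def using less_le_trans[OF mult_pos_pos[OF \<theta>(1) eps(1)[of j]] far[OF j(1)]] .
    define D where "D = \<kappa> * D0"
    have rD: "1 - norm w \<le> D"
    proof -
      have "1 - norm w \<le> eps j + D0" using norm_triangle_sub[of "z j" w] by (simp add: eps_def D0_def norm_minus_commute)
      also have "\<dots> \<le> D0 / \<theta> + D0" using epsD0 by simp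
      also have "\<dots> = D" by (simp add: D_def \<kappa>_def distrib_right)
      finally show ?thesis .
    qed
    have D: "0 < D" "D0 \<le> D" "eps j \<le> D" "c * D = D0 / 12"
    proof -
      show "0 < D" using \<kappa>0 D0 by (simp add: D_def)
      show "D0 \<le> D" using \<kappa> D0 by (simp add: D_def)
      have "D = D0 / \<theta> + D0" by (simp add: D_def \<kappa>_def distrib_right)
      then show "eps j \<le> D" using epsD0 D0 by linarith
      show "c * D = D0 / 12" using \<kappa>0 by (simp add: c_def D_def)
    qed
    have ext: "(\<lambda>x. 1 / fb S x) holomorphic_on ball w (D0 / 12)"
      "\<And>x. x \<in> ball w (D0 / 12) \<Longrightarrow> norm (1 / fb S x) \<le> K1"
      using fb_inverse_extension[OF S(1) w D0, of \<kappa>] j(2) rD \<kappa>0 by (simp_all add: D0_def K1_def D_def)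
    have 1: "norm ((deriv ^^ m) (\<lambda>x. f x * (1 / fb S x)) w)
      \<le> 2 * fact m * C1 * K1 * (2 / c) ^ m * (1 - norm w) powr (\<alpha> - real m)"
    proof (rule norm_higher_deriv_mult_le[OF w rD c \<alpha>m holf, of "taylor f n w"])
      show "(\<lambda>x. 1 / fb S x) holomorphic_on ball w (c * D)" unfolding D(4) by (rule ext(1))
      show "norm (1 / fb S x) \<le> K1" if "x \<in> ball w (c * D)" for x
        using that unfolding D(4) by (rule ext(2))
      show "norm (taylor f n w x) \<le> C1 * D powr \<alpha>" if x: "x \<in> ball w (c * D)" for x
        unfolding C1_def
      proof (rule taylor_poly_bound_of_jet[OF tb \<alpha>(1) P(1) w, of "z j"])
        show "norm (w - z j) \<le> D" using D by (simp add: D0_def)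
        have "norm (x - w) < D0 / 12" using x unfolding D(4) by (simp add: dist_norm norm_minus_commute)
        then show "norm (x - w) \<le> D" using D(2) D0 by linarith
        fix s assume s: "s \<le> n"
        have "P * eps j powr (\<alpha> - real s) \<le> P * D powr (\<alpha> - real s)"
          using P D eps(1)[of j] s \<alpha> by (intro mult_left_mono powr_mono2) auto
        then show "norm ((deriv ^^ s) f (z j)) \<le> P * D powr (\<alpha> - real s)" using P(2)[OF s, of j] by linarith
      qed (use norm_z D(1) in auto)
      show "norm (f x - taylor f n w x) \<le> C1 * (1 - norm w) powr \<alpha>"
        if x: "x \<in> ball w (c * (1 - norm w))" for x
      proof -
        have "c * (1 - norm w) \<le> 1 * (1 - norm w)" using c w by (intro mult_right_mono) auto
        moreover have "norm (x - w) < c * (1 - norm w)" using x by (simp add: dist_norm norm_minus_commute)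
        ultimately have xw: "norm (x - w) < 1 - norm w" by simp
        then have "x \<in> \<D>" using norm_triangle_sub[of x w] by simp
        then have "norm (f x - taylor f n w x) \<le> C * norm (x - w) powr \<alpha>"
          using C(2)[of 0 x w] w by simp
        also have "\<dots> \<le> C1 * (1 - norm w) powr \<alpha>" using C C1 xw \<alpha>m by (intro mult_mono powr_mono2) auto
        finally show ?thesis .
      qed
    qed (rule holomorphic_taylor_poly)
    have 2: "norm ((deriv ^^ m) (\<lambda>x. principal_coeff f S l / (x - z l)) w)
        \<le> A * (eps l powr (\<alpha> + 1) / norm (1 - cnj (z l) * w) ^ (n + 3))" if l: "l \<in> S" for l
    proof -
      define E where "E = norm (w - z l)"
      have E: "0 < E" unfolding E_def using less_le_trans[OF mult_pos_pos[OF \<theta>(1) eps(1)[of l]] far[OF l]] .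
      define X where "X = norm (1 - cnj (z l) * w)"
      have X: "0 < X" using one_minus_cnj_bounds(4)[of "z l" w] norm_z[of l] w by (simp add: X_def)
      have "eps l \<le> E / \<theta>" using far[OF l] \<theta> by (simp add: E_def field_simps)
      moreover have "X \<le> 2 * eps l + E" using one_minus_cnj_bounds(5)[of "z l" w] norm_z[of l] w by (simp add: X_def E_def eps_def)
      ultimately have "X \<le> 2 * (E / \<theta>) + E" by linarith
      also have "\<dots> = (2 / \<theta> + 1) * E" by (simp add: distrib_right)
      finally have XE: "X \<le> (2 / \<theta> + 1) * E" .
      have far': "E / 2 \<le> norm (y - z l)" if "y \<in> ball w (E / 2)" for y
        using norm_triangle_ineq[of "w - y" "y - z l"] that by (simp add: E_def dist_norm)
      have pc: "norm (principal_coeff f S l) \<le> Pc * eps l powr (\<alpha> + 1)"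
        unfolding Pc_def by (rule norm_principal_coeff_le[OF P(1) f0 S(1)])
      have "norm ((deriv ^^ m) (\<lambda>x. principal_coeff f S l / (x - z l)) w)
          \<le> fact m * ((Pc * eps l powr (\<alpha> + 1)) / (E / 2)) * (2 / (E / 2)) ^ m"
      proof (rule norm_higher_deriv_ball_le)
        have "y - z l \<noteq> 0" if "y \<in> ball w (E / 2)" for y using far'[OF that] E by auto
        then show "(\<lambda>x. principal_coeff f S l / (x - z l)) holomorphic_on ball w (E / 2)"
          by (intro holomorphic_intros) auto
        show "norm (principal_coeff f S l / (y - z l)) \<le> (Pc * eps l powr (\<alpha> + 1)) / (E / 2)" if "y \<in> ball w (E / 2)" for y
          unfolding norm_divide using pc far'[OF that] E Pc by (intro frac_le) auto
      qed (use E in auto)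
      also have "\<dots> = (fact m * (2 * Pc) * 4 ^ m * eps l powr (\<alpha> + 1)) * (1 / E) ^ (m + 1)"
        by (simp add: power_divide)
      also have "\<dots> \<le> (fact m * (2 * Pc) * 4 ^ m * eps l powr (\<alpha> + 1)) * ((2 / \<theta> + 1) / X) ^ (m + 1)"
        using XE E X Pc \<theta> by (intro mult_left_mono power_mono) (auto simp: field_simps)
      also have "\<dots> = A * (eps l powr (\<alpha> + 1) / X ^ (m + 1))" by (simp add: A_def power_divide)
      finally show ?thesis by (simp add: X_def m_def numeral_3_eq_3)
    qed
    define V where "V = \<D> - z ` S"
    have wV: "w \<in> V"
    proof -
      have "w \<noteq> z l" if "l \<in> S" for l using far[OF that] mult_pos_pos[OF \<theta>(1) eps(1)[of l]] by auto
      then show ?thesis using w by (auto simp: V_def)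
    qed
    have V: "open V" using S by (auto simp: V_def intro!: open_Diff finite_imp_closed)
    have fbnz: "fb S x \<noteq> 0" if "x \<in> V" for x
      using fb_eq_0_iff[OF S(1), of x] that by (auto simp: V_def)
    have hol1: "(\<lambda>x. f x * (1 / fb S x)) holomorphic_on V"
      using fbnz by (intro holomorphic_on_mult holomorphic_on_divide holomorphic_on_const
          holomorphic_on_subset[OF holf] holomorphic_on_subset[OF holomorphic_fb]) (auto simp: V_def)
    have hol2: "(\<lambda>x. principal_coeff f S l / (x - z l)) holomorphic_on V" if "l \<in> S" for l
      using that by (intro holomorphic_intros) (auto simp: V_def)
    have "(deriv ^^ m) q w = (deriv ^^ m) (\<lambda>x. f x * (1 / fb S x) - (\<Sum>j\<in>S. principal_coeff f S j / (x - z j))) w"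
      by (rule higher_deriv_cong_ev[OF eventually_mono[OF eventually_nhds_in_open[OF V wV]]]) (auto simp: V_def q)
    also have "\<dots> = (deriv ^^ m) (\<lambda>x. f x * (1 / fb S x)) w - (deriv ^^ m) (\<lambda>x. \<Sum>j\<in>S. principal_coeff f S j / (x - z j)) w"
      using hol2 by (intro higher_deriv_diff[OF hol1 _ V wV] holomorphic_on_sum) auto
    also have "(deriv ^^ m) (\<lambda>x. \<Sum>j\<in>S. principal_coeff f S j / (x - z j)) w = (\<Sum>j\<in>S. (deriv ^^ m) (\<lambda>x. principal_coeff f S j / (x - z j)) w)"
      using hol2 by (intro higher_deriv_sum[OF S(1) V wV]) auto
    finally have "norm ((deriv ^^ m) q w) \<le> norm ((deriv ^^ m) (\<lambda>x. f x * (1 / fb S x)) w)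
        + norm (\<Sum>j\<in>S. (deriv ^^ m) (\<lambda>x. principal_coeff f S j / (x - z j)) w)"
      by (simp only: norm_triangle_ineq4)
    also have "\<dots> \<le> M1 * (1 - norm w) powr (\<alpha> - real m) + (\<Sum>l\<in>S. A * (eps l powr (\<alpha> + 1) / norm (1 - cnj (z l) * w) ^ (n + 3)))"
      using 1 2 unfolding M1_def by (intro add_mono sum_norm_le) auto
    also have "(\<Sum>l\<in>S. A * (eps l powr (\<alpha> + 1) / norm (1 - cnj (z l) * w) ^ (n + 3))) \<le> A * (K * (1 - norm w) powr (\<alpha> - real m))"
      unfolding sum_distrib_left[symmetric] using K(2)[OF S(1) w] A by (intro mult_left_mono) (auto simp: m_def)
    finally show ?thesis by (simp add: M0_def distrib_right mult.assoc)
  qed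
  have M0: "0 \<le> M0"
    using C C1 c \<kappa> A K by (auto simp: M0_def M1_def K1_def intro!: add_nonneg_nonneg mult_nonneg_nonneg)
  \<comment> \<open>The factor is the price of the maximum principle: \<open>1 - norm\<close> at
    \<open>w\<close> is at most four times its value on the surrounding circle.\<close>
  define M where "M = M0 * 4 powr (real m - \<alpha>)"
  have M0M: "M0 \<le> M"
    using M0 \<alpha>m mult_left_mono[OF ge_one_powr_ge_zero[of 4 "real m - \<alpha>"] M0] by (simp add: M_def)
  have "norm ((deriv ^^ m) q w) \<le> M * (1 - norm w) powr (\<alpha> - real m)"
    if S: "finite S" "S \<noteq> {}" and holq: "q holomorphic_on \<D>"
      and q': "\<forall>w\<in>\<D> - z ` S. q w = f w * (1 / fb S w) - (\<Sum>j\<in>S. principal_coeff f S j / (w - z j))"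
      and w: "w \<in> \<D>" for S q w
  proof (cases "\<exists>j\<in>S. norm (w - z j) < \<theta> * eps j")
    case False
    then have "norm ((deriv ^^ m) q w) \<le> M0 * (1 - norm w) powr (\<alpha> - real m)"
      by (intro away[OF S holq bspec[OF q', OF DiffI] w]) (auto simp: not_less)
    also have "\<dots> \<le> M * (1 - norm w) powr (\<alpha> - real m)" using M0M by (intro mult_right_mono) auto
    finally show ?thesis .
  next
    case True
    then obtain j where j: "j \<in> S" "norm (w - z j) < \<theta> * eps j" by blast
    define \<rho> where "\<rho> = \<theta> * eps j"
    have \<rho>: "0 < \<rho>" "\<rho> \<le> eps j / 8" using \<theta> eps(1)[of j] mult_right_mono[OF \<theta>(2), of "eps j"] by (auto simp: \<rho>_def)
    have sub: "cball (z j) \<rho> \<subseteq> \<D>"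
    proof
      fix x assume "x \<in> cball (z j) \<rho>"
      then have "norm (x - z j) < eps j" using \<rho> eps(1)[of j] by (simp add: dist_norm norm_minus_commute)
      then show "x \<in> \<D>" by (rule ball_eps_subset)
    qed
    have hold: "(deriv ^^ m) q holomorphic_on \<D>" by (intro holomorphic_higher_deriv holq) auto
    have "norm ((deriv ^^ m) q w) \<le> M0 * (eps j / 2) powr (\<alpha> - real m)"
    proof (rule maximum_modulus_frontier[of "(deriv ^^ m) q" "ball (z j) \<rho>"])
      have "ball (z j) \<rho> \<subseteq> \<D>" using sub ball_subset_cball by blast
      then show "(deriv ^^ m) q holomorphic_on interior (ball (z j) \<rho>)"
        unfolding interior_open[OF open_ball] by (rule holomorphic_on_subset[OF hold])
      show "continuous_on (closure (ball (z j) \<rho>)) ((deriv ^^ m) q)"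
        using sub \<rho> by (intro holomorphic_on_imp_continuous_on holomorphic_on_subset[OF hold]) auto
      show "w \<in> ball (z j) \<rho>" using j(2) by (simp add: \<rho>_def dist_norm norm_minus_commute)
      fix x assume "x \<in> frontier (ball (z j) \<rho>)"
      then have x: "norm (x - z j) = \<rho>" using \<rho> by (simp add: dist_norm norm_minus_commute)
      then have xD: "x \<in> \<D>" using sub by (auto simp: dist_norm norm_minus_commute)
      \<comment> \<open>So \<open>away\<close> applies on this circle: other zeros are separated
        from \<open>z j\<close> by at least \<open>\<delta>\<close> times either \<open>eps\<close>,
        while the radius uses only an eighth of that.\<close>
      have "\<theta> * eps l \<le> norm (x - z l)" if "l \<in> S" for l
      proof (cases "l = j")
        case True
        then show ?thesis using x by (simp add: \<rho>_def)
      next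
        case False
        have "norm (z j - z l) \<le> \<rho> + norm (x - z l)"
          using norm_triangle_ineq[of "z j - x" "x - z l"] x by (simp add: norm_minus_commute)
        moreover have "\<rho> = \<delta> * eps j / 8" "\<theta> * eps l = \<delta> * eps l / 8" by (simp_all add: \<rho>_def \<theta>_def)
        moreover have "0 < \<delta> * eps j" "0 < \<delta> * eps l" using \<delta>_pos eps(1) by auto
        ultimately show ?thesis using separated[OF False] by linarith
      qed
      from away[OF S holq bspec[OF q', OF DiffI] xD this]
      have "norm ((deriv ^^ m) q x) \<le> M0 * (1 - norm x) powr (\<alpha> - real m)" .
      also have "\<dots> \<le> M0 * (eps j / 2) powr (\<alpha> - real m)"
      proof (intro mult_left_mono powr_mono2' M0)
        show "eps j / 2 \<le> 1 - norm x" using norm_triangle_sub[of x "z j"] x \<rho> eps(1)[of j] by (simp add: eps_def)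
      qed (use eps(1)[of j] \<alpha>m in auto)
      finally show "norm ((deriv ^^ m) q x) \<le> M0 * (eps j / 2) powr (\<alpha> - real m)" .
    qed simp
    also have "\<dots> \<le> M0 * ((1 - norm w) / 4) powr (\<alpha> - real m)"
    proof (intro mult_left_mono powr_mono2' M0)
      have "1 - norm w \<le> eps j + norm (w - z j)" using norm_triangle_sub[of "z j" w] by (simp add: eps_def norm_minus_commute)
      moreover have "norm (w - z j) < \<rho>" using j(2) by (simp add: \<rho>_def)
      ultimately have "1 - norm w \<le> 2 * eps j" using \<rho> eps(1)[of j] by linarith
      then show "(1 - norm w) / 4 \<le> eps j / 2" by simp
    qed (use w \<alpha>m in auto)
    also have "\<dots> = M * (1 - norm w) powr (\<alpha> - real m)"
    proof -
      have "((1 - norm w) / 4) powr (\<alpha> - real m) = (1 - norm w) powr (\<alpha> - real m) / 4 powr (\<alpha> - real m)"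
        by (rule powr_divide)
      also have "\<dots> = (1 - norm w) powr (\<alpha> - real m) * 4 powr (real m - \<alpha>)"
        using powr_minus_divide[of 4 "\<alpha> - real m"] by simp
      finally show ?thesis by (simp add: M_def)
    qed
    finally show ?thesis .
  qed
  then show ?thesis unfolding m_def by (rule that)
qed

end

section \<open>Boundary values of the principal parts\<close>

context carleson_seq
begin

lemma eps_powr_le:
  assumes "1 \<le> \<alpha>"
  shows "eps j powr \<alpha> \<le> eps j"
  using powr_mono'[of 1 \<alpha> "eps j"] assms eps[of j] by simp

text \<open>With \<open>w = r * cis t\<close>, the second fraction is the conjugate of
  \<open>w / (1 - cnj (z j) * w)\<close>, which agrees with \<open>1 / (w - z j)\<close> at
  \<open>r = 1\<close>. For almost every \<open>t\<close> both are eventually bounded by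
  \<open>1 / eps j\<close> along the whole radius, so Tannery's theorem applies with the summable
  majorant \<open>2 * eps j\<close>.\<close>

lemma boundary_sum_tendsto:
  assumes z: "blaschke_seq z" and \<alpha>: "1 \<le> \<alpha>"
    and far: "\<forall>\<^sub>F j in sequentially. 4 * (1 - norm (z j)) \<le> norm (cis t - z j)"
  defines "e \<equiv> \<lambda>j r. eps j powr (\<alpha> + 1) * norm (1 / (complex_of_real r * cis t - z j)
      - complex_of_real r / (cis t - complex_of_real r * z j))"
  shows "\<forall>\<^sub>F r in at_left 1. summable (\<lambda>j. e j r)" "((\<lambda>r. \<Sum>j. e j r) \<longlongrightarrow> 0) (at_left 1)"
proof -
  have r01: "\<forall>\<^sub>F r in at_left 1. r \<in> {0<..<(1::real)}" by (rule eventually_at_left_real) simp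
  have lim: "((\<lambda>r. e j r) \<longlongrightarrow> 0) (at_left 1)" for j
  proof -
    have nz: "cis t - z j \<noteq> 0" using norm_z[of j] by (metis eq_iff_diff_eq_0 less_irrefl norm_cis)
    have "((\<lambda>r. e j r) \<longlongrightarrow> eps j powr (\<alpha> + 1) * norm (1 / (complex_of_real 1 * cis t - z j)
      - complex_of_real 1 / (cis t - complex_of_real 1 * z j))) (at_left 1)"
      unfolding e_def using nz by (intro tendsto_intros) auto
    then show ?thesis by simp
  qed
  have le: "norm (e j r) \<le> 2 * eps j"
    if j: "4 * (1 - norm (z j)) \<le> norm (cis t - z j)" and r: "r \<in> {0<..<1}" for j r
  proof -
    define w where "w = complex_of_real r * cis t"
    have nw: "norm w = r" using r by (simp add: w_def norm_mult)
    have "cis t - w = complex_of_real (1 - r) * cis t" by (simp add: w_def algebra_simps)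
    then have cw: "norm (cis t - w) = 1 - r" using r by (simp only: norm_mult norm_of_real norm_cis) simp
    have 1: "eps j \<le> norm (w - z j)"
    proof (cases "1 - r \<le> 3 * eps j")
      case True
      then show ?thesis
        using j norm_triangle_ineq[of "cis t - w" "w - z j"] cw by (simp add: eps_def)
    next
      case False
      then show ?thesis
        using norm_triangle_ineq2[of "z j" w] nw eps(1)[of j] by (simp add: eps_def norm_minus_commute)
    qed
    have "norm (complex_of_real r * z j) \<le> norm (z j)" using r by (simp add: norm_mult mult_left_le_one_le)
    then have 2: "eps j \<le> norm (cis t - complex_of_real r * z j)"
      using norm_triangle_ineq2[of "cis t" "complex_of_real r * z j"] by (simp add: eps_def)
    have "norm (1 / (w - z j) - complex_of_real r / (cis t - complex_of_real r * z j))
        \<le> norm (1 / (w - z j)) + norm (complex_of_real r / (cis t - complex_of_real r * z j))"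
      by (rule norm_triangle_ineq4)
    also have "\<dots> \<le> 1 / eps j + 1 / eps j"
      unfolding norm_divide using 1 2 eps(1)[of j] r by (intro add_mono frac_le) auto
    finally have "e j r \<le> eps j powr (\<alpha> + 1) * (1 / eps j + 1 / eps j)"
      unfolding e_def w_def by (intro mult_left_mono) auto
    also have "\<dots> = 2 * eps j powr \<alpha>" using eps(1)[of j] by (simp add: powr_add)
    also have "\<dots> \<le> 2 * eps j" using eps_powr_le[OF \<alpha>] by simp
    finally show ?thesis by (simp add: e_def)
  qed
  have "\<forall>\<^sub>F x in at_top \<times>\<^sub>F at_left 1. case x of (j, r) \<Rightarrow> norm (e j r) \<le> 2 * eps j"
    by (rule eventually_mono[OF eventually_prodI[OF far r01]]) (use le in auto)
  moreover have "summable (\<lambda>j. 2 * eps j)"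
    unfolding eps_def by (intro summable_mult blaschke_seqD(2)[OF z])
  ultimately
  have *: "(\<forall>\<^sub>F r in at_left 1. summable (\<lambda>j. norm (e j r))) \<and> ((\<lambda>r. \<Sum>j. e j r) \<longlongrightarrow> (\<Sum>j. 0)) (at_left 1)"
    using tannerys_theorem[of e "\<lambda>_. 0" "at_left 1" "\<lambda>j. 2 * eps j", OF lim] by simp
  then show "\<forall>\<^sub>F r in at_left 1. summable (\<lambda>j. e j r)"
    by (auto elim!: eventually_mono intro: summable_norm_cancel)
  show "((\<lambda>r. \<Sum>j. e j r) \<longlongrightarrow> 0) (at_left 1)" using * by simp
qed

text \<open>\<open>g\<close> is a limit of the holomorphic parts from \<open>quotient_split\<close>,
  and \<open>h\<close> a limit of functions whose conjugates equal the sums of principal parts on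
  the circle. Inside the disc these two sums differ, and their difference is what
  \<open>boundary_sum_tendsto\<close> controls.\<close>

lemma division_of_small_jets:
  assumes z: "blaschke_seq z" and f: "f \<in> A_space \<alpha>" and \<alpha>: "real n < \<alpha>" "\<alpha> < real n + 1" "n \<ge> 1"
    and P: "P \<ge> 0" "\<And>s j. s \<le> n \<Longrightarrow> norm ((deriv ^^ s) f (z j)) \<le> P * eps j powr (\<alpha> - real s)"
  obtains g h where "g \<in> A_space \<alpha>" "h \<in> A_space \<alpha>"
    "AE t in lebesgue_on {0..2 * pi}.
      ((\<lambda>r. f (complex_of_real r * cis t) / blaschke_product z (complex_of_real r * cis t))
        \<longlongrightarrow> disc_ext g (cis t) + cnj (disc_ext h (cis t))) (at_left 1)"
proof -
  note holf = A_space_holomorphic[OF f]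
  define m where "m = n + 2"
  have \<alpha>m: "\<alpha> < real m" using \<alpha> by (simp add: m_def)
  have \<alpha>1: "1 \<le> \<alpha>" using \<alpha> by linarith
  obtain Mf where Mf: "Mf > 0" "\<And>w. w \<in> \<D> \<Longrightarrow> norm (f w) \<le> Mf" using A_space_boundedE[OF f] by blast
  have f0: "norm (f (z j)) \<le> P * eps j powr \<alpha>" for j using P(2)[of 0 j] by simp
  have sume: "summable eps" using blaschke_seqD(2)[OF z] by (simp add: eps_def[abs_def])
  define Pc where "Pc = 2 * P / \<delta>"
  have Pc: "0 \<le> Pc" using P \<delta>_pos by (simp add: Pc_def)
  define S where "S = (\<lambda>N::nat. {..N})"
  have S: "finite (S N)" "S N \<noteq> {}" for N by (auto simp: S_def)
  define p where "p = (\<lambda>N j. principal_coeff f (S N) j)"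
  have pb: "norm (p N j) \<le> Pc * eps j powr (\<alpha> + 1)" for N j
    unfolding p_def Pc_def by (rule norm_principal_coeff_le[OF P(1) f0 S(1)])
  define Q where "Q = Pc * suminf eps"
  have Qb: "(\<Sum>j\<in>S N. norm (p N j) / eps j) \<le> Q" for N
  proof -
    have "(\<Sum>j\<in>S N. norm (p N j) / eps j) \<le> (\<Sum>j\<in>S N. Pc * eps j)"
    proof (rule sum_mono)
      fix j
      have "norm (p N j) / eps j \<le> Pc * eps j powr (\<alpha> + 1) / eps j"
        using pb eps(1)[of j] by (intro divide_right_mono) auto
      also have "\<dots> = Pc * eps j powr \<alpha>" using eps(1)[of j] by (simp add: powr_add)
      also have "\<dots> \<le> Pc * eps j" using eps_powr_le[OF \<alpha>1] Pc by (intro mult_left_mono)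
      finally show "norm (p N j) / eps j \<le> Pc * eps j" .
    qed
    also have "\<dots> = Pc * sum eps (S N)" by (simp add: sum_distrib_left)
    also have "\<dots> \<le> Q"
      unfolding Q_def using Pc S eps by (intro mult_left_mono sum_le_suminf sume) (auto intro: less_imp_le)
    finally show ?thesis .
  qed
  define R where "R = (\<lambda>N q. q holomorphic_on \<D> \<and> (\<forall>w\<in>\<D>. norm (q w) \<le> Mf + Q) \<and>
     (\<forall>w\<in>\<D> - z ` S N. q w = f w * (1 / fb (S N) w) - (\<Sum>j\<in>S N. principal_coeff f (S N) j / (w - z j))))"
  have "\<forall>N. \<exists>q. R N q"
  proof
    fix N
    obtain q where "q holomorphic_on \<D>" "\<And>w. w \<in> \<D> \<Longrightarrow> norm (q w) \<le> Mf + Q"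
      "\<And>w. w \<in> \<D> \<Longrightarrow> w \<notin> z ` S N \<Longrightarrow> q w = f w * (1 / fb (S N) w) - (\<Sum>j\<in>S N. principal_coeff f (S N) j / (w - z j))"
    proof (rule quotient_split[of "S N" f Mf Q])
      show "(\<Sum>j\<in>S N. norm (principal_coeff f (S N) j) / eps j) \<le> Q" using Qb[of N] by (simp add: p_def)
      show "norm (f w) \<le> Mf" if "w \<in> \<D>" for w by (rule Mf(2)[OF that])
    qed ((rule S holf)+, rule that)
    then show "\<exists>q. R N q" unfolding R_def by (intro exI[of _ q]) auto
  qed
  then obtain q where Rq: "\<forall>N. R N (q N)" using choice by blast
  have q: "q N holomorphic_on \<D>" "\<And>w. w \<in> \<D> \<Longrightarrow> norm (q N w) \<le> Mf + Q"
    "\<forall>w\<in>\<D> - z ` S N. q N w = f w * (1 / fb (S N) w) - (\<Sum>j\<in>S N. principal_coeff f (S N) j / (w - z j))"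
    for N using Rq[rule_format, of N] unfolding R_def by auto
  obtain M where M: "\<And>N w. w \<in> \<D> \<Longrightarrow> norm ((deriv ^^ m) (q N) w) \<le> M * (1 - norm w) powr (\<alpha> - real m)"
  proof (rule quotient_deriv_bound[OF f \<alpha>(1,2) P])
    fix M assume M: "\<And>S q w. finite S \<Longrightarrow> S \<noteq> {} \<Longrightarrow> q holomorphic_on \<D> \<Longrightarrow>
    \<forall>w\<in>\<D> - z ` S. q w = f w * (1 / fb S w) - (\<Sum>j\<in>S. principal_coeff f S j / (w - z j)) \<Longrightarrow>
    w \<in> \<D> \<Longrightarrow> norm ((deriv ^^ (n + 2)) q w) \<le> M * (1 - norm w) powr (\<alpha> - real (n + 2))"
    show thesis
    proof (rule that)
      show "norm ((deriv ^^ m) (q N) w) \<le> M * (1 - norm w) powr (\<alpha> - real m)" if "w \<in> \<D>" for N w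
        unfolding m_def by (rule M[OF S q(1) q(3) that])
    qed
  qed assumption+
  \<comment> \<open>On the unit circle \<open>cnj (h0 N j w)\<close> equals
    \<open>p N j / (w - z j)\<close>: the pole has been reflected out of the disc.\<close>
  define h0 where "h0 = (\<lambda>N j w. cnj (p N j) * (w / (1 - cnj (z j) * w)))"
  define h1 where "h1 = (\<lambda>N w. \<Sum>j\<in>S N. h0 N j w)"
  have nz: "1 - cnj (z j) * w \<noteq> 0" if "w \<in> \<D>" for j w
    using one_minus_cnj_bounds(4)[of "z j" w] norm_z[of j] that by auto
  have holh0: "h0 N j holomorphic_on \<D>" for N j
    unfolding h0_def using nz by (intro holomorphic_intros) auto
  have holh: "h1 N holomorphic_on \<D>" for N unfolding h1_def by (intro holomorphic_on_sum holh0)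
  have hb: "norm (h1 N w) \<le> Q" if w: "w \<in> \<D>" for N w
  proof -
    have "norm (h1 N w) \<le> (\<Sum>j\<in>S N. norm (p N j) / eps j)"
      unfolding h1_def
    proof (rule sum_norm_le)
      fix j
      have X: "eps j \<le> norm (1 - cnj (z j) * w)"
        using one_minus_cnj_bounds(1)[of "z j" w] norm_z[of j] w by (simp add: eps_def)
      have "norm (h0 N j w) = norm (p N j) * (norm w / norm (1 - cnj (z j) * w))"
        by (simp add: h0_def norm_mult norm_divide)
      also have "\<dots> \<le> norm (p N j) * (1 / eps j)"
        using X w eps(1)[of j] by (intro mult_left_mono frac_le) auto
      finally show "norm (h0 N j w) \<le> norm (p N j) / eps j" by simp
    qed
    then show ?thesis using Qb[of N] by linarith
  qed
  obtain K where K: "K > 0" "\<And>(S :: nat set) w. finite S \<Longrightarrow> w \<in> \<D> \<Longrightarrow>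
    (\<Sum>l\<in>S. eps l powr (\<alpha> + 1) / norm (1 - cnj (z l) * w) ^ (n + 3)) \<le> K * (1 - norm w) powr (\<alpha> - real (n + 2))"
    by (rule carleson_decay_sum[OF \<alpha>(1,2)]) (rule that)
  define A where "A = fact m * Pc * 4 ^ (m + 1)"
  have A: "0 \<le> A" using Pc by (simp add: A_def)
  have hd: "norm ((deriv ^^ m) (h1 N) w) \<le> A * K * (1 - norm w) powr (\<alpha> - real m)" if w: "w \<in> \<D>" for N w
  proof -
    have "norm ((deriv ^^ m) (h0 N j) w) \<le> A * (eps j powr (\<alpha> + 1) / norm (1 - cnj (z j) * w) ^ (n + 3))" for j
    proof -
      define X where "X = norm (1 - cnj (z j) * w)"
      have X: "0 < X" "X \<le> 2" using nz[OF w, of j] one_minus_cnj_bounds(6)[of "z j" w] norm_z[of j] w by (auto simp: X_def)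
      have near: "X / 2 \<le> norm (1 - cnj (z j) * y)" "norm y \<le> 2" if y: "y \<in> ball w (X / 2)" for y
      proof -
        have yw: "norm (y - w) < X / 2" using y by (simp add: dist_norm norm_minus_commute)
        have "norm (cnj (z j) * (y - w)) \<le> norm (y - w)"
          using norm_z[of j] by (simp add: norm_mult mult_left_le_one_le)
        moreover have e: "1 - cnj (z j) * y = (1 - cnj (z j) * w) - cnj (z j) * (y - w)" by (simp add: algebra_simps)
        ultimately show "X / 2 \<le> norm (1 - cnj (z j) * y)"
          using norm_triangle_ineq2[of "1 - cnj (z j) * w" "cnj (z j) * (y - w)"] yw
          unfolding e X_def by linarith
        show "norm y \<le> 2" using norm_triangle_sub[of y w] yw X w by simp
      qed
      have "norm ((deriv ^^ m) (h0 N j) w) \<le> fact m * (Pc * eps j powr (\<alpha> + 1) * (2 / (X / 2))) * (2 / (X / 2)) ^ m"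
      proof (rule norm_higher_deriv_ball_le)
        have "1 - cnj (z j) * y \<noteq> 0" if "y \<in> ball w (X / 2)" for y using near(1)[OF that] X by auto
        then show "h0 N j holomorphic_on ball w (X / 2)"
          unfolding h0_def by (intro holomorphic_intros) auto
        show "norm (h0 N j y) \<le> Pc * eps j powr (\<alpha> + 1) * (2 / (X / 2))" if y: "y \<in> ball w (X / 2)" for y
          unfolding h0_def norm_mult norm_divide complex_mod_cnj
          using near[OF y] pb[of N j] X Pc by (intro mult_mono frac_le) (auto simp: norm_mult)
      qed (use X in auto)
      also have "\<dots> = A * (eps j powr (\<alpha> + 1) / X ^ (m + 1))" by (simp add: A_def power_divide)
      finally show ?thesis by (simp add: X_def m_def numeral_3_eq_3)
    qed
    then have "norm ((deriv ^^ m) (h1 N) w) \<le> (\<Sum>j\<in>S N. A * (eps j powr (\<alpha> + 1) / norm (1 - cnj (z j) * w) ^ (n + 3)))"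
      unfolding h1_def using w holh0
      by (subst higher_deriv_sum[OF S(1), of \<D>]) (auto intro: sum_norm_le)
    also have "\<dots> \<le> A * (K * (1 - norm w) powr (\<alpha> - real m))"
      unfolding sum_distrib_left[symmetric] using K(2)[OF S(1) w] A by (intro mult_left_mono) (auto simp: m_def)
    finally show ?thesis by (simp add: mult.assoc)
  qed
  obtain r1 g where g: "strict_mono (r1 :: nat \<Rightarrow> nat)" "g \<in> A_space \<alpha>"
    "\<And>w. w \<in> \<D> \<Longrightarrow> (\<lambda>N. q (r1 N) w) \<longlonglongrightarrow> g w"
    by (rule A_space_limit[of q "Mf + Q" \<alpha> m M]) (use q M \<alpha>m that in blast)+
  obtain r2 h where h: "strict_mono (r2 :: nat \<Rightarrow> nat)" "h \<in> A_space \<alpha>"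
    "\<And>w. w \<in> \<D> \<Longrightarrow> (\<lambda>N. h1 (r1 (r2 N)) w) \<longlonglongrightarrow> h w"
    by (rule A_space_limit[of "\<lambda>N. h1 (r1 N)" Q \<alpha> m "A * K"]) (use holh hb hd \<alpha>m that in blast)+
  \<comment> \<open>The second subsequence is extracted from the first, so both limits hold along
    the same indices.\<close>
  define r where "r = (\<lambda>N. r1 (r2 N))"
  have r: "strict_mono r" using strict_mono_o[OF g(1) h(1)] by (simp add: r_def o_def)
  have glim: "(\<lambda>N. q (r N) w) \<longlonglongrightarrow> g w" if "w \<in> \<D>" for w
    using LIMSEQ_subseq_LIMSEQ[OF g(3)[OF that] h(1)] by (simp add: o_def r_def)
  have hlim: "(\<lambda>N. h1 (r N) w) \<longlonglongrightarrow> h w" if "w \<in> \<D>" for w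
    using h(3)[OF that] by (simp add: r_def)
  show ?thesis
  proof (rule that[OF g(2) h(2)])
    show "AE t in lebesgue_on {0..2 * pi}.
      ((\<lambda>r. f (complex_of_real r * cis t) / blaschke_product z (complex_of_real r * cis t))
        \<longlongrightarrow> disc_ext g (cis t) + cnj (disc_ext h (cis t))) (at_left 1)"
      using blaschke_seq_AE_far[OF z]
    proof eventually_elim
      case (elim t)
      define e where "e = (\<lambda>j \<rho>. eps j powr (\<alpha> + 1) * norm (1 / (complex_of_real \<rho> * cis t - z j)
        - complex_of_real \<rho> / (cis t - complex_of_real \<rho> * z j)))"
      note e_lim = boundary_sum_tendsto[OF z \<alpha>1 elim]
      define \<Delta> where "\<Delta> = (\<lambda>w. f w / blaschke_product z w - g w - cnj (h w))"
      \<comment> \<open>The majorant must be independent of \<open>N\<close>: the limit in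
        \<open>N\<close> is taken first, at a fixed radius, and only afterwards does the radius tend
        to 1.\<close>
      have "\<forall>\<^sub>F \<rho> in at_left 1. norm (\<Delta> (complex_of_real \<rho> * cis t)) \<le> Pc * (\<Sum>j. e j \<rho>)"
      proof -
        have "\<forall>\<^sub>F \<rho> in at_left 1. \<rho> \<in> {0<..<(1::real)}" by (rule eventually_at_left_real) simp
        then show ?thesis
          using eventually_radius_avoids[OF norm_z elim] e_lim(1)
        proof eventually_elim
          case (elim \<rho>)
          define w where "w = complex_of_real \<rho> * cis t"
          have w: "w \<in> \<D>" "w \<notin> range z" using elim by (auto simp: w_def norm_mult)
          have B: "blaschke_product z w \<noteq> 0" using blaschke_product_eq_0_iff[OF z, of w] w by auto
          have fbl: "(\<lambda>N. fb (S (r N)) w) \<longlonglongrightarrow> blaschke_product z w"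
          proof -
            have "(\<lambda>N. fb (S N) w) \<longlonglongrightarrow> blaschke_product z w"
              unfolding S_def lessThan_Suc_atMost[symmetric] using w by (intro LIMSEQ_Suc finite_blaschke_tendsto z) auto
            from LIMSEQ_subseq_LIMSEQ[OF this r] show ?thesis by (simp add: o_def)
          qed
          have lim: "(\<lambda>N. f w * (1 / fb (S (r N)) w) - q (r N) w - cnj (h1 (r N) w)) \<longlonglongrightarrow> \<Delta> w"
            unfolding \<Delta>_def divide_inverse[of "f w"] inverse_eq_divide
            using w by (intro tendsto_intros fbl glim hlim B) auto
          have bd: "norm (f w * (1 / fb (S N) w) - q N w - cnj (h1 N w)) \<le> Pc * (\<Sum>j. e j \<rho>)" for N
          proof -
            have cw: "cnj w = complex_of_real \<rho> / cis t"
              by (simp add: w_def cis_cnj divide_inverse cis_inverse)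
            have "f w * (1 / fb (S N) w) - q N w - cnj (h1 N w)
                = (\<Sum>j\<in>S N. p N j / (w - z j)) - (\<Sum>j\<in>S N. p N j * (complex_of_real \<rho> / (cis t - complex_of_real \<rho> * z j)))"
            proof -
              have "w \<in> \<D> - z ` S N" using w by auto
              then have "q N w = f w * (1 / fb (S N) w) - (\<Sum>j\<in>S N. p N j / (w - z j))"
                using q(3)[of N] by (simp add: p_def)
              moreover have "cnj (h1 N w) = (\<Sum>j\<in>S N. p N j * (complex_of_real \<rho> / (cis t - complex_of_real \<rho> * z j)))"
                unfolding h1_def h0_def cnj_sum
              proof (intro sum.cong refl)
                fix j
                have "cnj w / (1 - z j * cnj w) = complex_of_real \<rho> / (cis t - complex_of_real \<rho> * z j)"
                proof -
                  have "1 - z j * cnj w = (cis t - complex_of_real \<rho> * z j) / cis t"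
                    by (simp add: cw field_simps)
                  then show ?thesis by (simp add: cw)
                qed
                then show "cnj (cnj (p N j) * (w / (1 - cnj (z j) * w))) = p N j * (complex_of_real \<rho> / (cis t - complex_of_real \<rho> * z j))"
                  by (simp only: complex_cnj_mult complex_cnj_divide complex_cnj_diff complex_cnj_one complex_cnj_cnj)
              qed
              ultimately show ?thesis by simp
            qed
            also have "\<dots> = (\<Sum>j\<in>S N. p N j * (1 / (w - z j) - complex_of_real \<rho> / (cis t - complex_of_real \<rho> * z j)))"
              by (simp add: sum_subtractf[symmetric] right_diff_distrib)
            also have "norm \<dots> \<le> (\<Sum>j\<in>S N. Pc * e j \<rho>)"
            proof (rule sum_norm_le)
              fix j
              have "norm (p N j * (1 / (w - z j) - complex_of_real \<rho> / (cis t - complex_of_real \<rho> * z j)))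
                  \<le> (Pc * eps j powr (\<alpha> + 1)) * norm (1 / (w - z j) - complex_of_real \<rho> / (cis t - complex_of_real \<rho> * z j))"
                unfolding norm_mult by (intro mult_right_mono pb) auto
              then show "norm (p N j * (1 / (w - z j) - complex_of_real \<rho> / (cis t - complex_of_real \<rho> * z j))) \<le> Pc * e j \<rho>"
                by (simp add: e_def w_def mult.assoc)
            qed
            also have "\<dots> = Pc * (\<Sum>j\<in>S N. e j \<rho>)" by (simp add: sum_distrib_left)
            also have "\<dots> \<le> Pc * (\<Sum>j. e j \<rho>)"
              using Pc S elim by (intro mult_left_mono sum_le_suminf) (auto simp: e_def)
            finally show ?thesis .
          qed
          show ?case
            using Lim_norm_ubound[OF _ lim] bd by (auto simp: w_def)
        qed
      qed
      moreover have "((\<lambda>\<rho>. Pc * (\<Sum>j. e j \<rho>)) \<longlongrightarrow> 0) (at_left 1)"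
        using tendsto_mult_right_zero[OF e_lim(2), of Pc] by (simp add: e_def)
      ultimately have "((\<lambda>\<rho>. \<Delta> (complex_of_real \<rho> * cis t)) \<longlongrightarrow> 0) (at_left 1)"
        by (rule Lim_null_comparison)
      then have "((\<lambda>\<rho>. \<Delta> (complex_of_real \<rho> * cis t) + g (complex_of_real \<rho> * cis t) + cnj (h (complex_of_real \<rho> * cis t)))
          \<longlongrightarrow> 0 + disc_ext g (cis t) + cnj (disc_ext h (cis t))) (at_left 1)"
        by (intro tendsto_add tendsto_cnj A_space_radial_limit[OF g(2) \<alpha>] A_space_radial_limit[OF h(2) \<alpha>])
      then show ?case by (simp add: \<Delta>_def)
    qed
  qed
qed

end

section \<open>The two implications\<close>

theorem corollary1p5:
  fixes n k :: nat and \<alpha> :: real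
    and z :: "nat \<Rightarrow> complex" and B :: "complex \<Rightarrow> complex"
  assumes "n \<ge> 1" and "real n < \<alpha>" and "\<alpha> < real n + 1"
    and "A_interpolating_blaschke n \<alpha> z B"
    and "real n / 2 < real k" and "k \<le> n"
  shows "J_mult \<alpha> B k \<subseteq> J_div \<alpha> B \<longleftrightarrow>
         bdd_above (range (\<lambda>j. sep_dist z j / (1 - norm (z j))))"
proof -
  note \<alpha> = assms(2,3,1) and int = assms(4)
  have z: "blaschke_seq z" "inj z" and B: "B = blaschke_product z"
    using int by (auto simp: A_interpolating_blaschke_def)
  obtain \<delta> where "carleson_seq z \<delta>" using interpolating_imp_carleson_seq[OF int \<alpha>] .
  then interpret carleson_seq z \<delta> .
  have d: "0 < sep_dist z j" for j by (rule sep_dist_pos[OF z])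
  show ?thesis
  proof
    assume sub: "J_mult \<alpha> B k \<subseteq> J_div \<alpha> B"
    obtain f where f: "f \<in> J_mult \<alpha> B k"
      "\<And>j. f (z j) = complex_of_real (sep_dist z j powr (\<alpha> - real k)) * (1 - cnj (z j) * z j) ^ k"
      by (rule J_mult_witness[OF int \<alpha> assms(6)]) (rule that)
    have fA: "f \<in> A_space \<alpha>" using f(1) by (simp add: J_mult_def)
    have "f \<in> J_div \<alpha> B" using sub f(1) by blast
    then obtain h0 where h0: "h0 \<in> Lambda_space \<alpha>" "has_boundary_function (\<lambda>w. f w / B w) h0"
      by (auto simp: J_div_def)
    then obtain g h where gh: "g \<in> A_space \<alpha>" "h \<in> A_space \<alpha>"
      "\<forall>\<zeta>\<in>sphere 0 1. h0 \<zeta> = disc_ext g \<zeta> + cnj (disc_ext h \<zeta>)"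
      by (auto simp: Lambda_space_def)
    have "h0 (cis t) = disc_ext g (cis t) + cnj (disc_ext h (cis t))" for t using gh(3) by simp
    then have ae: "AE t in lebesgue_on {0..2 * pi}.
      ((\<lambda>r. f (complex_of_real r * cis t) / blaschke_product z (complex_of_real r * cis t))
        \<longlongrightarrow> disc_ext g (cis t) + cnj (disc_ext h (cis t))) (at_left 1)"
      using h0(2) by (simp add: has_boundary_function_def B)
    obtain C where C: "\<And>j. norm (f (z j)) \<le> C * (1 - norm (z j)) powr \<alpha>"
      by (rule division_imp_decay[OF fA gh(1,2) \<alpha> z(1) ae]) (rule that)
    have \<alpha>k: "0 < \<alpha> - real k" using assms by linarith
    \<comment> \<open>Comparing the explicit value of the witness at \<open>z j\<close> with the
      decay leaves \<open>t powr (\<alpha> - k) \<le> C\<close>; the exponent is positive since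
      \<open>k \<le> n < \<alpha>\<close>.\<close>
    have "sep_dist z j / (1 - norm (z j)) \<le> C powr (1 / (\<alpha> - real k))" for j
    proof -
      define t where "t = sep_dist z j / eps j"
      have t: "0 < t" using d eps(1)[of j] by (simp add: t_def)
      have "eps j \<le> norm (1 - cnj (z j) * z j)"
        using one_minus_cnj_bounds(1)[of "z j" "z j"] norm_z[of j] by (simp add: eps_def)
      then have "sep_dist z j powr (\<alpha> - real k) * eps j ^ k \<le> norm (f (z j))"
        unfolding f(2) norm_mult norm_power using eps(1)[of j] by (intro mult_mono power_mono) auto
      also have "\<dots> \<le> C * eps j powr \<alpha>" using C[of j] by (simp add: eps_def)
      also have "eps j powr \<alpha> = eps j powr (\<alpha> - real k) * eps j ^ k"
        using eps(1)[of j] by (simp add: powr_diff powr_realpow)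
      finally have "sep_dist z j powr (\<alpha> - real k) \<le> C * eps j powr (\<alpha> - real k)"
        using eps(1)[of j] by (simp add: mult.assoc[symmetric])
      then have "t powr (\<alpha> - real k) \<le> C"
        using eps(1)[of j] by (simp add: t_def powr_divide divide_le_eq)
      then have "(t powr (\<alpha> - real k)) powr (1 / (\<alpha> - real k)) \<le> C powr (1 / (\<alpha> - real k))"
        using \<alpha>k by (intro powr_mono2) auto
      moreover have "(t powr (\<alpha> - real k)) powr (1 / (\<alpha> - real k)) = t"
        using t \<alpha>k by (simp add: powr_powr)
      ultimately show ?thesis by (simp only: t_def eps_def)
    qed
    then show "bdd_above (range (\<lambda>j. sep_dist z j / (1 - norm (z j))))"
      by (intro bdd_aboveI[of _ "C powr (1 / (\<alpha> - real k))"]) auto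
  next
    assume "bdd_above (range (\<lambda>j. sep_dist z j / (1 - norm (z j))))"
    then obtain M where M: "\<And>j. sep_dist z j / (1 - norm (z j)) \<le> M" by (auto simp: bdd_above_def)
    have M': "sep_dist z j \<le> M * eps j" for j
      using M[of j] eps(1)[of j] by (simp add: eps_def divide_le_eq)
    show "J_mult \<alpha> B k \<subseteq> J_div \<alpha> B"
    proof
      fix f assume "f \<in> J_mult \<alpha> B k"
      then have f: "f \<in> A_space \<alpha>" "(\<lambda>w. f w * blaschke_product z w ^ k) \<in> A_space \<alpha>"
        by (auto simp: J_mult_def B)
      have k: "n < 2 * k" using assms(5) by linarith
      obtain P where P: "P \<ge> 0" "\<And>s j. s \<le> n \<Longrightarrow> norm ((deriv ^^ s) f (z j)) \<le> P * eps j powr (\<alpha> - real s)"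
        by (rule jets_of_smooth_mult[OF z(1) f(1) \<alpha>(1,2) f(2) assms(6) k M']) (rule that)
      obtain g h where gh: "g \<in> A_space \<alpha>" "h \<in> A_space \<alpha>"
        "AE t in lebesgue_on {0..2 * pi}.
          ((\<lambda>r. f (complex_of_real r * cis t) / blaschke_product z (complex_of_real r * cis t))
            \<longlongrightarrow> disc_ext g (cis t) + cnj (disc_ext h (cis t))) (at_left 1)"
        by (rule division_of_small_jets[OF z(1) f(1) \<alpha> P]) (assumption | rule that)+
      define h0 where "h0 = (\<lambda>\<zeta>. disc_ext g \<zeta> + cnj (disc_ext h \<zeta>))"
      have "h0 \<in> Lambda_space \<alpha>" using gh(1,2) by (auto simp: Lambda_space_def h0_def)
      moreover have "has_boundary_function (\<lambda>w. f w / B w) h0"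
        using gh(3) by (simp add: has_boundary_function_def h0_def B)
      ultimately show "f \<in> J_div \<alpha> B" using f(1) by (auto simp: J_div_def)
    qed
  qed
qed

end
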